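(* Let $T$ be a free and ergodic measure-preserving action of a countable discrete amenable group $\Gamma$ on a standard probability space $(X,\mathcal F,\mu)$, and let $\mathcal A\subseteq\mathcal F$ be a $T$-invariant sub-$\sigma$-algebra. Let $U$ be a free (and necessarily ergodic) action of a group $\Gamma'$ (necessarily amenable) on $(X,\mathcal F,\mu)$ with the same orbits as $T$, and suppose that the orbit change from $T$ to $U$ is $\mathcal A$-measurable. Then for any finite partition $P$ of $X$, $$h(T,P\mid\mathcal A)=h(U,P\mid\mathcal A).$$
   Context: All actions are measure-preserving actions of countable discrete groups, with $T_\gamma T_{\gamma'}=T_{\gamma\gamma'}$. A finite partition $P$ is viewed as a measurable map $P:X\to\Sigma$ to a finite label set; $T_{\gamma^{-1}}(P)$ is the partition $x\mapsto P(T_\gamma x)$; $h(P)$ is Shannon entropy. For a Følner sequence $(H_i)$ of an amenable group $\Gamma$ (finite nonempty sets with $\#(\gamma H_i\triangle H_i)/\#H_i\to0$ for every $\gamma$), $h(T,P)=\lim_i \frac1{\#H_i}h(\bigvee_{\gamma\in H_i}T_{\gamma^{-1}}(P))$; the limit exists and is independent of the Følner sequence. For a $T$-invariant sub-$\sigma$-algebra $\mathcal A$, $$h(T,P\mid\mathcal A)=\inf\{h(T,P\vee Q)-h(T,Q): Q \text{ a finite } \mathcal A\text{-measurable partition}\}.$$ The orbit change from $T$ to $U$ is $\mathcal A$-measurable if for each $\gamma'\in\Gamma'$ the function $x\mapsto\gamma(x)\in\Gamma$ defined by $T_{\gamma(x)}(x)=U_{\gamma'}(x)$ is $\mathcal A$-measurable;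 in that case $\mathcal A$ is also $U$-invariant, and $h(U,P\mid\mathcal A)$ is defined in the same way for the $\Gamma'$-action $U$. *)

theory Defs
  imports "HOL-Probability.Probability" "HOL-Algebra.Group_Action"
begin

text \<open>A probability measure on a standard Borel space: the underlying set carries a Polish
  topology whose Borel sets are the measurable sets.\<close>

definition standard_prob_space :: "'a measure \<Rightarrow> bool" where
  "standard_prob_space M \<longleftrightarrow> prob_space M \<and>
    (\<exists>\<tau>. topspace \<tau> = space M \<and> completely_metrizable_space \<tau> \<and> second_countable \<tau> \<and>
         sets M = sigma_sets (space M) {V. openin \<tau> V})"

text \<open>The identity \<open>T g (T h x) = T (g \<otimes> h) x\<close> holds at every point; each \<open>T g\<close> is extensional
  on the space (a convention of \<^locale>\<open>group_action\<close>).\<close>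

definition mp_action :: "'a measure \<Rightarrow> ('g, 'm) monoid_scheme \<Rightarrow> ('g \<Rightarrow> 'a \<Rightarrow> 'a) \<Rightarrow> bool" where
  "mp_action M G T \<longleftrightarrow> countable (carrier G) \<and> group_action G (space M) T \<and>
    (\<forall>g\<in>carrier G. T g \<in> measurable M M \<and> distr M M (T g) = M)"

definition free_action :: "'a measure \<Rightarrow> ('g, 'm) monoid_scheme \<Rightarrow> ('g \<Rightarrow> 'a \<Rightarrow> 'a) \<Rightarrow> bool" where
  "free_action M G T \<longleftrightarrow> (AE x in M. stabilizer G T x = {\<one>\<^bsub>G\<^esub>})"

definition ergodic_action :: "'a measure \<Rightarrow> ('g, 'm) monoid_scheme \<Rightarrow> ('g \<Rightarrow> 'a \<Rightarrow> 'a) \<Rightarrow> bool" where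
  "ergodic_action M G T \<longleftrightarrow>
    (\<forall>B\<in>sets M. (\<forall>g\<in>carrier G. T g -` B \<inter> space M = B) \<longrightarrow> measure M B = 0 \<or> measure M B = 1)"

definition same_orbits ::
  "'a measure \<Rightarrow> ('g, 'm) monoid_scheme \<Rightarrow> ('g \<Rightarrow> 'a \<Rightarrow> 'a) \<Rightarrow>
   ('h, 'n) monoid_scheme \<Rightarrow> ('h \<Rightarrow> 'a \<Rightarrow> 'a) \<Rightarrow> bool" where
  "same_orbits M G T G' U \<longleftrightarrow> (AE x in M. orbit G T x = orbit G' U x)"

definition folner_sequence :: "('g, 'm) monoid_scheme \<Rightarrow> (nat \<Rightarrow> 'g set) \<Rightarrow> bool" where
  "folner_sequence G H \<longleftrightarrow>
    (\<forall>i. finite (H i) \<and> H i \<noteq> {} \<and> H i \<subseteq> carrier G) \<and>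
    (\<forall>g\<in>carrier G.
      (\<lambda>i. real (card (sym_diff (g <#\<^bsub>G\<^esub> H i) (H i))) / real (card (H i))) \<longlonglongrightarrow> 0)"

definition amenable :: "('g, 'm) monoid_scheme \<Rightarrow> bool" where
  "amenable G \<longleftrightarrow> (\<exists>H. folner_sequence G H)"

text \<open>Finite partitions are given by labelling maps \<open>P\<close> with \<^prop>\<open>simple_function M P\<close>,
  and entropies are in nats.\<close>

definition shannon_entropy :: "'a measure \<Rightarrow> ('a \<Rightarrow> 's) \<Rightarrow> real" where
  "shannon_entropy M P = prob_space.entropy M (exp 1) (count_space (P ` space M)) P"

text \<open>The join over \<open>g \<in> H\<close> of the partitions \<open>x \<mapsto> P (T g x)\<close>.\<close>

definition translates_join :: "('g \<Rightarrow> 'a \<Rightarrow> 'a) \<Rightarrow> ('a \<Rightarrow> 's) \<Rightarrow> 'g set \<Rightarrow> 'a \<Rightarrow> 'g \<Rightarrow> 's" where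
  "translates_join T P H x = (\<lambda>g\<in>H. P (T g x))"

definition join :: "('a \<Rightarrow> 's) \<Rightarrow> ('a \<Rightarrow> 't) \<Rightarrow> 'a \<Rightarrow> 's \<times> 't" where
  "join P Q x = (P x, Q x)"

text \<open>The common limit along all Folner sequences. The description is meaningful when \<open>G\<close> is
  amenable; for non-amenable \<open>G\<close> the value is unspecified.\<close>

definition ds_entropy ::
  "'a measure \<Rightarrow> ('g, 'm) monoid_scheme \<Rightarrow> ('g \<Rightarrow> 'a \<Rightarrow> 'a) \<Rightarrow> ('a \<Rightarrow> 's) \<Rightarrow> real" where
  "ds_entropy M G T P = (THE c. \<forall>H. folner_sequence G H \<longrightarrow>
     (\<lambda>i. shannon_entropy M (translates_join T P (H i)) / real (card (H i))) \<longlonglongrightarrow> c)"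

text \<open>Labels in \<^typ>\<open>nat\<close> suffice to represent every finite \<open>A\<close>-measurable partition \<open>Q\<close>.\<close>

definition rel_ds_entropy ::
  "'a measure \<Rightarrow> ('g, 'm) monoid_scheme \<Rightarrow> ('g \<Rightarrow> 'a \<Rightarrow> 'a) \<Rightarrow> ('a \<Rightarrow> 's) \<Rightarrow> 'a measure \<Rightarrow> real" where
  "rel_ds_entropy M G T P A =
    (INF Q\<in>{Q :: 'a \<Rightarrow> nat. simple_function A Q}.
       ds_entropy M G T (join P Q) - ds_entropy M G T Q)"

text \<open>Sub-\<open>\<sigma>\<close>-algebras are measures \<open>A\<close> with \<^prop>\<open>subalgebra M A\<close>, of which only
  \<^term>\<open>sets A\<close> matters. Invariance is understood modulo \<open>M\<close>-null sets: freeness and equality of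
  orbits hold only almost everywhere, so this is the notion that passes from \<open>T\<close> to \<open>U\<close> under an
  \<open>A\<close>-measurable orbit change.\<close>

definition invariant_subalgebra ::
  "'a measure \<Rightarrow> ('g, 'm) monoid_scheme \<Rightarrow> ('g \<Rightarrow> 'a \<Rightarrow> 'a) \<Rightarrow> 'a measure \<Rightarrow> bool" where
  "invariant_subalgebra M G T A \<longleftrightarrow> subalgebra M A \<and>
    (\<forall>g\<in>carrier G. \<forall>B\<in>sets A. \<exists>C\<in>sets A. sym_diff (T g -` B \<inter> space M) C \<in> null_sets M)"

text \<open>By freeness the function \<open>c\<close> is determined almost everywhere.\<close>

definition orbit_change_measurable ::
  "'a measure \<Rightarrow> 'a measure \<Rightarrow> ('g, 'm) monoid_scheme \<Rightarrow> ('g \<Rightarrow> 'a \<Rightarrow> 'a) \<Rightarrow>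
   ('h, 'n) monoid_scheme \<Rightarrow> ('h \<Rightarrow> 'a \<Rightarrow> 'a) \<Rightarrow> bool" where
  "orbit_change_measurable M A G T G' U \<longleftrightarrow>
    (\<forall>g'\<in>carrier G'. \<exists>c\<in>measurable A (count_space (carrier G)).
       AE x in M. T (c x) x = U g' x)"

end

theory Submission
  imports Defs "HOL-Real_Asymp.Real_Asymp"
begin

text \<open>By Shearer's inequality the relative entropy of an action of an amenable group is the infimum,
  over finite nonempty windows \<open>F\<close>, of \<open>H(P\<^sup>F | A) / |F|\<close>. A window \<open>E\<close> of the second group, moved along an
  orbit, is an \<open>A\<close>-measurable random window \<open>E(x)\<close> of the first group. Every point of a large Folner
  set \<open>K\<close> lies in exactly \<open>|E|\<close> translates of these random windows, and the expected number of
  translates based outside \<open>K\<close> is \<open>o(|K|)\<close>. Applying Shearer's inequality to the conditional entropies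
  given \<open>A\<close> pointwise, and integrating, bounds \<open>H(P\<^sup>K | A) / |K|\<close> by \<open>H(P\<^sup>E | A) / |E| + o(1)\<close>; hence one
  infimum is at most the other, and equality follows by symmetry. The same boundary estimate shows
  that the second group inherits Folner sets from orbit segments of the first.\<close>

section \<open>Shearer's inequality and finite entropy\<close>

text \<open>The orbit change may take infinitely many values, so no finite partition
  \<open>Q\<close> need record the random windows exactly, and the finite conditional entropies that
  define \<open>rel_ds_entropy\<close> cannot follow a window that varies with the point. This
  forces conditioning on the whole sigma-algebra: for the conditional probabilities at
  \<open>x\<close> an \<open>A\<close>-measurable window behaves like a constant, and a
  deterministic inequality applies to it. Finite partitions return only through Jensen's inequality
  and a discretisation of the conditional probabilities. Shearer's inequality takes the place of a
  tiling: it asks only that every point be covered equally often, which freeness guarantees for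
  windows carried along orbits. Freeness, equality of orbits and invariance hold only off null sets,
  so the work is done over the completion \<open>B\<close> of \<open>A\<close> by null sets, which
  both actions preserve exactly. Symmetry also needs the reverse orbit change to be
  \<open>B\<close>-measurable; it is found by searching an enumeration of the second group.\<close>

definition submodular_rank :: "'g set \<Rightarrow> ('g set \<Rightarrow> real) \<Rightarrow> bool" where
  "submodular_rank V \<psi> \<longleftrightarrow> \<psi> {} = 0 \<and>
    (\<forall>F F'. finite F \<longrightarrow> finite F' \<longrightarrow> F \<subseteq> V \<longrightarrow> F' \<subseteq> V \<longrightarrow> \<psi> (F \<union> F') + \<psi> (F \<inter> F') \<le> \<psi> F + \<psi> F') \<and>
    (\<forall>F F'. finite F' \<longrightarrow> F' \<subseteq> V \<longrightarrow> F \<subseteq> F' \<longrightarrow> \<psi> F \<le> \<psi> F')"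

lemma submodular_rankD:
  assumes "submodular_rank V \<psi>"
  shows "\<psi> {} = 0"
    and "\<And>F F'. \<lbrakk>finite F; finite F'; F \<subseteq> V; F' \<subseteq> V\<rbrakk> \<Longrightarrow> \<psi> (F \<union> F') + \<psi> (F \<inter> F') \<le> \<psi> F + \<psi> F'"
    and "\<And>F F'. \<lbrakk>finite F'; F' \<subseteq> V; F \<subseteq> F'\<rbrakk> \<Longrightarrow> \<psi> F \<le> \<psi> F'"
  using assms unfolding submodular_rank_def by blast+

lemma submodular_rank_le_card:
  fixes \<psi> :: "'g set \<Rightarrow> real"
  assumes "submodular_rank V \<psi>" "finite F" "F \<subseteq> V" "\<And>k. k \<in> F \<Longrightarrow> \<psi> {k} \<le> C"
  shows "\<psi> F \<le> C * card F"
  using assms(2-4)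
proof (induction F)
  case empty
  then show ?case using submodular_rankD(1)[OF assms(1)] by simp
next
  case (insert k F)
  have "\<psi> ({k} \<union> F) + \<psi> ({k} \<inter> F) \<le> \<psi> {k} + \<psi> F"
    using insert.hyps insert.prems by (intro submodular_rankD(2)[OF assms(1)]) auto
  then have "\<psi> (insert k F) \<le> \<psi> {k} + \<psi> F"
    using insert.hyps submodular_rankD(1)[OF assms(1)] by simp
  also have "\<dots> \<le> C + C * card F" using insert by (intro add_mono) auto
  finally show ?case using insert.hyps by (simp add: algebra_simps)
qed

text \<open>Induction on \<open>K\<close>. Adding \<open>k\<close> raises \<open>\<psi> K\<close> by
  some \<open>\<Delta>\<close>. If \<open>k \<in> C i\<close>, then
  \<open>C i \<inter> insert k K\<close> and \<open>K\<close> have union \<open>insert k K\<close>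
  and intersection \<open>C i \<inter> K\<close>, so submodularity makes the \<open>i\<close>-th
  term grow by at least \<open>\<Delta>\<close>. At least \<open>m\<close> indices gain in this way,
  and monotonicity gives \<open>\<Delta> \<ge> 0\<close>, so further indices do no harm.\<close>

lemma shearer:
  fixes \<psi> :: "'g set \<Rightarrow> real"
  assumes rank: "submodular_rank V \<psi>" and "finite K" "K \<subseteq> V" "finite I"
    and "\<And>k. k \<in> K \<Longrightarrow> m \<le> card {i \<in> I. k \<in> C i}"
  shows "real m * \<psi> K \<le> (\<Sum>i\<in>I. \<psi> (C i \<inter> K))"
  using assms(2,3,5)
proof (induction K)
  case empty
  then show ?case using submodular_rankD(1)[OF rank] by simp
next
  case (insert k K)
  define \<Delta> where "\<Delta> = \<psi> (insert k K) - \<psi> K"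
  have nonneg: "\<Delta> \<ge> 0"
    unfolding \<Delta>_def using insert.hyps insert.prems submodular_rankD(3)[OF rank, of "insert k K" K] by auto
  have step: "\<psi> (C i \<inter> K) + (if k \<in> C i then \<Delta> else 0) \<le> \<psi> (C i \<inter> insert k K)" for i
  proof (cases "k \<in> C i")
    case True
    have "\<psi> ((C i \<inter> insert k K) \<union> K) + \<psi> ((C i \<inter> insert k K) \<inter> K) \<le> \<psi> (C i \<inter> insert k K) + \<psi> K"
      using insert.hyps insert.prems by (intro submodular_rankD(2)[OF rank]) auto
    moreover have "(C i \<inter> insert k K) \<union> K = insert k K" "(C i \<inter> insert k K) \<inter> K = C i \<inter> K"
      using True insert.hyps by auto
    ultimately show ?thesis using True by (simp add: \<Delta>_def)
  qed simp
  have "real m * \<psi> (insert k K) = real m * \<psi> K + real m * \<Delta>" by (simp add: \<Delta>_def algebra_simps)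
  also have "\<dots> \<le> (\<Sum>i\<in>I. \<psi> (C i \<inter> K)) + real (card {i \<in> I. k \<in> C i}) * \<Delta>"
    using insert nonneg by (intro add_mono mult_right_mono) auto
  also have "real (card {i \<in> I. k \<in> C i}) * \<Delta> = (\<Sum>i\<in>I. if k \<in> C i then \<Delta> else 0)"
    using assms(4) by (simp flip: sum.inter_filter)
  also have "(\<Sum>i\<in>I. \<psi> (C i \<inter> K)) + \<dots> = (\<Sum>i\<in>I. \<psi> (C i \<inter> K) + (if k \<in> C i then \<Delta> else 0))"
    by (simp add: sum.distrib)
  also have "\<dots> \<le> (\<Sum>i\<in>I. \<psi> (C i \<inter> insert k K))" by (intro sum_mono step)
  finally show ?case .
qed

text \<open>Think of \<open>S g\<close> as a window based at \<open>g\<close>, and of \<open>r h k\<close> as the base point of the \<open>h\<close>-th window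
  through \<open>k\<close>; base points outside \<open>K\<close> are only counted, through the crude bound \<open>C\<close>.\<close>

lemma shearer_boundary:
  fixes \<psi> :: "'g set \<Rightarrow> real" and C :: real
  assumes rank: "submodular_rank V \<psi>" and K: "finite K" "K \<subseteq> V" and "finite E"
    and r: "\<And>h k. h \<in> E \<Longrightarrow> k \<in> K \<Longrightarrow> r h k \<in> V" and inj: "\<And>k. k \<in> K \<Longrightarrow> inj_on (\<lambda>h. r h k) E"
    and S: "\<And>g. g \<in> V \<Longrightarrow> finite (S g) \<and> S g \<subseteq> V \<and> card (S g) \<le> card E"
    and mem: "\<And>h k. h \<in> E \<Longrightarrow> k \<in> K \<Longrightarrow> k \<in> S (r h k)"
    and b: "\<And>g. g \<in> K \<Longrightarrow> \<psi> (S g) \<le> b g" and C: "0 \<le> C" "\<And>k. k \<in> K \<Longrightarrow> \<psi> {k} \<le> C"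
  shows "card E * \<psi> K \<le> (\<Sum>g\<in>K. b g) + C * card E * (\<Sum>h\<in>E. card {k \<in> K. r h k \<notin> K})"
proof -
  \<comment> \<open>\<open>J\<close> collects the base points outside \<open>K\<close>. Several
    pairs in \<open>D\<close> may share a base point, so \<open>D\<close> only bounds its size from
    above.\<close>
  define D where "D = (SIGMA h:E. {k \<in> K. r h k \<notin> K})"
  define J where "J = (\<lambda>(h, k). r h k) ` D"
  have finD: "finite D" unfolding D_def using K \<open>finite E\<close> by auto
  have finJ: "finite J" unfolding J_def using finD by simp
  have cardJ: "card J \<le> (\<Sum>h\<in>E. card {k \<in> K. r h k \<notin> K})"
    unfolding J_def using card_image_le[OF finD, of "\<lambda>(h, k). r h k"] \<open>finite E\<close> K
    by (simp add: D_def)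
  have JV: "J \<subseteq> V" "J \<inter> K = {}" unfolding J_def D_def using r by auto
  \<comment> \<open>For fixed \<open>k\<close> the points \<open>r h k\<close> with
    \<open>h \<in> E\<close> are distinct and each is the base of a window through \<open>k\<close>.
    Thus the windows based in \<open>K \<union> J\<close> cover \<open>k\<close> at least
    \<open>card E\<close> times.\<close>
  have "real (card E) * \<psi> K \<le> (\<Sum>g\<in>K \<union> J. \<psi> (S g \<inter> K))"
  proof (rule shearer[OF rank K])
    fix k assume k: "k \<in> K"
    have "(\<lambda>h. r h k) ` E \<subseteq> {g \<in> K \<union> J. k \<in> S g}"
    proof
      fix g assume "g \<in> (\<lambda>h. r h k) ` E"
      then obtain h where h: "h \<in> E" "g = r h k" by auto
      have "g \<in> K \<union> J"
      proof (cases "g \<in> K")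
        case False
        then have "(h, k) \<in> D" using h k by (auto simp: D_def)
        then have "g \<in> J" using h unfolding J_def by (intro image_eqI[of _ _ "(h, k)"]) auto
        then show ?thesis by simp
      qed simp
      then show "g \<in> {g \<in> K \<union> J. k \<in> S g}" using mem h k by auto
    qed
    then show "card E \<le> card {g \<in> K \<union> J. k \<in> S g}"
      using card_mono[of "{g \<in> K \<union> J. k \<in> S g}" "(\<lambda>h. r h k) ` E"] K finJ card_image[OF inj[OF k]] by auto
  qed (use K finJ in auto)
  also have "\<dots> = (\<Sum>g\<in>K. \<psi> (S g \<inter> K)) + (\<Sum>g\<in>J. \<psi> (S g \<inter> K))"
    using K finJ JV by (intro sum.union_disjoint) auto
  also have "(\<Sum>g\<in>K. \<psi> (S g \<inter> K)) \<le> (\<Sum>g\<in>K. b g)"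
  proof (rule sum_mono)
    fix g assume g: "g \<in> K"
    have "\<psi> (S g \<inter> K) \<le> \<psi> (S g)" using S[of g] g K by (intro submodular_rankD(3)[OF rank]) auto
    then show "\<psi> (S g \<inter> K) \<le> b g" using b[OF g] by simp
  qed
  also have "(\<Sum>g\<in>J. \<psi> (S g \<inter> K)) \<le> (\<Sum>g\<in>J. C * card E)"
  proof (rule sum_mono)
    fix g assume g: "g \<in> J"
    have "\<psi> (S g \<inter> K) \<le> C * card (S g \<inter> K)"
      using K C by (intro submodular_rank_le_card[OF rank]) auto
    also have "\<dots> \<le> C * card E"
    proof -
      have "card (S g \<inter> K) \<le> card (S g)" using S[of g] g JV by (intro card_mono) auto
      then show ?thesis using S[of g] g JV C by (intro mult_left_mono) auto
    qed
    finally show "\<psi> (S g \<inter> K) \<le> C * card E" .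
  qed
  also have "(\<Sum>g\<in>J. C * card E) = C * card E * card J" by simp
  also have "\<dots> \<le> C * card E * (\<Sum>h\<in>E. card {k \<in> K. r h k \<notin> K})"
    using cardJ C by (intro mult_left_mono) (auto simp flip: of_nat_sum)
  finally show ?thesis by simp
qed

section \<open>Concavity estimates for -t ln t\<close>

definition eta :: "real \<Rightarrow> real" where "eta t = - (t * ln t)"

lemma eta_0 [simp]: "eta 0 = 0" and eta_1 [simp]: "eta 1 = 0"
  by (simp_all add: eta_def)

text \<open>The right-hand side is the tangent line at \<open>a\<close> of the concave function
  \<open>eta\<close>. Integrating it with \<open>a\<close> the mean value gives Jensen's inequality;
  \<open>a = 1\<close> gives the uniform bound on \<open>eta\<close>.\<close>

lemma eta_le_tangent:
  assumes "0 \<le> t" "0 < a"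
  shows "eta t \<le> - (t * ln a) + a - t"
proof (cases "t = 0")
  case False
  then have "0 < t" using assms by simp
  have "ln (a / t) \<le> a / t - 1" using \<open>0 < t\<close> assms by (intro ln_le_minus_one) simp
  then have "t * (ln a - ln t) \<le> t * (a / t - 1)"
    using \<open>0 < t\<close> assms by (intro mult_left_mono) (auto simp: ln_div)
  also have "\<dots> = a - t" using \<open>0 < t\<close> by (simp add: field_simps)
  finally show ?thesis by (simp add: eta_def algebra_simps)
qed (use assms in simp)

lemma eta_le_1: "0 \<le> t \<Longrightarrow> eta t \<le> 1"
  using eta_le_tangent[of t 1] by simp

lemma eta_sum_le:
  assumes "finite I" "\<And>i. i \<in> I \<Longrightarrow> 0 \<le> p i"
  shows "eta (\<Sum>i\<in>I. p i) \<le> (\<Sum>i\<in>I. eta (p i))"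
proof -
  define N where "N = (\<Sum>i\<in>I. p i)"
  have "p i * ln (p i) \<le> p i * ln N" if "i \<in> I" for i
  proof (cases "p i = 0")
    case False
    then have pos: "0 < p i" using assms(2)[OF that] by simp
    have "p i \<le> N" unfolding N_def using assms that by (intro member_le_sum) auto
    then show ?thesis using pos by (intro mult_left_mono) auto
  qed simp
  then have "(\<Sum>i\<in>I. p i * ln (p i)) \<le> (\<Sum>i\<in>I. p i * ln N)" by (intro sum_mono) auto
  then show ?thesis by (simp add: eta_def N_def sum_negf sum_distrib_right)
qed

text \<open>Nonnegativity of mutual information for an array of total mass \<open>N\<close> not
  assumed to be 1. The array \<open>p i j\<close> is compared with the product array
  \<open>q i * u j / N\<close> of its marginals by \<open>ln t \<le> t - 1\<close>; both arrays have
  mass \<open>N\<close>, so the error terms cancel on summation. Leaving the mass free lets the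
  lemma be applied separately on every fibre of a conditioning partition.\<close>

lemma eta_sum2_le:
  assumes "finite I" "finite J" and p: "\<And>i j. i \<in> I \<Longrightarrow> j \<in> J \<Longrightarrow> 0 \<le> p i j"
  shows "(\<Sum>i\<in>I. \<Sum>j\<in>J. eta (p i j)) + eta (\<Sum>i\<in>I. \<Sum>j\<in>J. p i j)
    \<le> (\<Sum>i\<in>I. eta (\<Sum>j\<in>J. p i j)) + (\<Sum>j\<in>J. eta (\<Sum>i\<in>I. p i j))"
proof -
  define q u N where "q i = (\<Sum>j\<in>J. p i j)" and "u j = (\<Sum>i\<in>I. p i j)" and "N = (\<Sum>i\<in>I. \<Sum>j\<in>J. p i j)" for i j
  have N1: "N = (\<Sum>i\<in>I. q i)" and N2: "N = (\<Sum>j\<in>J. u j)"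
    unfolding N_def q_def u_def by (simp, rule sum.swap)
  have q: "0 \<le> q i" if "i \<in> I" for i unfolding q_def using p that by (intro sum_nonneg) auto
  have u: "0 \<le> u j" if "j \<in> J" for j unfolding u_def using p that by (intro sum_nonneg) auto
  have N: "0 \<le> N" unfolding N1 using q by (intro sum_nonneg) auto
  have key: "p i j * (ln (q i) + ln (u j) - ln N - ln (p i j)) \<le> q i * u j / N - p i j"
    if ij: "i \<in> I" "j \<in> J" for i j
  proof (cases "p i j = 0")
    case True
    then show ?thesis using q u N ij by simp
  next
    case False
    then have pp: "0 < p i j" using p[OF ij] by simp
    have "p i j \<le> q i" unfolding q_def using ij p assms by (intro member_le_sum) auto
    moreover have "p i j \<le> u j" unfolding u_def using ij p assms
      by (intro member_le_sum[where f = "\<lambda>i. p i j"]) auto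
    moreover have "q i \<le> N" unfolding N1 using ij q assms by (intro member_le_sum) auto
    ultimately have pos: "0 < q i" "0 < u j" "0 < N" using pp by auto
    have "ln (q i * u j / (N * p i j)) \<le> q i * u j / (N * p i j) - 1"
      using pos pp by (intro ln_le_minus_one) simp
    then have "p i j * ln (q i * u j / (N * p i j)) \<le> p i j * (q i * u j / (N * p i j) - 1)"
      using pp by (intro mult_left_mono) auto
    also have "\<dots> = q i * u j / N - p i j" using pp pos by (simp add: field_simps)
    also have "ln (q i * u j / (N * p i j)) = ln (q i) + ln (u j) - ln N - ln (p i j)"
      using pp pos by (simp add: ln_div ln_mult)
    finally show ?thesis .
  qed
  have "(\<Sum>i\<in>I. \<Sum>j\<in>J. p i j * (ln (q i) + ln (u j) - ln N - ln (p i j)))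
      \<le> (\<Sum>i\<in>I. \<Sum>j\<in>J. q i * u j / N - p i j)"
    by (intro sum_mono key)
  also have "\<dots> = (\<Sum>i\<in>I. q i) * (\<Sum>j\<in>J. u j) / N - N"
    by (simp add: sum_subtractf N_def sum_product sum_divide_distrib)
  \<comment> \<open>This covers \<open>N = 0\<close> as well, where the quotient is 0 by
    convention.\<close>
  also have "\<dots> = 0" unfolding N1[symmetric] N2[symmetric] by simp
  finally have le: "(\<Sum>i\<in>I. \<Sum>j\<in>J. p i j * (ln (q i) + ln (u j) - ln N - ln (p i j))) \<le> 0" .
  have "(\<Sum>i\<in>I. \<Sum>j\<in>J. p i j * (ln (q i) + ln (u j) - ln N - ln (p i j)))
     = (\<Sum>i\<in>I. \<Sum>j\<in>J. p i j * ln (q i)) + (\<Sum>i\<in>I. \<Sum>j\<in>J. p i j * ln (u j))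
       - (\<Sum>i\<in>I. \<Sum>j\<in>J. p i j * ln N) - (\<Sum>i\<in>I. \<Sum>j\<in>J. p i j * ln (p i j))"
    by (simp add: algebra_simps sum.distrib sum_subtractf)
  also have "(\<Sum>i\<in>I. \<Sum>j\<in>J. p i j * ln (q i)) = (\<Sum>i\<in>I. q i * ln (q i))"
    by (simp add: q_def sum_distrib_right)
  also have "(\<Sum>i\<in>I. \<Sum>j\<in>J. p i j * ln (u j)) = (\<Sum>j\<in>J. u j * ln (u j))"
    by (subst sum.swap) (simp add: u_def sum_distrib_right)
  also have "(\<Sum>i\<in>I. \<Sum>j\<in>J. p i j * ln N) = N * ln N"
    by (simp add: N_def sum_distrib_right)
  finally show ?thesis
    using le unfolding q_def[symmetric] u_def[symmetric] N1[symmetric] eta_def sum_negf by linarith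
qed

text \<open>Additivity of \<open>m\<close> is required only on the algebra generated by \<open>R\<close>: for a conditional
  expectation \<open>m = cprob M B x\<close> it holds at almost every \<open>x\<close>, but simultaneously only for countably
  many \<open>R\<close>.\<close>

definition prob_on :: "('a set \<Rightarrow> real) \<Rightarrow> 'a set \<Rightarrow> ('a \<Rightarrow> 's) \<Rightarrow> bool" where
  "prob_on m X R \<longleftrightarrow> finite (R ` X) \<and> m X = 1 \<and> (\<forall>b\<in>R ` X. 0 \<le> m (R -` {b} \<inter> X)) \<and>
    (\<forall>B. B \<subseteq> R ` X \<longrightarrow> m (R -` B \<inter> X) = (\<Sum>b\<in>B. m (R -` {b} \<inter> X)))"

text \<open>Shannon entropy for an arbitrary set function \<open>m\<close>, so that a single theory
  serves both \<open>prob\<close> and the conditional probabilities \<open>cprob M B x\<close> at a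
  fixed point.\<close>

definition ent :: "('a set \<Rightarrow> real) \<Rightarrow> 'a set \<Rightarrow> ('a \<Rightarrow> 's) \<Rightarrow> real" where
  "ent m X f = (\<Sum>y\<in>f ` X. eta (m (f -` {y} \<inter> X)))"

section \<open>Entropy of finite labellings\<close>

lemma prob_onD:
  assumes "prob_on m X R"
  shows "finite (R ` X)" and "m X = 1" and "\<And>b. b \<in> R ` X \<Longrightarrow> 0 \<le> m (R -` {b} \<inter> X)"
    and "\<And>B. B \<subseteq> R ` X \<Longrightarrow> m (R -` B \<inter> X) = (\<Sum>b\<in>B. m (R -` {b} \<inter> X))"
  using assms unfolding prob_on_def by blast+

lemma prob_on_empty: "prob_on m X R \<Longrightarrow> m {} = 0"
  using prob_onD(4)[of m X R "{}"] by simp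

lemma prob_on_nonneg: "prob_on m X R \<Longrightarrow> 0 \<le> m (R -` {b} \<inter> X)"
proof -
  assume R: "prob_on m X R"
  show ?thesis
  proof (cases "b \<in> R ` X")
    case False
    then have "R -` {b} \<inter> X = {}" by auto
    then show ?thesis using prob_on_empty[OF R] by simp
  qed (rule prob_onD(3)[OF R])
qed

text \<open>The hypothesis on \<open>f\<close> makes each of its fibres a union of fibres of
  \<open>R\<close>; \<open>A B\<close> is the set of \<open>R\<close>-labels lying over the
  \<open>f\<close>-labels in \<open>B\<close>. One joint labelling that is finitely additive
  therefore takes care of all its coordinates.\<close>

lemma prob_on_factor:
  assumes R: "prob_on m X R" and f: "\<And>x y. x \<in> X \<Longrightarrow> y \<in> X \<Longrightarrow> R x = R y \<Longrightarrow> f x = f y"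
  shows "prob_on m X f"
proof -
  define A where "A B = R ` (f -` B \<inter> X)" for B
  have A: "f -` B \<inter> X = R -` A B \<inter> X" for B unfolding A_def using f by auto
  have AX: "A B \<subseteq> R ` X" for B unfolding A_def by auto
  have fin: "finite (R ` X)" by (rule prob_onD(1)[OF R])
  have m: "m (f -` B \<inter> X) = (\<Sum>b\<in>A B. m (R -` {b} \<inter> X))" for B
    unfolding A by (rule prob_onD(4)[OF R AX])
  have "f ` X \<subseteq> (\<lambda>b. f (SOME x. x \<in> X \<and> R x = b)) ` (R ` X)"
  proof
    fix y assume "y \<in> f ` X"
    then obtain x where x: "x \<in> X" "y = f x" by auto
    have "(SOME z. z \<in> X \<and> R z = R x) \<in> X \<and> R (SOME z. z \<in> X \<and> R z = R x) = R x"
      by (rule someI[of _ x]) (use x in auto)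
    then have "f (SOME z. z \<in> X \<and> R z = R x) = y" using f x by metis
    then show "y \<in> (\<lambda>b. f (SOME x. x \<in> X \<and> R x = b)) ` (R ` X)"
      using x by (intro image_eqI[of _ _ "R x"]) auto
  qed
  then have finf: "finite (f ` X)" using fin finite_surj by blast
  have "m (f -` B \<inter> X) = (\<Sum>b\<in>B. m (f -` {b} \<inter> X))" if "B \<subseteq> f ` X" for B
  proof -
    have "A B = (\<Union>b\<in>B. A {b})" unfolding A_def by auto
    then have "m (f -` B \<inter> X) = (\<Sum>b\<in>(\<Union>b\<in>B. A {b}). m (R -` {b} \<inter> X))" using m by simp
    also have "\<dots> = (\<Sum>b\<in>B. \<Sum>a\<in>A {b}. m (R -` {a} \<inter> X))"
    proof (rule sum.UNION_disjoint)
      show "finite B" using that finf finite_subset by auto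
      show "\<forall>i\<in>B. finite (A {i})" using AX fin finite_subset by blast
      have "i = j" if a: "a \<in> A {i}" "a \<in> A {j}" for a i j
      proof -
        obtain x y where "x \<in> X" "f x = i" "R x = a" "y \<in> X" "f y = j" "R y = a"
          using a unfolding A_def by (elim imageE IntE vimageE singletonE) metis
        then show ?thesis using f[of x y] by simp
      qed
      then show "\<forall>i\<in>B. \<forall>j\<in>B. i \<noteq> j \<longrightarrow> A {i} \<inter> A {j} = {}" by (meson disjoint_iff)
    qed
    finally show ?thesis by (simp add: m)
  qed
  moreover have "0 \<le> m (f -` {b} \<inter> X)" for b
    unfolding m by (rule sum_nonneg, rule prob_onD(3)[OF R], rule subsetD[OF AX])
  ultimately show ?thesis using finf prob_onD(2)[OF R] unfolding prob_on_def by blast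
qed

lemma prob_on_marginal:
  assumes R: "prob_on m X (\<lambda>x. (f x, g x))"
  shows "m (g -` {y} \<inter> X) = (\<Sum>a\<in>f ` X. m ((\<lambda>x. (f x, g x)) -` {(a, y)} \<inter> X))"
proof -
  let ?R = "\<lambda>x. (f x, g x)"
  have finf: "finite (f ` X)"
    by (rule prob_onD(1)[OF prob_on_factor[OF R, of f]]) simp
  define A where "A = f ` (g -` {y} \<inter> X)"
  have "g -` {y} \<inter> X = ?R -` ((\<lambda>a. (a, y)) ` A) \<inter> X" unfolding A_def by auto
  moreover have "(\<lambda>a. (a, y)) ` A \<subseteq> ?R ` X" unfolding A_def by auto
  then have "m (?R -` ((\<lambda>a. (a, y)) ` A) \<inter> X) = (\<Sum>b\<in>(\<lambda>a. (a, y)) ` A. m (?R -` {b} \<inter> X))"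
    by (rule prob_onD(4)[OF R])
  ultimately have "m (g -` {y} \<inter> X) = (\<Sum>b\<in>(\<lambda>a. (a, y)) ` A. m (?R -` {b} \<inter> X))"
    by simp
  also have "\<dots> = (\<Sum>a\<in>A. m (?R -` {(a, y)} \<inter> X))"
    by (subst sum.reindex) (auto simp: inj_on_def)
  also have "\<dots> = (\<Sum>a\<in>f ` X. m (?R -` {(a, y)} \<inter> X))"
  proof (rule sum.mono_neutral_left[OF finf])
    show "A \<subseteq> f ` X" unfolding A_def by auto
    show "\<forall>a\<in>f ` X - A. m (?R -` {(a, y)} \<inter> X) = 0"
    proof
      fix a assume "a \<in> f ` X - A"
      then have "?R -` {(a, y)} \<inter> X = {}" 
        by (simp add: A_def image_iff set_eq_iff Ball_def) metis
      then show "m (?R -` {(a, y)} \<inter> X) = 0" using prob_on_empty[OF R] by simp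
    qed
  qed
  finally show ?thesis .
qed

lemma ent_superset:
  assumes "finite L" "f ` X \<subseteq> L" "m {} = 0"
  shows "ent m X f = (\<Sum>y\<in>L. eta (m (f -` {y} \<inter> X)))"
  unfolding ent_def
proof (rule sum.mono_neutral_left[OF assms(1,2)])
  show "\<forall>y\<in>L - f ` X. eta (m (f -` {y} \<inter> X)) = 0"
  proof
    fix y assume "y \<in> L - f ` X"
    then have "f -` {y} \<inter> X = {}" by auto
    then show "eta (m (f -` {y} \<inter> X)) = 0" using assms(3) by simp
  qed
qed

text \<open>Entropy sees a labelling only through its fibres; \<open>s\<close> picks a
  representative of each fibre to match the labels. This is what permits tuples to be regrouped,
  repeated coordinates to be dropped and names to be reindexed, even between different label
  types.\<close>

lemma ent_kernel:
  assumes "\<And>x y. x \<in> X \<Longrightarrow> y \<in> X \<Longrightarrow> f x = f y \<longleftrightarrow> g x = g y"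
  shows "ent m X f = ent m X g"
proof -
  define s where "s y = (SOME x. x \<in> X \<and> f x = y)" for y
  have s: "s (f x) \<in> X \<and> f (s (f x)) = f x" if "x \<in> X" for x
    unfolding s_def by (rule someI[of _ x]) (use that in auto)
  have gs: "g (s (f x)) = g x" if "x \<in> X" for x using s assms that by metis
  have bij: "bij_betw (\<lambda>y. g (s y)) (f ` X) (g ` X)"
    unfolding bij_betw_def
  proof
    show "inj_on (\<lambda>y. g (s y)) (f ` X)" using gs assms by (auto simp: inj_on_def)
    show "(\<lambda>y. g (s y)) ` f ` X = g ` X" using gs by (force simp: image_iff)
  qed
  have "ent m X g = (\<Sum>y\<in>f ` X. eta (m (g -` {g (s y)} \<inter> X)))"
    unfolding ent_def by (rule sum.reindex_bij_betw[OF bij, symmetric])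
  also have "\<dots> = ent m X f" unfolding ent_def
  proof (rule sum.cong[OF refl])
    fix y assume "y \<in> f ` X"
    then obtain x where x: "x \<in> X" "y = f x" by auto
    have "g -` {g (s y)} \<inter> X = f -` {y} \<inter> X" using gs[OF x(1)] assms x by auto
    then show "eta (m (g -` {g (s y)} \<inter> X)) = eta (m (f -` {y} \<inter> X))" by simp
  qed
  finally show ?thesis by simp
qed

text \<open>Nonnegativity of the mutual information of \<open>f\<close> and \<open>g\<close> given
  \<open>h\<close>: \<open>eta_sum2_le\<close> is applied to the array \<open>p a b c\<close> for
  each fixed label \<open>c\<close> of \<open>h\<close>, and the results are added over
  \<open>c\<close>.\<close>

lemma ent_cond_submodular:
  assumes R: "prob_on m X (\<lambda>x. (f x, g x, h x))"
  shows "ent m X (\<lambda>x. (f x, g x, h x)) + ent m X h \<le> ent m X (\<lambda>x. (f x, h x)) + ent m X (\<lambda>x. (g x, h x))"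
proof -
  have Rf: "prob_on m X f" and Rg: "prob_on m X g" and Rh: "prob_on m X h"
    and Rgh: "prob_on m X (\<lambda>x. (g x, h x))" and Rgfh: "prob_on m X (\<lambda>x. (g x, f x, h x))"
    by (rule prob_on_factor[OF R]; simp)+
  then have fin: "finite (f ` X)" "finite (g ` X)" "finite (h ` X)" by (simp_all add: prob_onD(1))
  have m0: "m {} = 0" using prob_on_empty[OF R] .
  define p where "p a b c = m ((\<lambda>x. (f x, g x, h x)) -` {(a, b, c)} \<inter> X)" for a b c
  have p: "0 \<le> p a b c" for a b c unfolding p_def by (rule prob_on_nonneg[OF R])
  have gh: "m ((\<lambda>x. (g x, h x)) -` {(b, c)} \<inter> X) = (\<Sum>a\<in>f ` X. p a b c)" for b c
    unfolding p_def by (rule prob_on_marginal[OF R])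
  have sw: "(\<lambda>x. (g x, f x, h x)) -` {(b, a, c)} = (\<lambda>x. (f x, g x, h x)) -` {(a, b, c)}" for a b c
    by auto
  have fh: "m ((\<lambda>x. (f x, h x)) -` {(a, c)} \<inter> X) = (\<Sum>b\<in>g ` X. p a b c)" for a c
    unfolding prob_on_marginal[OF Rgfh] p_def sw ..
  have hh: "m (h -` {c} \<inter> X) = (\<Sum>a\<in>f ` X. \<Sum>b\<in>g ` X. p a b c)" for c
    unfolding prob_on_marginal[OF Rgh] gh by (rule sum.swap)
  have 1: "ent m X (\<lambda>x. (f x, g x, h x)) = (\<Sum>c\<in>h ` X. \<Sum>a\<in>f ` X. \<Sum>b\<in>g ` X. eta (p a b c))"
  proof -
    have "ent m X (\<lambda>x. (f x, g x, h x)) = (\<Sum>y\<in>f ` X \<times> g ` X \<times> h ` X. eta (m ((\<lambda>x. (f x, g x, h x)) -` {y} \<inter> X)))"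
      using fin m0 by (intro ent_superset) auto
    also have "\<dots> = (\<Sum>a\<in>f ` X. \<Sum>b\<in>g ` X. \<Sum>c\<in>h ` X. eta (p a b c))"
      unfolding p_def by (simp add: sum.cartesian_product')
    also have "\<dots> = (\<Sum>c\<in>h ` X. \<Sum>a\<in>f ` X. \<Sum>b\<in>g ` X. eta (p a b c))"
      by (simp add: sum.swap[of _ "h ` X"])
    finally show ?thesis .
  qed
  have 2: "ent m X (\<lambda>x. (f x, h x)) = (\<Sum>c\<in>h ` X. \<Sum>a\<in>f ` X. eta (\<Sum>b\<in>g ` X. p a b c))"
  proof -
    have "ent m X (\<lambda>x. (f x, h x)) = (\<Sum>y\<in>f ` X \<times> h ` X. eta (m ((\<lambda>x. (f x, h x)) -` {y} \<inter> X)))"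
      using fin m0 by (intro ent_superset) auto
    also have "\<dots> = (\<Sum>a\<in>f ` X. \<Sum>c\<in>h ` X. eta (\<Sum>b\<in>g ` X. p a b c))"
      unfolding fh[symmetric] by (simp add: sum.cartesian_product')
    finally show ?thesis by (simp add: sum.swap[of _ "h ` X"])
  qed
  have 3: "ent m X (\<lambda>x. (g x, h x)) = (\<Sum>c\<in>h ` X. \<Sum>b\<in>g ` X. eta (\<Sum>a\<in>f ` X. p a b c))"
  proof -
    have "ent m X (\<lambda>x. (g x, h x)) = (\<Sum>y\<in>g ` X \<times> h ` X. eta (m ((\<lambda>x. (g x, h x)) -` {y} \<inter> X)))"
      using fin m0 by (intro ent_superset) auto
    also have "\<dots> = (\<Sum>b\<in>g ` X. \<Sum>c\<in>h ` X. eta (\<Sum>a\<in>f ` X. p a b c))"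
      unfolding gh[symmetric] by (simp add: sum.cartesian_product')
    finally show ?thesis by (simp add: sum.swap[of _ "h ` X"])
  qed
  have 4: "ent m X h = (\<Sum>c\<in>h ` X. eta (\<Sum>a\<in>f ` X. \<Sum>b\<in>g ` X. p a b c))"
    unfolding ent_def hh ..
  show ?thesis unfolding 1 2 3 4 sum.distrib[symmetric]
    using fin p by (intro sum_mono eta_sum2_le) auto
qed

lemma ent_mono:
  assumes R: "prob_on m X (\<lambda>x. (f x, h x))"
  shows "ent m X h \<le> ent m X (\<lambda>x. (f x, h x))"
proof -
  have "prob_on m X f" "prob_on m X h" by (rule prob_on_factor[OF R]; simp)+
  then have fin: "finite (f ` X)" "finite (h ` X)" by (simp_all add: prob_onD(1))
  have "ent m X h \<le> (\<Sum>c\<in>h ` X. \<Sum>a\<in>f ` X. eta (m ((\<lambda>x. (f x, h x)) -` {(a, c)} \<inter> X)))"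
    unfolding ent_def prob_on_marginal[OF R] using fin prob_on_nonneg[OF R]
    by (intro sum_mono eta_sum_le) auto
  also have "\<dots> = (\<Sum>a\<in>f ` X. \<Sum>c\<in>h ` X. eta (m ((\<lambda>x. (f x, h x)) -` {(a, c)} \<inter> X)))"
    by (rule sum.swap)
  also have "\<dots> = (\<Sum>y\<in>f ` X \<times> h ` X. eta (m ((\<lambda>x. (f x, h x)) -` {y} \<inter> X)))"
    by (simp add: sum.cartesian_product')
  also have "\<dots> = ent m X (\<lambda>x. (f x, h x))"
    using fin prob_on_empty[OF R] by (intro ent_superset[symmetric]) auto
  finally show ?thesis .
qed

text \<open>Cruder than the logarithmic bound, but it serves only for integrability and as a factor
  in front of boundary ratios that tend to 0.\<close>

lemma ent_le_card:
  assumes "prob_on m X f"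
  shows "ent m X f \<le> card (f ` X)"
proof -
  have "ent m X f \<le> (\<Sum>y\<in>f ` X. 1)"
    unfolding ent_def by (intro sum_mono eta_le_1 prob_on_nonneg[OF assms])
  then show ?thesis by simp
qed

lemma ent_const:
  assumes "m X = 1" "\<And>x y. x \<in> X \<Longrightarrow> y \<in> X \<Longrightarrow> f x = f y"
  shows "ent m X f = 0"
proof (cases "X = {}")
  case False
  then obtain x where x: "x \<in> X" by auto
  obtain c where "\<And>y. y \<in> X \<Longrightarrow> f y = c" using assms(2) x by blast
  then have "f ` X = {c}" "f -` {c} \<inter> X = X" using x by auto
  then show ?thesis using assms(1) by (simp add: ent_def)
qed (simp add: ent_def)

text \<open>The rank is the conditional entropy of the names over \<open>F\<close> given
  \<open>Z\<close>; subtracting the entropy of \<open>Z\<close> normalises it at the empty set.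
  Submodularity is \<open>ent_cond_submodular\<close> with the name over
  \<open>F \<inter> F'\<close>, together with \<open>Z\<close>, as the condition.\<close>

lemma submodular_rank_ent:
  assumes R: "\<And>F. finite F \<Longrightarrow> F \<subseteq> V \<Longrightarrow> prob_on m X (\<lambda>x. (\<lambda>g\<in>F. N g x, Z x))"
  shows "submodular_rank V (\<lambda>F. ent m X (\<lambda>x. (\<lambda>g\<in>F. N g x, Z x)) - ent m X Z)"
proof -
  let ?R = "\<lambda>F x. \<lambda>g\<in>F. N g x"
  have eq: "?R F x = ?R F y \<longleftrightarrow> (\<forall>g\<in>F. N g x = N g y)" for F x y
    by (auto simp: fun_eq_iff restrict_def)
  have 0: "ent m X (\<lambda>x. (?R {} x, Z x)) = ent m X Z" by (intro ent_kernel) auto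
  have mono: "ent m X (\<lambda>x. (?R F x, Z x)) \<le> ent m X (\<lambda>x. (?R F' x, Z x))"
    if "finite F'" "F' \<subseteq> V" "F \<subseteq> F'" for F F'
  proof -
    have "prob_on m X (\<lambda>x. (?R F' x, ?R F x, Z x))"
      by (rule prob_on_factor[OF R[OF that(1,2)]]) (use that(3) in \<open>auto simp: eq\<close>)
    then have "ent m X (\<lambda>x. (?R F x, Z x)) \<le> ent m X (\<lambda>x. (?R F' x, ?R F x, Z x))"
      by (rule ent_mono)
    also have "\<dots> = ent m X (\<lambda>x. (?R F' x, Z x))"
      using that(3) by (intro ent_kernel) (auto simp: eq)
    finally show ?thesis .
  qed
  have sub: "ent m X (\<lambda>x. (?R (F \<union> F') x, Z x)) + ent m X (\<lambda>x. (?R (F \<inter> F') x, Z x))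
      \<le> ent m X (\<lambda>x. (?R F x, Z x)) + ent m X (\<lambda>x. (?R F' x, Z x))"
    if "finite F" "finite F'" "F \<subseteq> V" "F' \<subseteq> V" for F F'
  proof -
    have "prob_on m X (\<lambda>x. (?R (F \<union> F') x, Z x))" using that by (intro R) auto
    then have "prob_on m X (\<lambda>x. (?R F x, ?R F' x, ?R (F \<inter> F') x, Z x))"
      by (rule prob_on_factor) (auto simp: eq)
    from ent_cond_submodular[OF this]
    have "ent m X (\<lambda>x. (?R F x, ?R F' x, ?R (F \<inter> F') x, Z x)) + ent m X (\<lambda>x. (?R (F \<inter> F') x, Z x))
      \<le> ent m X (\<lambda>x. (?R F x, ?R (F \<inter> F') x, Z x)) + ent m X (\<lambda>x. (?R F' x, ?R (F \<inter> F') x, Z x))" .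
    moreover have "ent m X (\<lambda>x. (?R F x, ?R F' x, ?R (F \<inter> F') x, Z x)) = ent m X (\<lambda>x. (?R (F \<union> F') x, Z x))"
      by (intro ent_kernel) (auto simp: eq)
    moreover have "ent m X (\<lambda>x. (?R F x, ?R (F \<inter> F') x, Z x)) = ent m X (\<lambda>x. (?R F x, Z x))"
      by (intro ent_kernel) (auto simp: eq)
    moreover have "ent m X (\<lambda>x. (?R F' x, ?R (F \<inter> F') x, Z x)) = ent m X (\<lambda>x. (?R F' x, Z x))"
      by (intro ent_kernel) (auto simp: eq)
    ultimately show ?thesis by simp
  qed
  show ?thesis unfolding submodular_rank_def
    using 0 mono sub by (smt (verit, ccfv_threshold))
qed

lemma ent_cond_le:
  assumes R: "prob_on m X (\<lambda>x. (f x, g x, h x))"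
  shows "ent m X (\<lambda>x. (f x, g x, h x)) - ent m X (\<lambda>x. (g x, h x)) \<le> ent m X (\<lambda>x. (f x, h x)) - ent m X h"
  using ent_cond_submodular[OF R] by linarith

lemma ent_cond_le_ent:
  assumes R: "prob_on m X (\<lambda>x. (f x, h x))"
  shows "ent m X (\<lambda>x. (f x, h x)) - ent m X h \<le> ent m X f"
proof -
  \<comment> \<open>The unit label is the trivial condition: comparing conditioning on
    \<open>h\<close> with conditioning on nothing is an instance of
    \<open>ent_cond_le\<close>.\<close>
  have "prob_on m X (\<lambda>x. (f x, h x, ()))" by (rule prob_on_factor[OF R]) auto
  from ent_cond_le[OF this]
  have "ent m X (\<lambda>x. (f x, h x, ())) - ent m X (\<lambda>x. (h x, ())) \<le> ent m X (\<lambda>x. (f x, ())) - ent m X (\<lambda>x. ())" .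
  moreover have "ent m X (\<lambda>x. (f x, h x, ())) = ent m X (\<lambda>x. (f x, h x))"
    "ent m X (\<lambda>x. (h x, ())) = ent m X h" "ent m X (\<lambda>x. (f x, ())) = ent m X f"
    by (auto intro!: ent_kernel)
  moreover have "ent m X (\<lambda>x. ()) = 0" using prob_onD(2)[OF R] by (intro ent_const) auto
  ultimately show ?thesis by simp
qed

section \<open>Entropy conditioned on a sub-sigma-algebra\<close>

lemma ent_eqI:
  assumes "finite (f ` X)" "finite (g ` Y)" "m {} = 0" "m' {} = 0"
    and "\<And>y. y \<in> f ` X \<union> g ` Y \<Longrightarrow> m (f -` {y} \<inter> X) = m' (g -` {y} \<inter> Y)"
  shows "ent m X f = ent m' Y g"
proof -
  have "ent m X f = (\<Sum>y\<in>f ` X \<union> g ` Y. eta (m (f -` {y} \<inter> X)))"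
    using assms by (intro ent_superset) auto
  also have "\<dots> = (\<Sum>y\<in>f ` X \<union> g ` Y. eta (m' (g -` {y} \<inter> Y)))"
    by (intro sum.cong refl arg_cong[of _ _ eta] assms(5))
  also have "\<dots> = ent m' Y g" using assms by (intro ent_superset[symmetric]) auto
  finally show ?thesis .
qed

lemma ent_nonneg:
  assumes R: "prob_on m X f"
  shows "0 \<le> ent m X f"
proof -
  have "prob_on m X (\<lambda>x. (f x, ()))" by (rule prob_on_factor[OF R]) auto
  from ent_mono[OF this] have "ent m X (\<lambda>x. ()) \<le> ent m X (\<lambda>x. (f x, ()))" .
  moreover have "ent m X (\<lambda>x. ()) = 0" using prob_onD(2)[OF R] by (intro ent_const) auto
  moreover have "ent m X (\<lambda>x. (f x, ())) = ent m X f" by (intro ent_kernel) auto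
  ultimately show ?thesis by simp
qed

lemma eta_measurable [measurable]: "eta \<in> borel_measurable borel"
  unfolding eta_def by measurable

text \<open>The delicate point is 0, where t ln t tends to 0. Compactness then gives the uniform
  continuity behind \<open>cond_ent_approx\<close>.\<close>

lemma continuous_on_eta: "continuous_on {0..1} eta"
proof -
  have "continuous (at t within {0..1}) eta" if "t \<in> {0..1}" for t :: real
  proof (cases "t = 0")
    case True
    have "((\<lambda>t::real. - (t * ln t)) \<longlongrightarrow> 0) (at_right 0)" by real_asymp
    moreover have "{0..} - {0} = {0<..} - {0 :: real}" by auto
    then have "at (0 :: real) within {0..} = at_right 0" unfolding at_within_def by simp
    ultimately have "(eta \<longlongrightarrow> 0) (at 0 within {0..})" unfolding eta_def by simp
    then have "(eta \<longlongrightarrow> 0) (at 0 within {0..1})"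
      by (rule tendsto_within_subset) auto
    then show ?thesis using True by (simp add: continuous_within)
  next
    case False
    then have "isCont eta t" using that unfolding eta_def by (intro continuous_intros) auto
    then show ?thesis by (simp add: continuous_at_imp_continuous_at_within)
  qed
  then show ?thesis by (simp add: continuous_on_eq_continuous_within)
qed

text \<open>A version is chosen for each \<open>S\<close> separately, so this need not be a measure
  in \<open>S\<close> at any given \<open>x\<close>. Properties involving several sets hold off a
  null set that depends on those sets.\<close>

definition cprob :: "'a measure \<Rightarrow> 'a measure \<Rightarrow> 'a \<Rightarrow> 'a set \<Rightarrow> real" where
  "cprob M B x S = real_cond_exp M B (indicator S) x"

definition cond_ent :: "'a measure \<Rightarrow> 'a measure \<Rightarrow> ('a \<Rightarrow> 's) \<Rightarrow> real" where
  "cond_ent M B R = (\<integral>x. ent (cprob M B x) (space M) R \<partial>M)"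

lemma simple_function_restrict:
  assumes "finite F" "\<And>g. g \<in> F \<Longrightarrow> simple_function M (N g)"
  shows "simple_function M (\<lambda>x. \<lambda>g\<in>F. N g x)"
  unfolding simple_function_def
proof (intro conjI ballI)
  have "(\<lambda>x. \<lambda>g\<in>F. N g x) ` space M \<subseteq> PiE F (\<lambda>g. N g ` space M)" by auto
  moreover have "finite (PiE F (\<lambda>g. N g ` space M))"
    using assms by (intro finite_PiE) (auto simp: simple_functionD)
  ultimately show "finite ((\<lambda>x. \<lambda>g\<in>F. N g x) ` space M)" by (rule finite_subset)
  fix w assume "w \<in> (\<lambda>x. \<lambda>g\<in>F. N g x) ` space M"
  then have "w \<in> extensional F" by auto
  then have "(\<lambda>x. \<lambda>g\<in>F. N g x) -` {w} \<inter> space M = {x \<in> space M. \<forall>g\<in>F. x \<in> N g -` {w g} \<inter> space M}"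
    by (auto simp: fun_eq_iff restrict_def extensional_def)
  also have "\<dots> \<in> sets M"
  proof (rule sets.sets_Collect_finite_All[OF _ assms(1)])
    show "{x \<in> space M. x \<in> N g -` {w g} \<inter> space M} \<in> sets M" if "g \<in> F" for g
    proof -
      have "{x \<in> space M. x \<in> N g -` {w g} \<inter> space M} = N g -` {w g} \<inter> space M" by auto
      then show ?thesis using simple_functionD(2)[OF assms(2)[OF that]] by simp
    qed
  qed
  finally show "(\<lambda>x. \<lambda>g\<in>F. N g x) -` {w} \<inter> space M \<in> sets M" .
qed

section \<open>Entropy of simple functions under a probability measure\<close>

context prob_space
begin

lemma prob_on_prob:
  assumes "simple_function M R"
  shows "prob_on prob (space M) R"
  unfolding prob_on_def
proof (intro conjI allI impI ballI)
  show "finite (R ` space M)" by (rule simple_functionD(1)[OF assms])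
  fix C assume C: "C \<subseteq> R ` space M"
  have "R -` C \<inter> space M = (\<Union>b\<in>C. R -` {b} \<inter> space M)" by auto
  also have "prob \<dots> = (\<Sum>b\<in>C. prob (R -` {b} \<inter> space M))"
    using C simple_functionD[OF assms]
    by (intro finite_measure_finite_Union) (auto simp: disjoint_family_on_def intro: finite_subset)
  finally show "prob (R -` C \<inter> space M) = (\<Sum>b\<in>C. prob (R -` {b} \<inter> space M))" .
qed (auto simp: prob_space)

lemma shannon_entropy_eq_ent:
  assumes "simple_function M P"
  shows "shannon_entropy M P = ent prob (space M) P"
proof -
  interpret information_space M "exp 1" by standard simp
  have "simple_distributed M P (\<lambda>y. prob (P -` {y} \<inter> space M))"
    using assms by (intro simple_distributedI) auto
  then show ?thesis
    unfolding shannon_entropy_def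
    by (simp add: entropy_simple_distributed ent_def eta_def log_def sum_negf)
qed

lemma ent_AE_cong:
  assumes "simple_function M f" "simple_function M g" "AE x in M. f x = g x"
  shows "ent prob (space M) f = ent prob (space M) g"
proof (rule ent_eqI)
  fix y
  show "prob (f -` {y} \<inter> space M) = prob (g -` {y} \<inter> space M)"
    using assms(3) simple_functionD(2)[OF assms(1)] simple_functionD(2)[OF assms(2)]
    by (intro measure_eq_AE) auto
qed (use simple_functionD(1)[OF assms(1)] simple_functionD(1)[OF assms(2)] in auto)

lemma ent_measure_preserving:
  assumes R: "simple_function M R" and t: "t \<in> measurable M M" "distr M M t = M"
    and surj: "t ` space M = space M"
  shows "ent prob (space M) (\<lambda>x. R (t x)) = ent prob (space M) R"
proof (rule ent_eqI)
  have im: "(\<lambda>x. R (t x)) ` space M = R ` space M" using surj by (metis image_image)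
  show "finite ((\<lambda>x. R (t x)) ` space M)" "finite (R ` space M)"
    unfolding im using simple_functionD(1)[OF R] by auto
  fix y
  have "prob (R -` {y} \<inter> space M) = measure (distr M M t) (R -` {y} \<inter> space M)" using t by simp
  also have "\<dots> = prob (t -` (R -` {y} \<inter> space M) \<inter> space M)"
    using simple_functionD(2)[OF R] t by (intro measure_distr) auto
  also have "t -` (R -` {y} \<inter> space M) \<inter> space M = (\<lambda>x. R (t x)) -` {y} \<inter> space M"
    using measurable_space[OF t(1)] by auto
  finally show "prob ((\<lambda>x. R (t x)) -` {y} \<inter> space M) = prob (R -` {y} \<inter> space M)" by simp
qed auto

end

section \<open>Conditional probability and conditional entropy given \<open>B\<close>\<close>

locale prob_subalgebra = prob_space M for M :: "'a measure" +
  fixes B :: "'a measure"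
  assumes subalg: "subalgebra M B"
begin

sublocale finite_measure_subalgebra M B
  by unfold_locales (rule subalg)

lemma space_B: "space B = space M"
  using subalg by (simp add: subalgebra_def)

lemma B_in_M: "S \<in> sets B \<Longrightarrow> S \<in> sets M"
  using subalg by (auto simp: subalgebra_def)

lemma integrable_ind: "S \<in> sets M \<Longrightarrow> integrable M (indicator S :: 'a \<Rightarrow> real)"
  by (intro integrable_real_indicator) (auto simp: emeasure_eq_measure)

lemma cprob_measurable [measurable]: "(\<lambda>x. cprob M B x S) \<in> borel_measurable B"
  unfolding cprob_def by simp

lemma cprob_measurable' [measurable]: "(\<lambda>x. cprob M B x S) \<in> borel_measurable M"
  by (rule measurable_from_subalg[OF subalg cprob_measurable])

lemma AE_cprob_nonneg: "S \<in> sets M \<Longrightarrow> AE x in M. 0 \<le> cprob M B x S"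
  unfolding cprob_def by (rule real_cond_exp_pos) auto

lemma AE_cprob_empty: "AE x in M. cprob M B x {} = 0"
  unfolding cprob_def using real_cond_exp_F_meas[of "indicator {}"] by simp

lemma AE_cprob_le_1: 
  assumes "S \<in> sets M" 
  shows "AE x in M. cprob M B x S \<le> 1"
proof -
  have "AE x in M. real_cond_exp M B (indicator S) x \<le> real_cond_exp M B (\<lambda>_. 1) x"
    using assms by (intro real_cond_exp_mono) (auto simp: integrable_ind split: split_indicator)
  moreover have "AE x in M. real_cond_exp M B (\<lambda>_. 1) x = 1" by (rule real_cond_exp_F_meas) auto
  ultimately show ?thesis unfolding cprob_def by eventually_elim simp
qed

lemma cprob_integrable: "S \<in> sets M \<Longrightarrow> integrable M (\<lambda>x. cprob M B x S)"
  unfolding cprob_def by (rule real_cond_exp_int) (rule integrable_ind)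

lemma cprob_integral:
  assumes "S \<in> sets M" "W \<in> sets B"
  shows "(\<integral>x. indicator W x * cprob M B x S \<partial>M) = prob (S \<inter> W)"
proof -
  have "(\<integral>x. indicator W x * real_cond_exp M B (indicator S) x \<partial>M) = (\<integral>x. indicator W x * indicator S x \<partial>M)"
    using assms B_in_M integrable_ind[of S]
    by (intro real_cond_exp_intg) (auto intro!: integrable_mult_indicator[where 'b = real, simplified] borel_measurable_indicator)
  also have "(\<lambda>x. indicator W x * indicator S x) = (indicator (S \<inter> W) :: 'a \<Rightarrow> real)"
    by (auto split: split_indicator)
  also have "(\<integral>x. indicator (S \<inter> W) x \<partial>M) = prob (S \<inter> W)"
    using assms B_in_M by (simp add: Int_absorb2 sets.sets_into_space)
  finally show ?thesis by (simp add: cprob_def)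
qed

text \<open>A finite labelling generates a finite algebra, so finitely many almost sure identities
  have to hold together.\<close>

lemma AE_prob_on:
  assumes R: "simple_function M R"
  shows "AE x in M. prob_on (cprob M B x) (space M) R"
proof -
  note [simp] = simple_functionD(2)[OF R]
  have fin: "finite (R ` space M)" by (rule simple_functionD(1)[OF R])
  have 1: "AE x in M. cprob M B x (space M) = 1"
  proof -
    have "AE x in M. cprob M B x (space M) = indicator (space M) x"
      unfolding cprob_def using sets.top[of B]
      by (intro real_cond_exp_F_meas borel_measurable_indicator) (auto simp: integrable_ind space_B)
    then show ?thesis by (rule AE_mp) (rule AE_I2, simp)
  qed
  have 2: "AE x in M. \<forall>b\<in>R ` space M. 0 \<le> cprob M B x (R -` {b} \<inter> space M)"
    by (intro AE_finite_allI[OF fin] AE_cprob_nonneg simple_functionD(2)[OF R])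
  have 3: "AE x in M. \<forall>C\<in>Pow (R ` space M). cprob M B x (R -` C \<inter> space M) = (\<Sum>b\<in>C. cprob M B x (R -` {b} \<inter> space M))"
  proof (intro AE_finite_allI)
    fix C assume "C \<in> Pow (R ` space M)"
    then have C: "finite C" using fin finite_subset by auto
    have "(indicator (R -` C \<inter> space M) :: 'a \<Rightarrow> real) = (\<lambda>x. \<Sum>b\<in>C. indicator (R -` {b} \<inter> space M) x)"
    proof
      fix x
      have "(\<Sum>b\<in>C. indicator (R -` {b} \<inter> space M) x) = (\<Sum>b\<in>C. if b = R x then indicator (space M) x else (0::real))"
        by (intro sum.cong) (auto split: split_indicator)
      then show "(indicator (R -` C \<inter> space M) x :: real) = (\<Sum>b\<in>C. indicator (R -` {b} \<inter> space M) x)"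
        using C by (auto split: split_indicator)
    qed
    moreover have "AE x in M. real_cond_exp M B (\<lambda>x. \<Sum>b\<in>C. indicator (R -` {b} \<inter> space M) x) x
        = (\<Sum>b\<in>C. real_cond_exp M B (indicator (R -` {b} \<inter> space M)) x)"
      by (rule real_cond_exp_sum) (simp add: integrable_ind)
    ultimately show "AE x in M. cprob M B x (R -` C \<inter> space M) = (\<Sum>b\<in>C. cprob M B x (R -` {b} \<inter> space M))"
      unfolding cprob_def by simp
  qed (use fin in simp)
  from 1 2 3 show ?thesis
  proof eventually_elim
    case (elim x)
    show ?case unfolding prob_on_def
    proof (intro conjI)
      show "\<forall>C. C \<subseteq> R ` space M \<longrightarrow> cprob M B x (R -` C \<inter> space M) = (\<Sum>b\<in>C. cprob M B x (R -` {b} \<inter> space M))"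
        using elim(3) unfolding Pow_iff Ball_def .
    qed (fact fin elim)+
  qed
qed

lemma cond_ent_measurable:
  "(\<lambda>x. ent (cprob M B x) (space M) R) \<in> borel_measurable B"
  unfolding ent_def by measurable

lemma cond_ent_measurable' [measurable]:
  "(\<lambda>x. ent (cprob M B x) (space M) R) \<in> borel_measurable M"
  by (rule measurable_from_subalg[OF subalg cond_ent_measurable])

lemma AE_cond_ent_bounds:
  assumes R: "simple_function M R"
  shows "AE x in M. 0 \<le> ent (cprob M B x) (space M) R \<and> ent (cprob M B x) (space M) R \<le> card (R ` space M)"
  using AE_prob_on[OF R] by eventually_elim (auto intro: ent_nonneg ent_le_card)

lemma cond_ent_integrable:
  assumes R: "simple_function M R"
  shows "integrable M (\<lambda>x. ent (cprob M B x) (space M) R)"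
proof (rule integrable_const_bound[of _ "card (R ` space M)"])
  show "AE x in M. norm (ent (cprob M B x) (space M) R) \<le> card (R ` space M)"
    using AE_cond_ent_bounds[OF R] by eventually_elim auto
qed measurable

lemma cond_ent_nonneg:
  assumes R: "simple_function M R"
  shows "0 \<le> cond_ent M B R"
  unfolding cond_ent_def using AE_cond_ent_bounds[OF R] by (auto intro!: integral_nonneg_AE)

text \<open>Locality of conditional expectation: the indicator of a set \<open>W\<close> in
  \<open>B\<close> can be pulled out, so inside \<open>W\<close> the conditional probability of a
  fibre depends only on its part in \<open>W\<close>. This is how a \<open>B\<close>-measurable
  random window is frozen to a fixed one.\<close>

lemma AE_ent_local:
  assumes W: "W \<in> sets B" and f: "simple_function M f" and g: "simple_function M g"
    and eq: "AE x in M. x \<in> W \<longrightarrow> f x = g x"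
  shows "AE x in M. x \<in> W \<longrightarrow> ent (cprob M B x) (space M) f = ent (cprob M B x) (space M) g"
proof -
  have fin: "finite (f ` space M)" "finite (g ` space M)"
    using f g by (auto simp: simple_functionD)
  have "AE x in M. \<forall>y\<in>f ` space M \<union> g ` space M. x \<in> W \<longrightarrow>
      cprob M B x (f -` {y} \<inter> space M) = cprob M B x (g -` {y} \<inter> space M)"
  proof (intro AE_finite_allI)
    fix y
    let ?f = "f -` {y} \<inter> space M" and ?g = "g -` {y} \<inter> space M"
    have [measurable]: "?f \<in> sets M" "?g \<in> sets M" "W \<in> sets M" "W \<in> sets B"
      by (fact simple_functionD(2)[OF f] simple_functionD(2)[OF g] W B_in_M[OF W])+
    have mult: "AE x in M. real_cond_exp M B (\<lambda>x. indicator W x * indicator S x) x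
        = indicator W x * real_cond_exp M B (indicator S) x" if [measurable]: "S \<in> sets M" for S
    proof (rule real_cond_exp_mult)
      show "integrable M (\<lambda>x. indicator W x * indicator S x :: real)"
        by (rule integrable_const_bound[of _ 1]) (auto split: split_indicator)
    qed measurable
    have ae: "AE x in M. real_cond_exp M B (\<lambda>x. indicator W x * indicator ?f x) x
        = real_cond_exp M B (\<lambda>x. indicator W x * indicator ?g x) x"
    proof (rule real_cond_exp_cong)
      show "AE x in M. indicator W x * indicator ?f x = (indicator W x * indicator ?g x :: real)"
        using eq by eventually_elim (auto split: split_indicator)
    qed measurable
    show "AE x in M. x \<in> W \<longrightarrow> cprob M B x ?f = cprob M B x ?g"
      unfolding cprob_def
      using ae mult[OF simple_functionD(2)[OF f, of "{y}"]] mult[OF simple_functionD(2)[OF g, of "{y}"]]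
      by eventually_elim auto
  qed (use fin in auto)
  with AE_cprob_empty show ?thesis
  proof eventually_elim
    case (elim x)
    then show ?case using fin by (auto intro!: ent_eqI)
  qed
qed

text \<open>An automorphism \<open>t\<close> of the space that preserves \<open>B\<close> in both
  directions transports conditional expectations: the conditional probability of the preimage of
  \<open>S\<close> at \<open>x\<close> is that of \<open>S\<close> at \<open>t x\<close>. It is
  verified through the characterisation by integrals over sets of \<open>B\<close>.\<close>

lemma AE_ent_equivariant:
  assumes R: "simple_function M R"
    and t: "t \<in> measurable M M" "distr M M t = M" "t \<in> measurable B B"
    and s: "s \<in> measurable B B" "\<And>x. x \<in> space M \<Longrightarrow> s (t x) = x" "\<And>x. x \<in> space M \<Longrightarrow> t (s x) = x"
  shows "AE x in M. ent (cprob M B (t x)) (space M) R = ent (cprob M B x) (space M) (\<lambda>x. R (t x))"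
proof -
  have sp: "t x \<in> space M" "s x \<in> space M" if "x \<in> space M" for x
    using measurable_space[OF t(1)] measurable_space[OF s(1)] that by (auto simp: space_B)
  have surj: "t ` space M = space M" using sp s by force
  have im: "(\<lambda>x. R (t x)) ` space M = R ` space M" using surj by (metis image_image)
  have fin: "finite (R ` space M)" by (rule simple_functionD(1)[OF R])
  have "AE x in M. \<forall>y\<in>R ` space M. cprob M B x ((\<lambda>x. R (t x)) -` {y} \<inter> space M) = cprob M B (t x) (R -` {y} \<inter> space M)"
  proof (intro AE_finite_allI[OF fin])
    fix y
    let ?S = "R -` {y} \<inter> space M" and ?S' = "(\<lambda>x. R (t x)) -` {y} \<inter> space M"
    have S: "?S \<in> sets M" by (rule simple_functionD(2)[OF R])
    have S': "?S' = t -` ?S \<inter> space M" using sp by auto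
    have S'_meas: "?S' \<in> sets M" unfolding S' by (rule measurable_sets[OF t(1) S])
    have int: "integrable M (\<lambda>x. cprob M B (t x) ?S)"
    proof -
      have "integrable (distr M M t) (\<lambda>x. cprob M B x ?S)" using t(2) cprob_integrable[OF S] by simp
      then show ?thesis by (subst (asm) integrable_distr_eq[OF t(1)]) auto
    qed
    show "AE x in M. cprob M B x ?S' = cprob M B (t x) ?S"
      unfolding cprob_def[of M B _ ?S']
    proof (rule real_cond_exp_charact)
      fix W assume W: "W \<in> sets B"
      \<comment> \<open>The test set must be a \<open>t\<close>-preimage of a member of
        \<open>B\<close>; measurability of the inverse \<open>s\<close> supplies one.\<close>
      define V where "V = s -` W \<inter> space M"
      have V: "V \<in> sets B" using measurable_sets[OF s(1) W] by (simp add: V_def space_B)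
      have VM: "V \<in> sets M" using B_in_M[OF V] .
      have W_eq: "W = t -` V \<inter> space M"
        using sp s sets.sets_into_space[OF B_in_M[OF W]] by (auto simp: V_def)
      have "(\<integral>x\<in>W. indicator ?S' x \<partial>M) = (\<integral>x. indicator (?S' \<inter> W) x \<partial>M)"
        unfolding set_lebesgue_integral_def by (intro Bochner_Integration.integral_cong) (auto split: split_indicator)
      also have "\<dots> = prob (?S' \<inter> W)" using S'_meas B_in_M[OF W] by (simp add: Int_absorb2 sets.sets_into_space)
      also have "?S' \<inter> W = t -` (?S \<inter> V) \<inter> space M" unfolding S' W_eq by auto
      also have "prob \<dots> = measure (distr M M t) (?S \<inter> V)"
        using S VM by (intro measure_distr[symmetric] t) auto
      also have "\<dots> = prob (?S \<inter> V)" using t by simp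
      also have "\<dots> = (\<integral>x. indicator V x * cprob M B x ?S \<partial>M)" by (rule cprob_integral[OF S V, symmetric])
      also have "\<dots> = (\<integral>x. indicator V x * cprob M B x ?S \<partial>distr M M t)" using t by simp
      also have "\<dots> = (\<integral>x. indicator V (t x) * cprob M B (t x) ?S \<partial>M)"
        by (rule integral_distr[OF t(1)]) (use VM in measurable)
      also have "\<dots> = (\<integral>x\<in>W. cprob M B (t x) ?S \<partial>M)"
        unfolding set_lebesgue_integral_def
        by (intro Bochner_Integration.integral_cong) (auto simp: W_eq split: split_indicator)
      finally show "(\<integral>x\<in>W. indicator ?S' x \<partial>M) = (\<integral>x\<in>W. cprob M B (t x) ?S \<partial>M)" .
    next
      show "(\<lambda>x. cprob M B (t x) ?S) \<in> borel_measurable B"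
        using measurable_compose[OF t(3) cprob_measurable[of ?S]] .
    qed (use S'_meas int integrable_ind in auto)
  qed
  moreover have "AE x in distr M M t. cprob M B x {} = 0" unfolding t(2) by (rule AE_cprob_empty)
  then have "AE x in M. cprob M B (t x) {} = 0" by (rule AE_distrD[OF t(1)])
  moreover note AE_cprob_empty
  ultimately show ?thesis
  proof eventually_elim
    case (elim x)
    then show ?case using fin im by (intro ent_eqI) auto
  qed
qed

section \<open>Comparison of conditioning on \<open>B\<close> with finite partitions\<close>

lemma cond_ent_formula:
  assumes R: "simple_function M R" and Q: "simple_function M Q"
  shows "ent prob (space M) (\<lambda>x. (R x, Q x)) - ent prob (space M) Q =
    (\<Sum>s\<in>R ` space M. \<Sum>q\<in>Q ` space M. prob (Q -` {q} \<inter> space M) *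
      eta (prob (R -` {s} \<inter> space M \<inter> (Q -` {q} \<inter> space M)) / prob (Q -` {q} \<inter> space M)))"
proof -
  let ?X = "space M"
  define u where "u q = prob (Q -` {q} \<inter> ?X)" for q
  define v where "v s q = prob (R -` {s} \<inter> ?X \<inter> (Q -` {q} \<inter> ?X))" for s q
  have fin: "finite (R ` ?X)" "finite (Q ` ?X)" using R Q by (auto simp: simple_functionD)
  have RQ: "prob_on prob ?X (\<lambda>x. (R x, Q x))" by (intro prob_on_prob simple_function_Pair R Q)
  have veq: "(\<lambda>x. (R x, Q x)) -` {(s, q)} \<inter> ?X = R -` {s} \<inter> ?X \<inter> (Q -` {q} \<inter> ?X)" for s q by auto
  have u: "u q = (\<Sum>s\<in>R ` ?X. v s q)" for q
    unfolding u_def v_def prob_on_marginal[OF RQ] veq ..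
  have v0: "0 \<le> v s q" for s q by (simp add: v_def)
  have vu: "v s q \<le> u q" for s q
    unfolding v_def u_def using simple_functionD(2)[OF Q] by (intro finite_measure_mono) auto
  have "ent prob ?X (\<lambda>x. (R x, Q x)) = (\<Sum>y\<in>R ` ?X \<times> Q ` ?X. eta (prob ((\<lambda>x. (R x, Q x)) -` {y} \<inter> ?X)))"
    using fin by (intro ent_superset) auto
  also have "\<dots> = (\<Sum>s\<in>R ` ?X. \<Sum>q\<in>Q ` ?X. eta (v s q))"
    by (simp add: sum.cartesian_product' veq v_def)
  finally have 1: "ent prob ?X (\<lambda>x. (R x, Q x)) = (\<Sum>s\<in>R ` ?X. \<Sum>q\<in>Q ` ?X. eta (v s q))" .
  have "ent prob ?X Q = (\<Sum>q\<in>Q ` ?X. - (u q * ln (u q)))" by (simp add: ent_def u_def eta_def)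
  also have "\<dots> = (\<Sum>q\<in>Q ` ?X. \<Sum>s\<in>R ` ?X. - (v s q * ln (u q)))"
    by (simp add: u sum_distrib_right sum_negf)
  also have "\<dots> = (\<Sum>s\<in>R ` ?X. \<Sum>q\<in>Q ` ?X. - (v s q * ln (u q)))" by (rule sum.swap)
  finally have 2: "ent prob ?X Q = (\<Sum>s\<in>R ` ?X. \<Sum>q\<in>Q ` ?X. - (v s q * ln (u q)))" .
  \<comment> \<open>The case \<open>v s q = 0\<close> includes fibres of \<open>Q\<close> of
    probability 0, where both sides vanish, the right one because of its factor
    \<open>u q\<close>.\<close>
  have "eta (v s q) - - (v s q * ln (u q)) = u q * eta (v s q / u q)" for s q
  proof (cases "v s q = 0")
    case False
    then have "0 < v s q" "0 < u q" using v0[of s q] vu[of s q] by auto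
    then show ?thesis by (simp add: eta_def ln_div algebra_simps)
  qed simp
  then show ?thesis unfolding 1 2 sum_subtractf[symmetric] by (simp add: u_def v_def)
qed

text \<open>Cutting the integral along the fibres of a \<open>B\<close>-measurable \<open>Q\<close>
  gives the same double sum as in \<open>cond_ent_formula\<close>, with the integral of
  \<open>eta\<close> in place of \<open>eta\<close> of the mean. The two entropies can then be
  compared term by term.\<close>

lemma cond_ent_split:
  assumes R: "simple_function M R" and Q: "simple_function B Q"
  shows "cond_ent M B R = (\<Sum>s\<in>R ` space M. \<Sum>q\<in>Q ` space M.
    (\<integral>x. indicator (Q -` {q} \<inter> space M) x * eta (cprob M B x (R -` {s} \<inter> space M)) \<partial>M))"
    and "\<And>s q. integrable M (\<lambda>x. indicator (Q -` {q} \<inter> space M) x * eta (cprob M B x (R -` {s} \<inter> space M)))"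
proof -
  have QB: "Q -` {q} \<inter> space M \<in> sets B" for q using simple_functionD(2)[OF Q] by (simp add: space_B)
  note [measurable] = B_in_M[OF QB] simple_functionD(2)[OF R]
  have fin: "finite (Q ` space M)" using simple_functionD(1)[OF Q] by (simp add: space_B)
  have eta_bd: "\<bar>eta t\<bar> \<le> 1" if "0 \<le> t" "t \<le> 1" for t
  proof -
    have "0 \<le> eta t" using that by (cases "t = 0") (auto simp: eta_def mult_nonneg_nonpos)
    then show ?thesis using eta_le_1[of t] that by simp
  qed
  have bd: "AE x in M. \<bar>eta (cprob M B x (R -` {s} \<inter> space M))\<bar> \<le> 1" for s
    using AE_cprob_nonneg[OF simple_functionD(2)[OF R, of "{s}"]] AE_cprob_le_1[OF simple_functionD(2)[OF R, of "{s}"]]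
    by eventually_elim (rule eta_bd)
  show int: "integrable M (\<lambda>x. indicator (Q -` {q} \<inter> space M) x * eta (cprob M B x (R -` {s} \<inter> space M)))" for s q
  proof (rule integrable_const_bound[of _ 1])
    show "AE x in M. norm (indicator (Q -` {q} \<inter> space M) x * eta (cprob M B x (R -` {s} \<inter> space M))) \<le> 1"
      using bd[of s] by eventually_elim (auto split: split_indicator)
  qed measurable
  have "cond_ent M B R = (\<integral>x. (\<Sum>s\<in>R ` space M. \<Sum>q\<in>Q ` space M.
      indicator (Q -` {q} \<inter> space M) x * eta (cprob M B x (R -` {s} \<inter> space M))) \<partial>M)"
    unfolding cond_ent_def ent_def
  proof (intro Bochner_Integration.integral_cong refl sum.cong)
    fix x s assume x: "x \<in> space M"
    have "(\<Sum>q\<in>Q ` space M. indicator (Q -` {q} \<inter> space M) x * eta (cprob M B x (R -` {s} \<inter> space M)))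
      = (\<Sum>q\<in>Q ` space M. if q = Q x then eta (cprob M B x (R -` {s} \<inter> space M)) else 0)"
      using x by (intro sum.cong) (auto split: split_indicator)
    then show "eta (cprob M B x (R -` {s} \<inter> space M)) =
       (\<Sum>q\<in>Q ` space M. indicator (Q -` {q} \<inter> space M) x * eta (cprob M B x (R -` {s} \<inter> space M)))"
      using x fin by simp
  qed
  then show "cond_ent M B R = (\<Sum>s\<in>R ` space M. \<Sum>q\<in>Q ` space M.
    (\<integral>x. indicator (Q -` {q} \<inter> space M) x * eta (cprob M B x (R -` {s} \<inter> space M)) \<partial>M))"
    by (simp add: int)
qed

lemma simple_function_B_M: "simple_function B Q \<Longrightarrow> simple_function M Q"
  using subalg by (auto simp: simple_function_def subalgebra_def)

text \<open>Jensen's inequality on each fibre \<open>?W\<close> of \<open>Q\<close>: the mean over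
  \<open>?W\<close> of the conditional probability of \<open>?S\<close> is \<open>a\<close>, and the
  tangent to \<open>eta\<close> at \<open>a\<close> is integrated.\<close>

lemma cond_ent_le_finite:
  assumes R: "simple_function M R" and Q: "simple_function B Q"
  shows "cond_ent M B R \<le> ent prob (space M) (\<lambda>x. (R x, Q x)) - ent prob (space M) Q"
  unfolding cond_ent_split(1)[OF R Q] cond_ent_formula[OF R simple_function_B_M[OF Q]]
proof (intro sum_mono)
  fix s q
  let ?S = "R -` {s} \<inter> space M" and ?W = "Q -` {q} \<inter> space M"
  define a where "a = prob (?S \<inter> ?W) / prob ?W"
  have S: "?S \<in> sets M" by (rule simple_functionD(2)[OF R])
  have W: "?W \<in> sets B" using simple_functionD(2)[OF Q] by (simp add: space_B)
  note WM = B_in_M[OF W]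
  note intW = cprob_integral[OF S W]
  have intc: "integrable M (\<lambda>x. indicator ?W x * cprob M B x ?S)"
    using integrable_mult_indicator[OF WM cprob_integrable[OF S]] by simp
  \<comment> \<open>At mean 0 there is no tangent, so that case is separate: the conditional
    probability then vanishes almost everywhere on \<open>?W\<close>.\<close>
  show "(\<integral>x. indicator ?W x * eta (cprob M B x ?S) \<partial>M) \<le> prob ?W * eta (prob (?S \<inter> ?W) / prob ?W)"
  proof (cases "prob (?S \<inter> ?W) = 0")
    case True
    have "AE x in M. indicator ?W x * cprob M B x ?S = 0"
    proof (subst integral_nonneg_eq_0_iff_AE[symmetric])
      show "AE x in M. 0 \<le> indicator ?W x * cprob M B x ?S"
        using AE_cprob_nonneg[OF S] by eventually_elim simp
    qed (use intc intW True in auto)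
    then have "AE x in M. indicator ?W x * eta (cprob M B x ?S) = 0"
      by eventually_elim (auto split: split_indicator)
    then show ?thesis using True by (simp add: integral_eq_zero_AE)
  next
    case False
    then have pos: "0 < prob (?S \<inter> ?W)" by (simp add: zero_less_measure_iff)
    moreover have "prob (?S \<inter> ?W) \<le> prob ?W" using WM by (intro finite_measure_mono) auto
    ultimately have a: "0 < a" "prob ?W > 0" unfolding a_def by auto
    have "(\<integral>x. indicator ?W x * eta (cprob M B x ?S) \<partial>M)
      \<le> (\<integral>x. a * indicator ?W x - (ln a + 1) * (indicator ?W x * cprob M B x ?S) \<partial>M)"
    proof (rule integral_mono_AE[OF cond_ent_split(2)[OF R Q]])
      show "integrable M (\<lambda>x. a * indicator ?W x - (ln a + 1) * (indicator ?W x * cprob M B x ?S))"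
        using intc WM integrable_ind by (intro Bochner_Integration.integrable_diff integrable_mult_right) auto
      show "AE x in M. indicator ?W x * eta (cprob M B x ?S) \<le> a * indicator ?W x - (ln a + 1) * (indicator ?W x * cprob M B x ?S)"
        using AE_cprob_nonneg[OF S]
      proof eventually_elim
        case (elim x)
        then show ?case using eta_le_tangent[OF elim a(1)] by (auto split: split_indicator simp: algebra_simps)
      qed
    qed
    also have "\<dots> = a * prob ?W - (ln a + 1) * prob (?S \<inter> ?W)"
      using intc WM integrable_ind intW by (subst Bochner_Integration.integral_diff) auto
    also have "\<dots> = prob ?W * eta a" using a by (simp add: a_def eta_def field_simps)
    finally show ?thesis by (simp add: a_def)
  qed
qed

end

context prob_subalgebra
begin

text \<open>Jensen's inequality loses little when the integrand is nearly constant. So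
  \<open>Q\<close> records the conditional probabilities of the fibres of \<open>R\<close> rounded
  to multiples of \<open>1 / N\<close>; within a fibre of \<open>Q\<close> they differ by at most
  \<open>1 / N\<close>, and uniform continuity of \<open>eta\<close> bounds the loss.\<close>

lemma cond_ent_approx:
  assumes R: "simple_function M R" and "0 < \<epsilon>"
  shows "\<exists>Q :: 'a \<Rightarrow> nat. simple_function B Q \<and>
    ent prob (space M) (\<lambda>x. (R x, Q x)) - ent prob (space M) Q \<le> cond_ent M B R + \<epsilon>"
proof -
  let ?X = "space M"
  define n where "n = card (R ` ?X)"
  have finR: "finite (R ` ?X)" by (rule simple_functionD(1)[OF R])
  \<comment> \<open>Each of the \<open>n\<close> labels of \<open>R\<close> costs at most
    \<open>e\<close>, because the fibre probabilities of \<open>Q\<close> add up to 1.\<close>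
  define e where "e = \<epsilon> / (n + 1)"
  have e: "0 < e" "n * e \<le> \<epsilon>" using \<open>0 < \<epsilon>\<close> by (auto simp: e_def field_simps)
  have "uniformly_continuous_on {0..1} eta"
    by (rule compact_uniformly_continuous[OF continuous_on_eta]) simp
  then obtain \<delta> where \<delta>: "0 < \<delta>"
    "\<And>t t'. t \<in> {0..1} \<Longrightarrow> t' \<in> {0..1} \<Longrightarrow> \<bar>t' - t\<bar> < \<delta> \<Longrightarrow> \<bar>eta t' - eta t\<bar> < e"
    unfolding uniformly_continuous_on_def dist_real_def using e by metis
  \<comment> \<open>Both \<open>E s x\<close> and the mean over the fibre lie within
    \<open>1 / N\<close> of the value at a reference point \<open>z\<close>, which explains the
    2.\<close>
  obtain N where N: "2 / \<delta> < real N" using reals_Archimedean2 by blast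
  then have Npos: "0 < real N" using \<delta>(1) by (meson divide_pos_pos less_trans zero_less_numeral)
  have N2: "2 / N < \<delta>" using N Npos \<delta>(1) by (simp add: field_simps)
  \<comment> \<open>Clipping gives bounds at every point, which finiteness of the range of
    \<open>Q0\<close> requires; almost everywhere it changes nothing.\<close>
  define E where "E s x = max 0 (min 1 (cprob M B x (R -` {s} \<inter> ?X)))" for s x
  have [measurable]: "E s \<in> borel_measurable B" for s unfolding E_def by measurable
  have E01: "0 \<le> E s x" "E s x \<le> 1" for s x by (auto simp: E_def)
  define Q0 where "Q0 x = (\<lambda>s\<in>R ` ?X. nat \<lfloor>real N * E s x\<rfloor>)" for x
  have Q0: "simple_function B Q0"
    unfolding Q0_def
  proof (rule simple_function_restrict[OF finR])
    fix s
    have "nat \<lfloor>real N * E s x\<rfloor> \<le> N" for x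
      using mult_left_mono[OF E01(2)[of s x], of "real N"] by (simp add: nat_le_iff floor_le_iff)
    then have "(\<lambda>x. nat \<lfloor>real N * E s x\<rfloor>) ` space B \<subseteq> {..N}" by auto
    then have "finite ((\<lambda>x. nat \<lfloor>real N * E s x\<rfloor>) ` space B)" by (rule finite_subset) simp
    then show "simple_function B (\<lambda>x. nat \<lfloor>real N * E s x\<rfloor>)"
      unfolding simple_function_eq_measurable by simp
  qed
  \<comment> \<open>Encodes the vector of rounded values by a natural number, the label type over
    which \<open>rel_ds_entropy\<close> takes its infimum.\<close>
  define Q where "Q x = to_nat_on (Q0 ` ?X) (Q0 x)" for x
  have Q: "simple_function B Q"
    unfolding Q_def by (rule simple_function_compose1[OF Q0])
  have QM: "simple_function M Q" by (rule simple_function_B_M[OF Q])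
  have "countable (Q0 ` ?X)" using simple_functionD(1)[OF Q0] by (simp add: countable_finite space_B)
  then have QQ0: "Q x = Q y \<Longrightarrow> Q0 x = Q0 y" if "x \<in> ?X" "y \<in> ?X" for x y
    using that unfolding Q_def by (auto dest: inj_on_to_nat_on inj_onD)
  have key: "prob (Q -` {q} \<inter> ?X) * eta (prob (R -` {s} \<inter> ?X \<inter> (Q -` {q} \<inter> ?X)) / prob (Q -` {q} \<inter> ?X))
      \<le> (\<integral>x. indicator (Q -` {q} \<inter> ?X) x * eta (cprob M B x (R -` {s} \<inter> ?X)) \<partial>M) + e * prob (Q -` {q} \<inter> ?X)"
    if s: "s \<in> R ` ?X" and q: "q \<in> Q ` ?X" for s q
  proof -
    let ?S = "R -` {s} \<inter> ?X" and ?W = "Q -` {q} \<inter> ?X"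
    have S: "?S \<in> sets M" by (rule simple_functionD(2)[OF R])
    have W: "?W \<in> sets B" using simple_functionD(2)[OF Q] by (simp add: space_B)
    note WM = B_in_M[OF W]
    obtain z where z: "z \<in> ?X" "Q z = q" using q by auto
    have near: "\<bar>E s x - E s z\<bar> \<le> 1 / N" if "x \<in> ?W" for x
    proof -
      have "Q0 x = Q0 z" using that z by (intro QQ0) auto
      then have "Q0 x s = Q0 z s" by simp
      then have "nat \<lfloor>real N * E s x\<rfloor> = nat \<lfloor>real N * E s z\<rfloor>" using s by (simp add: Q0_def)
      moreover have "0 \<le> real N * E s x" "0 \<le> real N * E s z" using E01 by simp_all
      ultimately have "\<lfloor>real N * E s x\<rfloor> = \<lfloor>real N * E s z\<rfloor>" by (simp only: eq_nat_nat_iff zero_le_floor)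
      then have "\<bar>real N * E s x - real N * E s z\<bar> \<le> 1" by linarith
      then have "real N * \<bar>E s x - E s z\<bar> \<le> 1" by (simp add: abs_mult flip: right_diff_distrib)
      then show ?thesis using Npos by (simp add: field_simps)
    qed
    have AE: "AE x in M. cprob M B x ?S = E s x"
      using AE_cprob_nonneg[OF S] AE_cprob_le_1[OF S] by eventually_elim (simp add: E_def)
    have ind: "integrable M (indicator ?W :: 'a \<Rightarrow> real)" by (rule integrable_ind[OF WM])
    have intc: "integrable M (\<lambda>x. indicator ?W x * cprob M B x ?S)"
      using integrable_mult_indicator[OF WM cprob_integrable[OF S]] by simp
    show ?thesis
    proof (cases "prob ?W = 0")
      case True
      then have "AE x in M. x \<notin> ?W" using WM by (intro AE_not_in) (auto simp: null_sets_def emeasure_eq_measure)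
      then have "AE x in M. indicator ?W x * eta (cprob M B x ?S) = 0" by eventually_elim simp
      then show ?thesis using True by (simp add: integral_eq_zero_AE)
    next
      case False
      then have pos: "0 < prob ?W" by (simp add: zero_less_measure_iff)
      define a where "a = prob (?S \<inter> ?W) / prob ?W"
      have "(E s z - 1 / N) * prob ?W = (\<integral>x. (E s z - 1 / N) * indicator ?W x \<partial>M)"
        using WM by simp
      also have "\<dots> \<le> (\<integral>x. indicator ?W x * cprob M B x ?S \<partial>M)"
      proof (rule integral_mono_AE)
        show "AE x in M. (E s z - 1 / N) * indicator ?W x \<le> indicator ?W x * cprob M B x ?S"
          using AE
        proof eventually_elim
          case (elim x)
          then show ?case using near[of x] by (auto split: split_indicator)
        qed
      qed (use ind intc in auto)
      also have "\<dots> = prob (?S \<inter> ?W)" by (rule cprob_integral[OF S W])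
      finally have lo: "E s z - 1 / N \<le> a" using pos by (simp add: a_def field_simps)
      have "prob (?S \<inter> ?W) = (\<integral>x. indicator ?W x * cprob M B x ?S \<partial>M)" by (rule cprob_integral[OF S W, symmetric])
      also have "\<dots> \<le> (\<integral>x. (E s z + 1 / N) * indicator ?W x \<partial>M)"
      proof (rule integral_mono_AE)
        show "AE x in M. indicator ?W x * cprob M B x ?S \<le> (E s z + 1 / N) * indicator ?W x"
          using AE
        proof eventually_elim
          case (elim x)
          then show ?case using near[of x] by (auto split: split_indicator)
        qed
      qed (use ind intc in auto)
      also have "\<dots> = (E s z + 1 / N) * prob ?W" using WM by simp
      finally have hi: "a \<le> E s z + 1 / N" using pos by (simp add: a_def field_simps)
      have "prob (?S \<inter> ?W) \<le> prob ?W" using WM by (intro finite_measure_mono) auto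
      then have a01: "a \<in> {0..1}" using pos by (simp add: a_def)
      have close: "eta a \<le> eta (E s x) + e" if "x \<in> ?W" for x
      proof -
        have "1 / N + 1 / N = 2 / N" by simp
        then have "\<bar>a - E s x\<bar> < \<delta>" using near[OF that] lo hi N2 by linarith
        then show ?thesis using \<delta>(2)[of "E s x" a] a01 E01 by fastforce
      qed
      have "prob ?W * eta a = (\<integral>x. eta a * indicator ?W x \<partial>M)" using WM by simp
      also have "\<dots> \<le> (\<integral>x. indicator ?W x * eta (cprob M B x ?S) + e * indicator ?W x \<partial>M)"
      proof (rule integral_mono_AE)
        show "integrable M (\<lambda>x. indicator ?W x * eta (cprob M B x ?S) + e * indicator ?W x)"
          using ind cond_ent_split(2)[OF R Q] by (intro Bochner_Integration.integrable_add integrable_mult_right) auto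
        show "AE x in M. eta a * indicator ?W x \<le> indicator ?W x * eta (cprob M B x ?S) + e * indicator ?W x"
          using AE
        proof eventually_elim
          case (elim x)
          then show ?case using close[of x] by (auto split: split_indicator)
        qed
      qed (use ind in auto)
      also have "\<dots> = (\<integral>x. indicator ?W x * eta (cprob M B x ?S) \<partial>M) + e * prob ?W"
        using ind cond_ent_split(2)[OF R Q] WM by (subst Bochner_Integration.integral_add) auto
      finally show ?thesis by (simp add: a_def)
    qed
  qed
  have sum1: "(\<Sum>q\<in>Q ` ?X. prob (Q -` {q} \<inter> ?X)) = 1"
  proof -
    have "Q -` (Q ` ?X) \<inter> ?X = ?X" by auto
    then show ?thesis using prob_onD(4)[OF prob_on_prob[OF QM], of "Q ` ?X"] by (simp add: prob_space)
  qed
  have "ent prob ?X (\<lambda>x. (R x, Q x)) - ent prob ?X Q \<le>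
    (\<Sum>s\<in>R ` ?X. \<Sum>q\<in>Q ` ?X. (\<integral>x. indicator (Q -` {q} \<inter> ?X) x * eta (cprob M B x (R -` {s} \<inter> ?X)) \<partial>M)
      + e * prob (Q -` {q} \<inter> ?X))"
    unfolding cond_ent_formula[OF R QM] by (intro sum_mono key)
  also have "\<dots> = cond_ent M B R + n * e"
    by (simp add: sum.distrib cond_ent_split(1)[OF R Q] sum1 n_def flip: sum_distrib_left)
  finally show ?thesis using Q e by (intro exI[of _ Q]) auto
qed

end

text \<open>Passing to this completion turns invariance modulo null sets into exact invariance.\<close>

definition null_completion :: "'a measure \<Rightarrow> 'a measure \<Rightarrow> 'a measure" where
  "null_completion M A = sigma (space M) {S \<in> sets M. \<exists>C\<in>sets A. sym_diff S C \<in> null_sets M}"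

lemma space_null_completion [simp]: "space (null_completion M A) = space M"
  unfolding null_completion_def by (rule space_measure_of) (auto dest: sets.sets_into_space)

lemma sets_null_completion:
  assumes A: "subalgebra M A"
  shows "sets (null_completion M A) = {S \<in> sets M. \<exists>C\<in>sets A. sym_diff S C \<in> null_sets M}"
proof -
  have AM: "C \<in> sets M" if "C \<in> sets A" for C using A that by (auto simp: subalgebra_def)
  have sp: "space A = space M" using A by (simp add: subalgebra_def)
  have "sigma_algebra (space M) {S \<in> sets M. \<exists>C\<in>sets A. sym_diff S C \<in> null_sets M}"
    unfolding sigma_algebra_iff2
  proof (intro conjI ballI allI impI)
    show "{S \<in> sets M. \<exists>C\<in>sets A. sym_diff S C \<in> null_sets M} \<subseteq> Pow (space M)"
      by (auto dest: sets.sets_into_space)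
    show "{} \<in> {S \<in> sets M. \<exists>C\<in>sets A. sym_diff S C \<in> null_sets M}"
      by (auto intro!: bexI[of _ "{}"])
  next
    fix S assume "S \<in> {S \<in> sets M. \<exists>C\<in>sets A. sym_diff S C \<in> null_sets M}"
    then obtain C where C: "S \<in> sets M" "C \<in> sets A" "sym_diff S C \<in> null_sets M" by auto
    have "sym_diff (space M - S) (space M - C) \<in> null_sets M"
      using C AM by (intro null_sets_subset[OF C(3)]) auto
    moreover have "space M - C \<in> sets A" using C sp by (metis sets.compl_sets)
    ultimately show "space M - S \<in> {S \<in> sets M. \<exists>C\<in>sets A. sym_diff S C \<in> null_sets M}"
      using C by auto
  next
    fix S :: "nat \<Rightarrow> 'a set"
    assume "range S \<subseteq> {S \<in> sets M. \<exists>C\<in>sets A. sym_diff S C \<in> null_sets M}"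
    then have "\<forall>i. S i \<in> sets M \<and> (\<exists>C. C \<in> sets A \<and> sym_diff (S i) C \<in> null_sets M)" by auto
    then obtain C where C: "\<And>i. S i \<in> sets M" "\<And>i. C i \<in> sets A" "\<And>i. sym_diff (S i) (C i) \<in> null_sets M"
      by metis
    have "(\<Union>i. sym_diff (S i) (C i)) \<in> null_sets M" using C by (intro null_sets_UN) auto
    then have "sym_diff (\<Union>i. S i) (\<Union>i. C i) \<in> null_sets M"
      using C AM by (elim null_sets_subset) auto
    moreover have "(\<Union>i. C i) \<in> sets A" using C by auto
    ultimately show "(\<Union>i. S i) \<in> {S \<in> sets M. \<exists>C\<in>sets A. sym_diff S C \<in> null_sets M}"
      using C by auto
  qed
  then show ?thesis unfolding null_completion_def by (simp add: sigma_algebra.sets_measure_of_eq)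
qed

lemma subalgebra_null_completion:
  assumes "subalgebra M A"
  shows "subalgebra M (null_completion M A)" and "sets A \<subseteq> sets (null_completion M A)"
    and "null_sets M \<subseteq> sets (null_completion M A)"
proof -
  show "subalgebra M (null_completion M A)"
    unfolding subalgebra_def sets_null_completion[OF assms] by auto
  show "sets A \<subseteq> sets (null_completion M A)"
  proof
    fix S assume "S \<in> sets A"
    then show "S \<in> sets (null_completion M A)"
      using assms unfolding subalgebra_def sets_null_completion[OF assms] by (auto intro!: bexI[of _ S])
  qed
  show "null_sets M \<subseteq> sets (null_completion M A)"
    unfolding sets_null_completion[OF assms] by (auto intro!: bexI[of _ "{}"])
qed

lemma null_completion_simple:
  fixes Q :: "'a \<Rightarrow> nat"
  assumes A: "subalgebra M A" and Q: "simple_function (null_completion M A) Q"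
  shows "\<exists>Q'. simple_function A Q' \<and> (AE x in M. Q x = Q' x)"
proof -
  have sp: "space A = space M" using A by (simp add: subalgebra_def)
  have fin: "finite (Q ` space M)" using simple_functionD(1)[OF Q] by simp
  have "\<forall>y. \<exists>C. C \<in> sets A \<and> sym_diff (Q -` {y} \<inter> space M) C \<in> null_sets M"
    using simple_functionD(2)[OF Q] unfolding sets_null_completion[OF A] by auto
  then obtain C where C: "\<And>y. C y \<in> sets A" "\<And>y. sym_diff (Q -` {y} \<inter> space M) (C y) \<in> null_sets M"
    by metis
  \<comment> \<open>The sets \<open>C y\<close> may overlap or miss points, but only on a null set.
    Elsewhere exactly one summand survives the test and the sum is \<open>Q x\<close>.\<close>
  define Q' where "Q' x = (\<Sum>y\<in>Q ` space M. if x \<in> C y then y else 0)" for x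
  have "simple_function A Q'"
    unfolding Q'_def by (intro simple_function_sum simple_function_If_set) (auto simp: C(1))
  moreover have "AE x in M. \<forall>y\<in>Q ` space M. x \<notin> sym_diff (Q -` {y} \<inter> space M) (C y)"
    using fin C(2) by (intro AE_finite_allI AE_not_in)
  then have "AE x in M. Q x = Q' x"
    using AE_space
  proof eventually_elim
    case (elim x)
    have "Q' x = (\<Sum>y\<in>Q ` space M. if y = Q x then y else 0)"
      unfolding Q'_def
    proof (rule sum.cong[OF refl])
      fix y assume "y \<in> Q ` space M"
      from bspec[OF elim(1) this] have "x \<in> C y \<longleftrightarrow> y = Q x" using elim(2) by blast
      then show "(if x \<in> C y then y else 0) = (if y = Q x then y else 0)" by simp
    qed
    then show ?case using fin elim(2) by simp
  qed
  ultimately show ?thesis by auto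
qed

section \<open>Probability-preserving actions and averages over Folner sets\<close>

locale pmp_action = prob_space M for M :: "'a measure" +
  fixes G :: "('g, 'm) monoid_scheme" (structure) and T :: "'g \<Rightarrow> 'a \<Rightarrow> 'a"
  assumes mp: "mp_action M G T"
begin

lemma count_G: "countable (carrier G)" and action: "group_action G (space M) T"
  and T_meas: "g \<in> carrier G \<Longrightarrow> T g \<in> measurable M M"
  and T_distr: "g \<in> carrier G \<Longrightarrow> distr M M (T g) = M"
  using mp by (auto simp: mp_action_def)

sublocale group G
  using action by (simp add: group_action_def group_hom_def)

sublocale group_action G "space M" T by (rule action)

lemma T_space: "g \<in> carrier G \<Longrightarrow> x \<in> space M \<Longrightarrow> T g x \<in> space M"
  using element_image by blast

lemma T_one: "x \<in> space M \<Longrightarrow> T \<one> x = x"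
  using id_eq_one by (metis restrict_apply')

lemma T_mult: "x \<in> space M \<Longrightarrow> g \<in> carrier G \<Longrightarrow> h \<in> carrier G \<Longrightarrow> T (g \<otimes> h) x = T g (T h x)"
  by (rule composition_rule)

lemma T_inv: 
  assumes "x \<in> space M" "g \<in> carrier G" shows "T (inv g) (T g x) = x" "T g (T (inv g) x) = x"
  using assms T_mult[of x "inv g" g] T_mult[of x g "inv g"] T_one by simp_all

lemma AE_T:
  assumes "AE x in M. \<Phi> x" "g \<in> carrier G"
  shows "AE x in M. \<Phi> (T g x)"
  using AE_distrD[OF T_meas[OF assms(2)], of \<Phi>] assms(1) unfolding T_distr[OF assms(2)] by blast

lemma AE_all_T:
  assumes "AE x in M. \<Phi> x"
  shows "AE x in M. \<forall>g\<in>carrier G. \<Phi> (T g x)"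
  using count_G AE_T[OF assms] by (simp add: AE_ball_countable)

lemma simple_T: "g \<in> carrier G \<Longrightarrow> simple_function M R \<Longrightarrow> simple_function M (\<lambda>x. R (T g x))"
  using T_meas by (rule simple_function_comp)

lemma simple_translates:
  assumes "simple_function M R" "finite F" "F \<subseteq> carrier G"
  shows "simple_function M (translates_join T R F)"
proof -
  have "simple_function M (\<lambda>x. \<lambda>g\<in>F. R (T g x))"
    using assms by (intro simple_function_restrict simple_T) auto
  then show ?thesis by (simp add: translates_join_def[abs_def])
qed

lemma translates_eq_iff: "translates_join T R F x = translates_join T R F y \<longleftrightarrow> (\<forall>g\<in>F. R (T g x) = R (T g y))"
  by (auto simp: translates_join_def fun_eq_iff restrict_def)

lemma ent_T:
  assumes "simple_function M R" "g \<in> carrier G"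
  shows "ent prob (space M) (\<lambda>x. R (T g x)) = ent prob (space M) R"
  using assms by (intro ent_measure_preserving T_meas T_distr surj_prop)

text \<open>Left multiplication by \<open>g\<close> injects the points counted on the left into the
  part of \<open>g <# K\<close> outside \<open>K\<close>. This converts the Folner condition into
  the boundary count of \<open>shearer_boundary\<close>.\<close>

lemma card_translates_boundary:
  assumes "finite K" "K \<subseteq> carrier G" "g \<in> carrier G"
  shows "card {k \<in> K. g \<otimes> k \<notin> K} \<le> card (sym_diff (g <# K) K)"
proof -
  have gK: "g <# K = (\<lambda>k. g \<otimes> k) ` K" by (auto simp: l_coset_def)
  have "inj_on (\<lambda>k. g \<otimes> k) {k \<in> K. g \<otimes> k \<notin> K}" using assms by (intro inj_onI) (auto simp: subset_iff)
  then have "card {k \<in> K. g \<otimes> k \<notin> K} = card ((\<lambda>k. g \<otimes> k) ` {k \<in> K. g \<otimes> k \<notin> K})" by (simp add: card_image)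
  also have "\<dots> \<le> card (sym_diff (g <# K) K)" using assms by (intro card_mono) (auto simp: gK)
  finally show ?thesis .
qed

lemma folnerD:
  assumes "folner_sequence G K"
  shows "finite (K i)" "K i \<noteq> {}" "K i \<subseteq> carrier G" "0 < card (K i)"
  using assms by (auto simp: folner_sequence_def card_gt_0_iff)

lemma folner_boundary:
  assumes K: "folner_sequence G K" and g: "g \<in> carrier G"
  shows "(\<lambda>i. card {k \<in> K i. g \<otimes> k \<notin> K i} / card (K i)) \<longlonglongrightarrow> 0"
proof (rule tendsto_sandwich[OF _ _ tendsto_const])
  show "(\<lambda>i. card (sym_diff (g <# K i) (K i)) / card (K i)) \<longlonglongrightarrow> 0"
    using K g by (auto simp: folner_sequence_def)
  show "\<forall>\<^sub>F i in sequentially. card {k \<in> K i. g \<otimes> k \<notin> K i} / card (K i) \<le> card (sym_diff (g <# K i) (K i)) / card (K i)"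
    using card_translates_boundary[OF folnerD(1,3)[OF K] g] by (intro always_eventually allI divide_right_mono) auto
qed auto

lemma folner_boundary_sum:
  assumes K: "folner_sequence G K" and F: "finite F" "F \<subseteq> carrier G"
  shows "(\<lambda>i. (\<Sum>f\<in>F. card {k \<in> K i. inv f \<otimes> k \<notin> K i}) / card (K i)) \<longlonglongrightarrow> 0"
proof -
  have "(\<lambda>i. \<Sum>f\<in>F. card {k \<in> K i. inv f \<otimes> k \<notin> K i} / card (K i)) \<longlonglongrightarrow> (\<Sum>f\<in>F. 0)"
    using F by (intro tendsto_sum folner_boundary[OF K]) auto
  then show ?thesis by (simp add: sum_divide_distrib)
qed

text \<open>\<open>shearer_boundary\<close> with windows \<open>F g\<close>, where the window
  through \<open>k\<close> that has \<open>k\<close> in position \<open>f\<close> is based at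
  \<open>inv f \<otimes> k\<close>. For a base \<open>g \<in> K\<close> the name of \<open>Q\<close>
  over \<open>K\<close> determines \<open>Q\<close> at \<open>T g x\<close>; weakening the condition
  to this single label can only increase the entropy, and invariance under \<open>T g\<close> turns
  the result into the entropy of the name of \<open>P\<close> over \<open>F\<close> given
  \<open>Q\<close>. Only one label of \<open>Q\<close> is kept because \<open>F g\<close> may leave
  \<open>K\<close>.\<close>

lemma cond_shearer:
  assumes P: "simple_function M P" and Q: "simple_function M Q"
    and K: "finite K" "K \<subseteq> carrier G" and F: "finite F" "F \<subseteq> carrier G"
  shows "card F * (ent prob (space M) (\<lambda>x. (translates_join T P K x, translates_join T Q K x))
      - ent prob (space M) (translates_join T Q K))
    \<le> card K * (ent prob (space M) (\<lambda>x. (translates_join T P F x, Q x)) - ent prob (space M) Q)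
      + card (P ` space M) * card F * (\<Sum>f\<in>F. card {k \<in> K. inv f \<otimes> k \<notin> K})"
proof -
  let ?X = "space M"
  let ?Z = "translates_join T Q K"
  define C where "C = card (P ` ?X)"
  define \<psi> where "\<psi> F' = ent prob ?X (\<lambda>x. (translates_join T P F' x, ?Z x)) - ent prob ?X ?Z" for F'
  have Z: "simple_function M ?Z" using Q K by (rule simple_translates)
  have rank: "submodular_rank (carrier G) \<psi>"
    unfolding \<psi>_def translates_join_def[of T P]
  proof (rule submodular_rank_ent)
    fix F' assume "finite F'" "F' \<subseteq> carrier G"
    then have "simple_function M (\<lambda>x. (translates_join T P F' x, ?Z x))"
      by (intro simple_function_Pair simple_translates P Z)
    then show "prob_on prob ?X (\<lambda>x. (\<lambda>g\<in>F'. P (T g x), ?Z x))"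
      unfolding translates_join_def[of T P] by (rule prob_on_prob)
  qed
  define b where "b = ent prob ?X (\<lambda>x. (translates_join T P F x, Q x)) - ent prob ?X Q"
  have "card F * \<psi> K \<le> (\<Sum>g\<in>K. b) + real C * card F * (\<Sum>f\<in>F. card {k \<in> K. inv f \<otimes> k \<notin> K})"
  proof (rule shearer_boundary[OF rank K F(1)])
    show "inv f \<otimes> k \<in> carrier G" if "f \<in> F" "k \<in> K" for f k using that F K by auto
    show "inj_on (\<lambda>f. inv f \<otimes> k) F" if "k \<in> K" for k
      using that F K by (intro inj_onI) (metis inv_closed inv_inv right_cancel subsetD)
    show "finite ((\<lambda>f. f \<otimes> g) ` F) \<and> (\<lambda>f. f \<otimes> g) ` F \<subseteq> carrier G \<and> card ((\<lambda>f. f \<otimes> g) ` F) \<le> card F"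
      if "g \<in> carrier G" for g using that F by (auto intro: card_image_le)
  next
    fix f k assume "f \<in> F" "k \<in> K"
    then have "k = f \<otimes> (inv f \<otimes> k)" using F K by (metis inv_closed l_one m_assoc r_inv subsetD)
    then show "k \<in> (\<lambda>f'. f' \<otimes> (inv f \<otimes> k)) ` F" using \<open>f \<in> F\<close> by blast
  next
    fix g assume g: "g \<in> K"
    then have gG: "g \<in> carrier G" using K by auto
    let ?Fg = "(\<lambda>f. f \<otimes> g) ` F"
    have Fg: "finite ?Fg" "?Fg \<subseteq> carrier G" using F gG by auto
    have "simple_function M (\<lambda>x. (translates_join T P ?Fg x, ?Z x, Q (T g x)))"
      by (intro simple_function_Pair simple_translates P Z Fg simple_T Q gG)
    from ent_cond_le[OF prob_on_prob[OF this]]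
    have "ent prob ?X (\<lambda>x. (translates_join T P ?Fg x, ?Z x, Q (T g x))) - ent prob ?X (\<lambda>x. (?Z x, Q (T g x)))
      \<le> ent prob ?X (\<lambda>x. (translates_join T P ?Fg x, Q (T g x))) - ent prob ?X (\<lambda>x. Q (T g x))" .
    also have "ent prob ?X (\<lambda>x. (translates_join T P ?Fg x, ?Z x, Q (T g x))) = ent prob ?X (\<lambda>x. (translates_join T P ?Fg x, ?Z x))"
      using g by (intro ent_kernel) (auto simp: translates_eq_iff)
    also have "ent prob ?X (\<lambda>x. (?Z x, Q (T g x))) = ent prob ?X ?Z"
      using g by (intro ent_kernel) (auto simp: translates_eq_iff)
    also have "ent prob ?X (\<lambda>x. Q (T g x)) = ent prob ?X Q" by (rule ent_T[OF Q gG])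
    also have "ent prob ?X (\<lambda>x. (translates_join T P ?Fg x, Q (T g x))) =
        ent prob ?X (\<lambda>x. (translates_join T P F (T g x), Q (T g x)))"
    proof (rule ent_kernel)
      fix x y assume x: "x \<in> ?X" "y \<in> ?X"
      have "P (T (f \<otimes> g) x) = P (T f (T g x))" "P (T (f \<otimes> g) y) = P (T f (T g y))" if "f \<in> F" for f
        using that F gG x by (auto simp: T_mult subset_iff)
      then show "(translates_join T P ?Fg x, Q (T g x)) = (translates_join T P ?Fg y, Q (T g y)) \<longleftrightarrow>
        (translates_join T P F (T g x), Q (T g x)) = (translates_join T P F (T g y), Q (T g y))"
        by (simp add: translates_eq_iff)
    qed
    also have "\<dots> = ent prob ?X (\<lambda>x. (translates_join T P F x, Q x))"
      using ent_T[OF simple_function_Pair[OF simple_translates[OF P F] Q] gG] by simp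
    finally show "\<psi> ?Fg \<le> b" by (simp add: \<psi>_def b_def)
  next
    fix k assume "k \<in> K"
    then have k: "k \<in> carrier G" using K by auto
    have sk: "simple_function M (translates_join T P {k})" using k by (intro simple_translates P) auto
    have "\<psi> {k} \<le> ent prob ?X (translates_join T P {k})"
      unfolding \<psi>_def by (intro ent_cond_le_ent prob_on_prob simple_function_Pair sk Z)
    also have "\<dots> = ent prob ?X (\<lambda>x. P (T k x))" by (intro ent_kernel) (simp add: translates_eq_iff)
    also have "\<dots> = ent prob ?X P" by (rule ent_T[OF P k])
    also have "\<dots> \<le> C" unfolding C_def by (intro ent_le_card prob_on_prob P)
    finally show "\<psi> {k} \<le> real C" .
  qed auto
  then show ?thesis by (simp add: \<psi>_def b_def C_def)
qed

end

section \<open>Relative entropy as an infimum over windows\<close>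

context pmp_action
begin

definition finite_windows :: "'g set set" where
  "finite_windows = {F. finite F \<and> F \<noteq> {} \<and> F \<subseteq> carrier G}"

lemma finite_windowsD: "F \<in> finite_windows \<Longrightarrow> finite F \<and> F \<subseteq> carrier G \<and> 0 < card F"
  by (auto simp: finite_windows_def card_gt_0_iff)

lemma folner_window: "folner_sequence G K \<Longrightarrow> K i \<in> finite_windows"
  by (auto simp: folner_sequence_def finite_windows_def)

lemma finite_windows_nonempty: "finite_windows \<noteq> {}"
  by (auto simp: finite_windows_def intro!: exI[of _ "{\<one>}"])

text \<open>An infimum refers to no Folner sequence, so it can serve as the common limit of all of
  them.\<close>

definition inf_entropy :: "('a \<Rightarrow> 's) \<Rightarrow> real" where
  "inf_entropy P = (INF F\<in>finite_windows. ent prob (space M) (translates_join T P F) / card F)"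

lemma inf_entropy_le:
  assumes P: "simple_function M P" and F: "F \<in> finite_windows"
  shows "inf_entropy P \<le> ent prob (space M) (translates_join T P F) / card F"
  unfolding inf_entropy_def
proof (rule cINF_lower[OF _ F])
  show "bdd_below ((\<lambda>F. ent prob (space M) (translates_join T P F) / card F) ` finite_windows)"
  proof (rule bdd_belowI2[of _ 0])
    fix F assume "F \<in> finite_windows"
    then show "0 \<le> ent prob (space M) (translates_join T P F) / card F"
      by (intro divide_nonneg_nonneg ent_nonneg prob_on_prob simple_translates P) (auto dest: finite_windowsD)
  qed
qed

lemma cond_shearer_average:
  assumes P: "simple_function M P" and Q: "simple_function M Q"
    and K: "folner_sequence G K" and F: "F \<in> finite_windows"
  shows "(ent prob (space M) (\<lambda>x. (translates_join T P (K i) x, translates_join T Q (K i) x))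
      - ent prob (space M) (translates_join T Q (K i))) / card (K i)
    \<le> (ent prob (space M) (\<lambda>x. (translates_join T P F x, Q x)) - ent prob (space M) Q) / card F
      + card (P ` space M) * ((\<Sum>f\<in>F. card {k \<in> K i. inv f \<otimes> k \<notin> K i}) / card (K i))"
proof -
  define d b c n f where "d = ent prob (space M) (\<lambda>x. (translates_join T P (K i) x, translates_join T Q (K i) x))
      - ent prob (space M) (translates_join T Q (K i))"
    and "b = ent prob (space M) (\<lambda>x. (translates_join T P F x, Q x)) - ent prob (space M) Q"
    and "c = real (card (P ` space M)) * real (\<Sum>f\<in>F. card {k \<in> K i. inv f \<otimes> k \<notin> K i})"
    and "n = real (card (K i))" and "f = real (card F)"
  have pos: "0 < n" "0 < f" using folnerD[OF K] finite_windowsD[OF F] by (auto simp: n_def f_def)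
  have "f * d \<le> n * b + c * f"
    using cond_shearer[OF P Q folnerD(1)[OF K] folnerD(3)[OF K], of F i] finite_windowsD[OF F]
    by (simp add: d_def b_def c_def n_def f_def algebra_simps)
  then have "d / n \<le> b / f + c / n" using pos by (simp add: field_simps)
  then show ?thesis by (simp add: d_def b_def c_def n_def f_def)
qed

text \<open>Each \<open>K i\<close> is itself a window, so the averages never fall below the
  infimum. Conversely, any window \<open>F\<close> bounds them from above by its own average plus a
  boundary term tending to 0.\<close>

lemma ds_limit:
  assumes P: "simple_function M P" and K: "folner_sequence G K"
  shows "(\<lambda>i. ent prob (space M) (translates_join T P (K i)) / card (K i)) \<longlonglongrightarrow> inf_entropy P"
proof (rule LIMSEQ_I)
  fix r :: real assume r: "0 < r"
  let ?h = "\<lambda>F. ent prob (space M) (translates_join T P F)"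
  have "\<exists>F\<in>finite_windows. ?h F / card F < inf_entropy P + r / 2"
  proof (rule ccontr)
    assume "\<not> ?thesis"
    then have "inf_entropy P + r / 2 \<le> inf_entropy P"
      unfolding inf_entropy_def[of P] by (intro cINF_greatest finite_windows_nonempty) (auto simp: not_less inf_entropy_def)
    then show False using r by simp
  qed
  then obtain F where F: "F \<in> finite_windows" "?h F / card F < inf_entropy P + r / 2" by blast
  let ?e = "\<lambda>i. card (P ` space M) * ((\<Sum>f\<in>F. card {k \<in> K i. inv f \<otimes> k \<notin> K i}) / card (K i))"
  \<comment> \<open>With a one-label partition as \<open>Q\<close>, the conditional Shearer bound
    becomes unconditional.\<close>
  have const: "ent prob (space M) (\<lambda>x. ()) = 0" "ent prob (space M) (translates_join T (\<lambda>x. ()) F') = 0" for F'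
    by (intro ent_const; simp add: prob_space translates_join_def)+
  have pair: "ent prob (space M) (\<lambda>x. (translates_join T P F' x, translates_join T (\<lambda>x. ()) F' x)) = ?h F'"
    "ent prob (space M) (\<lambda>x. (translates_join T P F' x, ())) = ?h F'" for F'
    by (intro ent_kernel; simp add: translates_join_def)+
  have upper: "?h (K i) / card (K i) \<le> ?h F / card F + ?e i" for i
    using cond_shearer_average[OF P simple_function_const K F(1), of i "()"]
    by (simp add: const pair)
  have "?e \<longlonglongrightarrow> 0" using finite_windowsD[OF F(1)]
    by (intro tendsto_mult_right_zero folner_boundary_sum[OF K]) auto
  then have "\<forall>\<^sub>F i in sequentially. ?e i < r / 2" using r by (intro order_tendstoD) auto
  then obtain N where N: "\<And>i. i \<ge> N \<Longrightarrow> ?e i < r / 2" by (auto simp: eventually_sequentially)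
  have "norm (?h (K i) / card (K i) - inf_entropy P) < r" if "i \<ge> N" for i
    using upper[of i] N[OF that] F(2) inf_entropy_le[OF P folner_window[OF K], of i] r
    unfolding real_norm_def abs_less_iff by linarith
  then show "\<exists>N. \<forall>i\<ge>N. norm (?h (K i) / card (K i) - inf_entropy P) < r" by blast
qed

lemma ds_entropy_eq:
  assumes P: "simple_function M P" and G: "amenable G"
  shows "ds_entropy M G T P = inf_entropy P"
proof -
  have sh: "shannon_entropy M (translates_join T P (K i)) = ent prob (space M) (translates_join T P (K i))"
    if "folner_sequence G K" for K i
    using folnerD[OF that] by (intro shannon_entropy_eq_ent simple_translates P)
  obtain K where K: "folner_sequence G K" using G by (auto simp: amenable_def)
  show ?thesis unfolding ds_entropy_def
  proof (rule the_equality)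
    show "\<forall>H. folner_sequence G H \<longrightarrow>
      (\<lambda>i. shannon_entropy M (translates_join T P (H i)) / card (H i)) \<longlonglongrightarrow> inf_entropy P"
      using ds_limit[OF P] by (simp add: sh)
    fix c assume "\<forall>H. folner_sequence G H \<longrightarrow>
      (\<lambda>i. shannon_entropy M (translates_join T P (H i)) / card (H i)) \<longlonglongrightarrow> c"
    then have "(\<lambda>i. ent prob (space M) (translates_join T P (K i)) / card (K i)) \<longlonglongrightarrow> c"
      using K by (simp add: sh)
    then show "c = inf_entropy P" using ds_limit[OF P K] by (rule LIMSEQ_unique)
  qed
qed

end

section \<open>Relative entropy over an exactly invariant sigma-algebra\<close>

locale factor_action = pmp_action M G T + prob_subalgebra M B
  for M :: "'a measure" and G :: "('g, 'm) monoid_scheme" (structure) and T and B +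
  assumes T_meas_B: "g \<in> carrier G \<Longrightarrow> T g \<in> measurable B B"
begin

definition inf_cond_ent :: "('a \<Rightarrow> 's) \<Rightarrow> real" where
  "inf_cond_ent P = (INF F\<in>finite_windows. cond_ent M B (translates_join T P F) / card F)"

lemma inf_cond_ent_le:
  assumes P: "simple_function M P" and F: "F \<in> finite_windows"
  shows "inf_cond_ent P \<le> cond_ent M B (translates_join T P F) / card F"
  unfolding inf_cond_ent_def
proof (rule cINF_lower[OF _ F])
  show "bdd_below ((\<lambda>F. cond_ent M B (translates_join T P F) / card F) ` finite_windows)"
  proof (rule bdd_belowI2[of _ 0])
    fix F assume "F \<in> finite_windows"
    then show "0 \<le> cond_ent M B (translates_join T P F) / card F"
      by (intro divide_nonneg_nonneg cond_ent_nonneg simple_translates P) (auto dest: finite_windowsD)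
  qed
qed

lemma simple_translates_B:
  assumes "simple_function B R" "finite F" "F \<subseteq> carrier G"
  shows "simple_function B (translates_join T R F)"
proof -
  have "simple_function B (\<lambda>x. \<lambda>g\<in>F. R (T g x))"
    using assms T_meas_B by (intro simple_function_restrict simple_function_comp[OF T_meas_B]) auto
  then show ?thesis by (simp add: translates_join_def[abs_def])
qed

lemma rel_entropy_limit:
  assumes P: "simple_function M P" and Q: "simple_function M Q" and K: "folner_sequence G K" and G: "amenable G"
  shows "(\<lambda>i. (ent prob (space M) (\<lambda>x. (translates_join T P (K i) x, translates_join T Q (K i) x))
      - ent prob (space M) (translates_join T Q (K i))) / card (K i))
    \<longlonglongrightarrow> ds_entropy M G T (join P Q) - ds_entropy M G T Q"
proof -
  have PQ: "simple_function M (join P Q)"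
    using simple_function_Pair[OF P Q] by (simp add: join_def[abs_def])
  have "ent prob (space M) (translates_join T (join P Q) F) =
      ent prob (space M) (\<lambda>x. (translates_join T P F x, translates_join T Q F x))" for F
    by (intro ent_kernel) (auto simp: translates_eq_iff join_def)
  then show ?thesis
    using tendsto_diff[OF ds_limit[OF PQ K] ds_limit[OF Q K]]
    by (simp add: ds_entropy_eq[OF PQ G] ds_entropy_eq[OF Q G] diff_divide_distrib)
qed

text \<open>Lower bound: by exact invariance the name of \<open>Q\<close> over \<open>K i\<close> is
  \<open>B\<close>-measurable, so conditioning on it leaves at least the entropy given
  \<open>B\<close>. Upper bound: for a fixed window \<open>F\<close> a finite \<open>Q\<close> is
  chosen that is nearly as good as \<open>B\<close> for the name over \<open>F\<close>, and
  \<open>cond_shearer_average\<close> carries this to the limit along \<open>K\<close>.\<close>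

lemma rel_ds_entropy_eq:
  assumes P: "simple_function M P" and G: "amenable G"
    and AB: "subalgebra M A" "sets A \<subseteq> sets B"
    and approx: "\<And>Q :: 'a \<Rightarrow> nat. simple_function B Q \<Longrightarrow> \<exists>Q'. simple_function A Q' \<and> (AE x in M. Q x = Q' x)"
  shows "rel_ds_entropy M G T P A = inf_cond_ent P"
proof (rule antisym)
  obtain K where K: "folner_sequence G K" using G by (auto simp: amenable_def)
  have AB': "simple_function B Q" if "simple_function A Q" for Q :: "'a \<Rightarrow> nat"
    using that AB by (auto simp: simple_function_def subalgebra_def space_B)
  have lower: "inf_cond_ent P \<le> ds_entropy M G T (join P Q) - ds_entropy M G T Q"
    if "simple_function B Q" for Q :: "'a \<Rightarrow> nat"
  proof (rule LIMSEQ_le_const[OF rel_entropy_limit[OF P simple_function_B_M[OF that] K G]], intro exI allI impI)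
    fix i
    have "inf_cond_ent P \<le> cond_ent M B (translates_join T P (K i)) / card (K i)"
      by (rule inf_cond_ent_le[OF P folner_window[OF K]])
    also have "\<dots> \<le> (ent prob (space M) (\<lambda>x. (translates_join T P (K i) x, translates_join T Q (K i) x))
      - ent prob (space M) (translates_join T Q (K i))) / card (K i)"
      using folnerD[OF K] P that
      by (intro divide_right_mono cond_ent_le_finite simple_translates simple_translates_B) auto
    finally show "inf_cond_ent P \<le> (ent prob (space M) (\<lambda>x. (translates_join T P (K i) x, translates_join T Q (K i) x))
      - ent prob (space M) (translates_join T Q (K i))) / card (K i)" .
  qed
  have simple_const: "simple_function A (\<lambda>x. 0 :: nat)" by simp
  show "inf_cond_ent P \<le> rel_ds_entropy M G T P A"
    unfolding rel_ds_entropy_def using simple_const by (intro cINF_greatest lower AB') auto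
  have "rel_ds_entropy M G T P A \<le> cond_ent M B (translates_join T P F) / card F" if F: "F \<in> finite_windows" for F
  proof (rule field_le_epsilon)
    fix e :: real assume "0 < e"
    note FD = finite_windowsD[OF F]
    have PF: "simple_function M (translates_join T P F)" using P FD by (intro simple_translates) auto
    obtain Q :: "'a \<Rightarrow> nat" where Q: "simple_function B Q"
      "ent prob (space M) (\<lambda>x. (translates_join T P F x, Q x)) - ent prob (space M) Q
        \<le> cond_ent M B (translates_join T P F) + e"
      using cond_ent_approx[OF PF \<open>0 < e\<close>] by blast
    \<comment> \<open>The infimum ranges over \<open>A\<close>-measurable partitions, while
      \<open>Q\<close> is measurable only for the larger \<open>B\<close>; a change on a null set
      leaves all entropies alone.\<close>
    obtain Q' where Q': "simple_function A Q'" "AE x in M. Q x = Q' x" using approx[OF Q(1)] by blast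
    have QM: "simple_function M Q" "simple_function M Q'" using Q(1) Q'(1) AB' simple_function_B_M by auto
    have ae1: "AE x in M. Q' x = Q x" using Q'(2) by eventually_elim simp
    then have ae2: "AE x in M. (translates_join T P F x, Q' x) = (translates_join T P F x, Q x)"
      by eventually_elim simp
    have "ent prob (space M) (\<lambda>x. (translates_join T P F x, Q' x)) - ent prob (space M) Q'
      = ent prob (space M) (\<lambda>x. (translates_join T P F x, Q x)) - ent prob (space M) Q"
    proof (intro arg_cong2[of _ _ _ _ "(-)"])
      show "ent prob (space M) (\<lambda>x. (translates_join T P F x, Q' x)) = ent prob (space M) (\<lambda>x. (translates_join T P F x, Q x))"
        by (intro ent_AE_cong simple_function_Pair PF QM ae2)
      show "ent prob (space M) Q' = ent prob (space M) Q"
        by (intro ent_AE_cong QM ae1)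
    qed
    then have le: "ent prob (space M) (\<lambda>x. (translates_join T P F x, Q' x)) - ent prob (space M) Q'
        \<le> cond_ent M B (translates_join T P F) + e" using Q(2) by simp
    let ?e = "\<lambda>i. card (P ` space M) * ((\<Sum>f\<in>F. card {k \<in> K i. inv f \<otimes> k \<notin> K i}) / card (K i))"
    let ?b = "(ent prob (space M) (\<lambda>x. (translates_join T P F x, Q' x)) - ent prob (space M) Q') / card F"
    have "rel_ds_entropy M G T P A \<le> ds_entropy M G T (join P Q') - ds_entropy M G T Q'"
      unfolding rel_ds_entropy_def
    proof (rule cINF_lower)
      show "bdd_below ((\<lambda>Q. ds_entropy M G T (join P Q) - ds_entropy M G T Q) ` {Q :: 'a \<Rightarrow> nat. simple_function A Q})"
        using lower[OF AB'] by (intro bdd_belowI2[of _ "inf_cond_ent P"]) auto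
    qed (use Q' in simp)
    also have "\<dots> \<le> ?b"
    proof (rule LIMSEQ_le[OF rel_entropy_limit[OF P QM(2) K G]])
      have "?e \<longlonglongrightarrow> 0" using FD
        by (intro tendsto_mult_right_zero folner_boundary_sum[OF K]) auto
      from tendsto_add[OF tendsto_const[of ?b] this] show "(\<lambda>i. ?b + ?e i) \<longlonglongrightarrow> ?b" by simp
    qed (use cond_shearer_average[OF P QM(2) K F] in blast)
    also have "\<dots> \<le> (cond_ent M B (translates_join T P F) + e) / card F"
      using le by (intro divide_right_mono) auto
    also have "\<dots> \<le> cond_ent M B (translates_join T P F) / card F + e"
      using FD \<open>0 < e\<close> by (simp add: add_divide_distrib field_simps)
    finally show "rel_ds_entropy M G T P A \<le> cond_ent M B (translates_join T P F) / card F + e" .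
  qed
  then show "rel_ds_entropy M G T P A \<le> inf_cond_ent P"
    unfolding inf_cond_ent_def by (intro cINF_greatest finite_windows_nonempty)
qed

end

section \<open>Orbit changes and amenability\<close>

text \<open>Continuity from below along an enumeration of \<open>V\<close>.\<close>

lemma (in prob_space) finite_range_approx:
  assumes c: "c \<in> measurable M (count_space V)" and V: "countable V" "V \<noteq> {}" and "0 < e"
  shows "\<exists>V0. finite V0 \<and> V0 \<subseteq> V \<and> prob {x \<in> space M. c x \<notin> V0} < e"
proof -
  define f where "f = from_nat_into V"
  have f: "range f = V" unfolding f_def using V by (simp add: range_from_nat_into)
  define S where "S n = {x \<in> space M. c x \<in> f ` {..n}}" for n
  have S: "S n \<in> sets M" for n
  proof -
    have "c -` (f ` {..n}) \<inter> space M \<in> sets M" using f by (intro measurable_sets[OF c]) auto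
    moreover have "c -` (f ` {..n}) \<inter> space M = S n" by (auto simp: S_def)
    ultimately show ?thesis by simp
  qed
  have "incseq S" unfolding S_def incseq_def by force
  have "(\<Union>n. S n) = space M"
  proof -
    have "x \<in> (\<Union>n. S n)" if x: "x \<in> space M" for x
    proof -
      have "c x \<in> range f" using measurable_space[OF c x] f by simp
      then obtain n where "c x = f n" by auto
      then show ?thesis using x by (auto simp: S_def)
    qed
    then show ?thesis by (auto simp: S_def)
  qed
  then have "(\<lambda>n. prob (S n)) \<longlonglongrightarrow> 1"
    using finite_Lim_measure_incseq[of S] S \<open>incseq S\<close> by (auto simp: prob_space)
  then have "\<forall>\<^sub>F n in sequentially. 1 - e < prob (S n)" using \<open>0 < e\<close> by (intro order_tendstoD) auto
  then obtain n where n: "1 - e < prob (S n)" by (auto simp: eventually_sequentially)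
  have "{x \<in> space M. c x \<notin> f ` {..n}} = space M - S n" by (auto simp: S_def)
  then have "prob {x \<in> space M. c x \<notin> f ` {..n}} < e" using prob_compl[OF S[of n]] n by simp
  then show ?thesis using f by (intro exI[of _ "f ` {..n}"]) auto
qed

section \<open>Orbit coordinates and the boundary of a moved window\<close>

locale orbit_cocycle = pmp_action M G T + U: pmp_action M G' U
  for M :: "'a measure" and G :: "('g, 'm) monoid_scheme" (structure) and T
    and G' :: "('h, 'n) monoid_scheme" and U +
  fixes c :: "'h \<Rightarrow> 'a \<Rightarrow> 'g"
  assumes free_T: "free_action M G T" and free_U: "free_action M G' U"
    and c_meas: "h \<in> carrier G' \<Longrightarrow> c h \<in> measurable M (count_space (carrier G))"
    and c_eq: "h \<in> carrier G' \<Longrightarrow> AE x in M. T (c h x) x = U h x"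
begin

text \<open>The conditions on \<open>U\<close> and \<open>c\<close> are imposed along the entire
  \<open>T\<close>-orbit, because windows are based at the points \<open>T g x\<close>; countability
  of the group keeps the exceptional set null. The stabilizer for \<open>T\<close> is taken at
  \<open>x\<close> alone, since elements of \<open>G\<close> are always compared through their
  action on \<open>x\<close>.\<close>

definition good :: "'a \<Rightarrow> bool" where
  "good x \<longleftrightarrow> x \<in> space M \<and> stabilizer G T x = {\<one>} \<and>
    (\<forall>g\<in>carrier G. stabilizer G' U (T g x) = {\<one>\<^bsub>G'\<^esub>} \<and>
      (\<forall>h\<in>carrier G'. T (c h (T g x)) (T g x) = U h (T g x)))"

lemma AE_good: "AE x in M. good x"
proof -
  have "AE x in M. stabilizer G' U x = {\<one>\<^bsub>G'\<^esub>} \<and> (\<forall>h\<in>carrier G'. T (c h x) x = U h x)"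
    using free_U c_eq U.count_G by (simp add: free_action_def AE_ball_countable)
  from AE_all_T[OF this] free_T AE_space show ?thesis
    unfolding free_action_def by eventually_elim (simp add: good_def)
qed

lemma good_space: "good x \<Longrightarrow> x \<in> space M"
  by (simp add: good_def)

lemma c_carrier: "h \<in> carrier G' \<Longrightarrow> x \<in> space M \<Longrightarrow> c h x \<in> carrier G"
  using measurable_space[OF c_meas] by simp

lemma good_T_inj:
  assumes "good x" "g \<in> carrier G" "g' \<in> carrier G" "T g x = T g' x"
  shows "g = g'"
proof -
  note x = good_space[OF assms(1)]
  have "T (inv g' \<otimes> g) x = x" using assms x by (simp add: T_mult T_inv)
  then have "inv g' \<otimes> g \<in> stabilizer G T x" using assms by (simp add: stabilizer_def)
  then have "inv g' \<otimes> g = \<one>" using assms(1) by (simp add: good_def)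
  then show ?thesis using assms by (metis inv_closed inv_equality inv_inv)
qed

lemma good_U_inj:
  assumes "good x" "k \<in> carrier G" "h \<in> carrier G'" "h' \<in> carrier G'" "U h (T k x) = U h' (T k x)"
  shows "h = h'"
proof -
  have x: "T k x \<in> space M" using good_space[OF assms(1)] assms(2) by (rule T_space[rotated])
  have "U (inv\<^bsub>G'\<^esub> h' \<otimes>\<^bsub>G'\<^esub> h) (T k x) = T k x" using assms x by (simp add: U.T_mult U.T_inv)
  then have "inv\<^bsub>G'\<^esub> h' \<otimes>\<^bsub>G'\<^esub> h \<in> stabilizer G' U (T k x)" using assms by (simp add: stabilizer_def)
  then have "inv\<^bsub>G'\<^esub> h' \<otimes>\<^bsub>G'\<^esub> h = \<one>\<^bsub>G'\<^esub>" using assms(1,2) by (simp add: good_def)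
  then show ?thesis using assms by (metis U.inv_closed U.inv_equality U.inv_inv)
qed

text \<open>In the coordinate \<open>g\<close> for the point \<open>T g x\<close> of the orbit, the
  map \<open>U h\<close> becomes left multiplication by an element that depends on the
  point.\<close>

lemma good_cocycle:
  assumes "good x" "g \<in> carrier G" "h \<in> carrier G'"
  shows "T (c h (T g x) \<otimes> g) x = U h (T g x)" and "c h (T g x) \<otimes> g \<in> carrier G"
proof -
  note x = good_space[OF assms(1)]
  have "c h (T g x) \<in> carrier G" using assms x by (intro c_carrier T_space)
  then show "c h (T g x) \<otimes> g \<in> carrier G" "T (c h (T g x) \<otimes> g) x = U h (T g x)"
    using assms x by (auto simp: T_mult good_def)
qed

text \<open>For good \<open>x\<close>, the number of points of the orbit segment with coordinates in
  \<open>K\<close> that \<open>U h\<close> moves out of it.\<close>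

definition bdry :: "'h \<Rightarrow> 'g set \<Rightarrow> 'a \<Rightarrow> real" where
  "bdry h K x = card {k \<in> K. c h (T k x) \<otimes> k \<notin> K}"

lemma c_sets: "h \<in> carrier G' \<Longrightarrow> {x \<in> space M. c h x \<in> Z} \<in> sets M"
proof -
  assume h: "h \<in> carrier G'"
  have "{x \<in> space M. c h x \<in> Z} = c h -` (Z \<inter> carrier G) \<inter> space M"
    using c_carrier[OF h] by auto
  then show ?thesis using measurable_sets[OF c_meas[OF h], of "Z \<inter> carrier G"] by simp
qed

text \<open>The point \<open>T k x\<close> has the same distribution as \<open>x\<close>, so after
  integration the cocycle is evaluated at \<open>x\<close> for every \<open>k\<close>.\<close>

lemma bdry_integral:
  assumes h: "h \<in> carrier G'" and K: "finite K" "K \<subseteq> carrier G"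
  shows "integrable M (bdry h K)"
    and "(\<integral>x. bdry h K x \<partial>M) = (\<Sum>k\<in>K. prob {x \<in> space M. c h x \<otimes> k \<notin> K})"
proof -
  define D where "D k = {x \<in> space M. c h x \<in> {g. g \<otimes> k \<notin> K}}" for k
  define D' where "D' k = T k -` D k \<inter> space M" for k
  have D: "D k \<in> sets M" for k unfolding D_def by (rule c_sets[OF h])
  have D': "D' k \<in> sets M" if "k \<in> K" for k
    unfolding D'_def using that K by (intro measurable_sets[OF T_meas D]) auto
  have prob_D': "prob (D' k) = prob (D k)" if "k \<in> K" for k
  proof -
    have k: "k \<in> carrier G" using that K by auto
    have "prob (D' k) = measure (distr M M (T k)) (D k)"
      unfolding D'_def by (rule measure_distr[OF T_meas[OF k] D, symmetric])
    then show ?thesis using T_distr[OF k] by simp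
  qed
  have eq: "bdry h K x = (\<Sum>k\<in>K. indicator (D' k) x)" if x: "x \<in> space M" for x
  proof -
    have "{k \<in> K. c h (T k x) \<otimes> k \<notin> K} = {k \<in> K. x \<in> D' k}"
      using x K T_space[OF _ x] by (auto simp: D'_def D_def)
    then show ?thesis using K by (simp add: bdry_def indicator_def Int_def)
  qed
  have int: "integrable M (\<lambda>x. \<Sum>k\<in>K. indicator (D' k) x :: real)"
    by (intro Bochner_Integration.integrable_sum integrable_real_indicator D') (auto simp: emeasure_eq_measure)
  show "integrable M (bdry h K)"
    using int by (subst Bochner_Integration.integrable_cong[OF refl eq])
  have "(\<integral>x. bdry h K x \<partial>M) = (\<integral>x. (\<Sum>k\<in>K. indicator (D' k) x) \<partial>M)"
    by (rule Bochner_Integration.integral_cong[OF refl eq])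
  also have "\<dots> = (\<Sum>k\<in>K. prob (D' k))"
    using D' by (subst Bochner_Integration.integral_sum)
      (auto intro!: integrable_real_indicator sum.cong simp: emeasure_eq_measure Int_absorb2 sets.sets_into_space)
  also have "\<dots> = (\<Sum>k\<in>K. prob (D k))" by (intro sum.cong refl prob_D')
  finally show "(\<integral>x. bdry h K x \<partial>M) = (\<Sum>k\<in>K. prob {x \<in> space M. c h x \<otimes> k \<notin> K})"
    by (simp add: D_def)
qed

text \<open>Up to small probability the cocycle takes finitely many values, and for each of these the
  Folner property applies.\<close>

lemma bdry_limit:
  assumes h: "h \<in> carrier G'" and K: "folner_sequence G K"
  shows "(\<lambda>i. (\<integral>x. bdry h (K i) x \<partial>M) / card (K i)) \<longlonglongrightarrow> 0"
proof (rule LIMSEQ_I)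
  fix r :: real assume "0 < r"
  then have "0 < r / 2" by simp
  from finite_range_approx[OF c_meas[OF h] count_G _ this]
  obtain V where V: "finite V" "V \<subseteq> carrier G" "prob {x \<in> space M. c h x \<notin> V} < r / 2" by auto
  let ?e = "\<lambda>i. \<Sum>v\<in>V. card {k \<in> K i. v \<otimes> k \<notin> K i} / card (K i)"
  have "?e \<longlonglongrightarrow> (\<Sum>v\<in>V. 0)" using V by (intro tendsto_sum folner_boundary[OF K]) auto
  then have "\<forall>\<^sub>F i in sequentially. ?e i < r / 2" using \<open>0 < r\<close> by (intro order_tendstoD) auto
  then obtain N where N: "\<And>i. i \<ge> N \<Longrightarrow> ?e i < r / 2" by (auto simp: eventually_sequentially)
  have bound: "(\<integral>x. bdry h (K i) x \<partial>M) \<le> card (K i) * (r / 2) + (\<Sum>v\<in>V. card {k \<in> K i. v \<otimes> k \<notin> K i})" for i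
  proof -
    \<comment> \<open>If some \<open>v \<in> V\<close> moves \<open>k\<close> out of
      \<open>K i\<close>, the trivial bound 1 is charged to that \<open>v\<close>. Otherwise
      \<open>k\<close> can leave only when the cocycle takes a value outside
      \<open>V\<close>.\<close>
    have "prob {x \<in> space M. c h x \<otimes> k \<notin> K i} \<le> r / 2 + (\<Sum>v\<in>V. if v \<otimes> k \<notin> K i then 1 else 0)" for k
    proof (cases "\<exists>v\<in>V. v \<otimes> k \<notin> K i")
      case True
      then obtain v where v: "v \<in> V" "v \<otimes> k \<notin> K i" by blast
      have "(1::real) \<le> (\<Sum>v\<in>V. if v \<otimes> k \<notin> K i then 1 else 0)"
        using member_le_sum[OF v(1), of "\<lambda>v. if v \<otimes> k \<notin> K i then 1 else (0::real)"] v V by simp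
      moreover have "prob {x \<in> space M. c h x \<otimes> k \<notin> K i} \<le> 1" by simp
      ultimately show ?thesis using \<open>0 < r\<close> by linarith
    next
      case False
      have "prob {x \<in> space M. c h x \<otimes> k \<notin> K i} \<le> prob {x \<in> space M. c h x \<in> - V}"
        using False by (intro finite_measure_mono c_sets[OF h]) auto
      moreover have "0 \<le> (\<Sum>v\<in>V. if v \<otimes> k \<notin> K i then 1 else (0::real))" by (intro sum_nonneg) auto
      ultimately show ?thesis using V(3) by simp
    qed
    then have "(\<integral>x. bdry h (K i) x \<partial>M) \<le> (\<Sum>k\<in>K i. r / 2 + (\<Sum>v\<in>V. if v \<otimes> k \<notin> K i then 1 else 0))"
      unfolding bdry_integral(2)[OF h folnerD(1,3)[OF K]] by (intro sum_mono)
    also have "\<dots> = card (K i) * (r / 2) + (\<Sum>v\<in>V. \<Sum>k\<in>K i. if v \<otimes> k \<notin> K i then 1 else 0)"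
      by (simp add: sum.distrib sum.swap[of _ V])
    also have "(\<Sum>v\<in>V. \<Sum>k\<in>K i. if v \<otimes> k \<notin> K i then 1 else (0::real)) = (\<Sum>v\<in>V. card {k \<in> K i. v \<otimes> k \<notin> K i})"
      using folnerD(1)[OF K] by (simp flip: sum.inter_filter)
    finally show ?thesis by simp
  qed
  have "norm ((\<integral>x. bdry h (K i) x \<partial>M) / card (K i)) < r" if "i \<ge> N" for i
  proof -
    have pos: "0 < real (card (K i))" using folnerD(4)[OF K] by simp
    have "(\<integral>x. bdry h (K i) x \<partial>M) / card (K i) \<le> (card (K i) * (r / 2) + (\<Sum>v\<in>V. card {k \<in> K i. v \<otimes> k \<notin> K i})) / card (K i)"
      using bound[of i] pos by (intro divide_right_mono) auto
    also have "\<dots> = r / 2 + ?e i" using pos by (simp add: add_divide_distrib sum_divide_distrib)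
    also have "\<dots> < r" using N[OF that] by simp
    finally show ?thesis by (simp add: bdry_def integral_nonneg)
  qed
  then show "\<exists>N. \<forall>i\<ge>N. norm ((\<integral>x. bdry h (K i) x \<partial>M) / card (K i) - 0) < r" by auto
qed

lemma bdry_sum_limit:
  assumes E: "finite E" "E \<subseteq> carrier G'" and K: "folner_sequence G K"
  shows "(\<lambda>i. (\<Sum>h\<in>E. \<integral>x. bdry h (K i) x \<partial>M) / card (K i)) \<longlonglongrightarrow> 0"
proof -
  have "(\<lambda>i. \<Sum>h\<in>E. (\<integral>x. bdry h (K i) x \<partial>M) / card (K i)) \<longlonglongrightarrow> (\<Sum>h\<in>E. 0)"
    using E by (intro tendsto_sum bdry_limit K) auto
  then show ?thesis by (simp add: sum_divide_distrib)
qed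

text \<open>\<open>S\<close> is the orbit segment over \<open>K\<close> read in the coordinates of
  the second group; freeness of both actions makes the change of coordinates \<open>d\<close> a
  bijection from \<open>K\<close> onto \<open>S\<close>. A point of \<open>h S\<close> outside
  \<open>S\<close> is a point of the segment moved out of it by \<open>U h\<close>, and these are
  what \<open>bdry\<close> counts.\<close>

lemma orbit_window:
  assumes x: "good x" "orbit G T x = orbit G' U x" and K: "finite K" "K \<subseteq> carrier G"
  defines "S \<equiv> {s \<in> carrier G'. U s x \<in> (\<lambda>k. T k x) ` K}"
  shows "finite S" "card S = card K"
    and "\<And>h. h \<in> carrier G' \<Longrightarrow> card (sym_diff (h <#\<^bsub>G'\<^esub> S) S) \<le> 2 * bdry h K x"
proof -
  note xM = good_space[OF x(1)]
  have "\<exists>s. s \<in> carrier G' \<and> U s x = T k x" if "k \<in> carrier G" for k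
  proof -
    have "T k x \<in> orbit G' U x" unfolding x(2)[symmetric] using that by (auto simp: orbit_def)
    then show ?thesis by (auto simp: orbit_def)
  qed
  then obtain d where d: "\<And>k. k \<in> carrier G \<Longrightarrow> d k \<in> carrier G' \<and> U (d k) x = T k x" by metis
  have U_inj: "s = s'" if "s \<in> carrier G'" "s' \<in> carrier G'" "U s x = U s' x" for s s'
    using good_U_inj[OF x(1) one_closed that(1,2)] that(3) by (simp add: T_one[OF xM])
  have S: "S = d ` K"
    unfolding S_def using d K U_inj by (auto simp: subset_iff) (metis imageI)
  show "finite S" unfolding S using K by simp
  have inj_d: "inj_on d K"
  proof (rule inj_onI)
    fix k k' assume k: "k \<in> K" "k' \<in> K" "d k = d k'"
    then have "T k x = T k' x" using d K by (metis subsetD)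
    then show "k = k'" using k K good_T_inj[OF x(1)] by (meson subsetD)
  qed
  then show cardS: "card S = card K" unfolding S by (rule card_image)
  fix h assume h: "h \<in> carrier G'"
  have SG: "S \<subseteq> carrier G'" by (auto simp: S_def)
  let ?hS = "(\<lambda>s. h \<otimes>\<^bsub>G'\<^esub> s) ` S"
  have hS: "h <#\<^bsub>G'\<^esub> S = ?hS" by (auto simp: l_coset_def)
  have "inj_on (\<lambda>s. h \<otimes>\<^bsub>G'\<^esub> s) S" using h SG by (intro inj_onI) (auto simp: subset_iff)
  then have card_hS: "card ?hS = card S" by (rule card_image)
  have fin: "finite S" "finite ?hS" using \<open>finite S\<close> by auto
  have "?hS - S \<subseteq> (\<lambda>k. h \<otimes>\<^bsub>G'\<^esub> d k) ` {k \<in> K. c h (T k x) \<otimes> k \<notin> K}"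
  proof
    fix s assume s: "s \<in> ?hS - S"
    then obtain k where k: "k \<in> K" "s = h \<otimes>\<^bsub>G'\<^esub> d k" by (auto simp: S)
    have kG: "k \<in> carrier G" using k K by auto
    have sG: "s \<in> carrier G'" using k d[OF kG] h by simp
    have "U s x = U h (T k x)" using k d[OF kG] h xM by (simp add: U.T_mult)
    also have "\<dots> = T (c h (T k x) \<otimes> k) x" using good_cocycle(1)[OF x(1) kG h] by simp
    finally have "c h (T k x) \<otimes> k \<notin> K" using s sG by (auto simp: S_def)
    then show "s \<in> (\<lambda>k. h \<otimes>\<^bsub>G'\<^esub> d k) ` {k \<in> K. c h (T k x) \<otimes> k \<notin> K}" using k by blast
  qed
  then have "card (?hS - S) \<le> card ((\<lambda>k. h \<otimes>\<^bsub>G'\<^esub> d k) ` {k \<in> K. c h (T k x) \<otimes> k \<notin> K})"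
    using K by (intro card_mono) auto
  also have "\<dots> \<le> card {k \<in> K. c h (T k x) \<otimes> k \<notin> K}" using K by (intro card_image_le) auto
  finally have 1: "real (card (?hS - S)) \<le> bdry h K x" by (simp add: bdry_def)
  \<comment> \<open>Sets of equal size have equally large differences, hence the factor 2 in the
    conclusion.\<close>
  have "card (S - ?hS) = card (?hS - S)"
    using card_Int_Diff[OF fin(1), of ?hS] card_Int_Diff[OF fin(2), of S] card_hS by (simp add: Int_commute)
  moreover have "card (sym_diff ?hS S) = card (?hS - S) + card (S - ?hS)"
    using fin by (intro card_Un_disjoint) auto
  ultimately show "card (sym_diff (h <#\<^bsub>G'\<^esub> S) S) \<le> 2 * bdry h K x" using 1 unfolding hS by simp
qed

text \<open>The boundary is small on average over \<open>x\<close>, so it is small at some good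
  point whose two orbits agree, and the orbit segment there is the required set. The average is
  pushed below \<open>e / 2\<close> to absorb the factor 2 of \<open>orbit_window\<close>.\<close>

lemma almost_invariant_window:
  assumes K: "folner_sequence G K" and orb: "same_orbits M G T G' U"
    and E: "finite E" "E \<subseteq> carrier G'" and "0 < e"
  shows "\<exists>S. finite S \<and> S \<noteq> {} \<and> S \<subseteq> carrier G' \<and>
    (\<forall>h\<in>E. card (sym_diff (h <#\<^bsub>G'\<^esub> S) S) / card S \<le> e)"
proof -
  have "\<forall>\<^sub>F i in sequentially. (\<Sum>h\<in>E. \<integral>x. bdry h (K i) x \<partial>M) / card (K i) < e / 2"
    using bdry_sum_limit[OF E K] \<open>0 < e\<close> by (intro order_tendstoD) auto
  then obtain i where i: "(\<Sum>h\<in>E. \<integral>x. bdry h (K i) x \<partial>M) / card (K i) < e / 2"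
    by (auto simp: eventually_sequentially)
  note KD = folnerD[OF K, of i]
  have int: "integrable M (bdry h (K i))" if "h \<in> E" for h using that E KD by (intro bdry_integral) auto
  have "\<exists>x. good x \<and> orbit G T x = orbit G' U x \<and> (\<Sum>h\<in>E. bdry h (K i) x) \<le> e / 2 * card (K i)"
  proof (rule ccontr)
    assume neg: "\<not> ?thesis"
    have "AE x in M. e / 2 * card (K i) \<le> (\<Sum>h\<in>E. bdry h (K i) x)"
      using AE_good orb unfolding same_orbits_def
    proof eventually_elim
      case (elim x)
      then show ?case using neg by (meson nle_le)
    qed
    then have "(\<integral>x. e / 2 * card (K i) \<partial>M) \<le> (\<integral>x. (\<Sum>h\<in>E. bdry h (K i) x) \<partial>M)"
      using int by (intro integral_mono_AE Bochner_Integration.integrable_sum) auto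
    then have "e / 2 * card (K i) \<le> (\<Sum>h\<in>E. \<integral>x. bdry h (K i) x \<partial>M)"
      using int by (simp add: prob_space)
    then show False using i KD by (simp add: field_simps)
  qed
  then obtain x where x: "good x" "orbit G T x = orbit G' U x" "(\<Sum>h\<in>E. bdry h (K i) x) \<le> e / 2 * card (K i)"
    by blast
  define S where "S = {s \<in> carrier G'. U s x \<in> (\<lambda>k. T k x) ` K i}"
  note W = orbit_window[OF x(1,2) KD(1,3), folded S_def]
  have "card (sym_diff (h <#\<^bsub>G'\<^esub> S) S) / card S \<le> e" if "h \<in> E" for h
  proof -
    have "bdry h (K i) x \<le> (\<Sum>h\<in>E. bdry h (K i) x)"
      using E that by (intro member_le_sum) (auto simp: bdry_def)
    then have "card (sym_diff (h <#\<^bsub>G'\<^esub> S) S) \<le> e * card (K i)"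
      using W(3)[of h] that E x(3) by auto
    then show ?thesis using W(2) KD(4) by (simp add: field_simps)
  qed
  moreover have "S \<noteq> {}" using W(2) KD(4) by auto
  ultimately show ?thesis using W(1) by (intro exI[of _ S]) (auto simp: S_def)
qed

text \<open>Diagonal choice: the \<open>n\<close>-th set is nearly invariant, with tolerance
  \<open>1 / (n + 1)\<close>, under the elements \<open>f 0\<close> to \<open>f n\<close> of an
  enumeration of the group.\<close>

lemma amenable_orbit_change:
  assumes G: "amenable G" and orb: "same_orbits M G T G' U"
  shows "amenable G'"
proof -
  obtain K where K: "folner_sequence G K" using G by (auto simp: amenable_def)
  define f where "f = from_nat_into (carrier G')"
  have f: "range f = carrier G'"
    unfolding f_def using U.count_G U.one_closed by (intro range_from_nat_into) auto
  have "\<forall>n. \<exists>S. finite S \<and> S \<noteq> {} \<and> S \<subseteq> carrier G' \<and>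
    (\<forall>h\<in>f ` {..n}. card (sym_diff (h <#\<^bsub>G'\<^esub> S) S) / card S \<le> inverse (real (Suc n)))"
    using f by (intro allI almost_invariant_window[OF K orb]) auto
  then obtain S where S: "\<And>n. finite (S n) \<and> S n \<noteq> {} \<and> S n \<subseteq> carrier G'"
    "\<And>n h. h \<in> f ` {..n} \<Longrightarrow> card (sym_diff (h <#\<^bsub>G'\<^esub> S n) (S n)) / card (S n) \<le> inverse (real (Suc n))"
    by metis
  have "(\<lambda>n. card (sym_diff (h <#\<^bsub>G'\<^esub> S n) (S n)) / card (S n)) \<longlonglongrightarrow> 0" if "h \<in> carrier G'" for h
  proof (rule tendsto_sandwich[OF _ _ tendsto_const LIMSEQ_inverse_real_of_nat])
    have "h \<in> range f" unfolding f by (fact that)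
    then obtain m where m: "h = f m" by (rule rangeE)
    show "\<forall>\<^sub>F n in sequentially. card (sym_diff (h <#\<^bsub>G'\<^esub> S n) (S n)) / card (S n) \<le> inverse (real (Suc n))"
      using eventually_ge_at_top[of m]
    proof eventually_elim
      case (elim n)
      then have "h \<in> f ` {..n}" unfolding m by simp
      then show ?case by (rule S(2))
    qed
  qed auto
  then have "folner_sequence G' S" using S(1) by (simp add: folner_sequence_def)
  then show ?thesis by (auto simp: amenable_def)
qed

end

section \<open>Windows transported by an orbit change\<close>

locale factor_cocycle = orbit_cocycle M G T G' U c + factor_action M G T B + UB: factor_action M G' U B
  for M :: "'a measure" and G :: "('g, 'm) monoid_scheme" (structure) and T
    and G' :: "('h, 'n) monoid_scheme" and U c B +
  assumes c_meas_B: "h \<in> carrier G' \<Longrightarrow> c h \<in> measurable B (count_space (carrier G))"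
begin

text \<open>On the \<open>B\<close>-measurable set where the cocycle values along \<open>E\<close> are prescribed, the \<open>E\<close>-name
  under \<open>U\<close> and the corresponding name under \<open>T\<close> are the same partition.\<close>

lemma AE_ent_cocycle:
  assumes P: "simple_function M P" and E: "finite E" "E \<subseteq> carrier G'" and g: "g \<in> carrier G"
  shows "AE x in M. ent (cprob M B (T g x)) (space M) (translates_join U P E)
    = ent (cprob M B x) (space M) (translates_join T P ((\<lambda>h. c h (T g x) \<otimes> g) ` E))"
proof -
  let ?X = "space M"
  let ?f = "\<lambda>x. translates_join U P E (T g x)"
  have PE: "simple_function M (translates_join U P E)" by (rule U.simple_translates[OF P E])
  have f: "simple_function M ?f" by (rule simple_T[OF g PE])
  have equi: "AE x in M. ent (cprob M B (T g x)) ?X (translates_join U P E) = ent (cprob M B x) ?X ?f"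
    using g by (intro AE_ent_equivariant[where s = "T (inv g)"] PE T_meas T_distr T_meas_B T_inv) auto
  define D where "D = (\<Pi>\<^sub>E h\<in>E. carrier G)"
  have D: "countable D" unfolding D_def using E count_G by (intro countable_PiE) auto
  define W where "W d = {x \<in> ?X. \<forall>h\<in>E. c h (T g x) \<otimes> g = d h}" for d
  have local: "AE x in M. x \<in> W d \<longrightarrow> ent (cprob M B x) ?X ?f = ent (cprob M B x) ?X (translates_join T P (d ` E))"
    if d: "d \<in> D" for d
  proof -
    have dG: "d h \<in> carrier G" if "h \<in> E" for h using d that by (auto simp: D_def)
    have "W d = {x \<in> space B. \<forall>h\<in>E. c h (T g x) \<otimes> g = d h}" by (simp add: W_def space_B)
    also have "\<dots> \<in> sets B"
    proof (rule sets.sets_Collect_finite_All[OF _ E(1)])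
      fix h assume h: "h \<in> E"
      have "(\<lambda>x. c h (T g x)) \<in> measurable B (count_space (carrier G))"
        using measurable_compose[OF T_meas_B[OF g] c_meas_B] h E by auto
      then have "(\<lambda>x. c h (T g x)) -` {v \<in> carrier G. v \<otimes> g = d h} \<inter> space B \<in> sets B"
        by (rule measurable_sets) auto
      also have "(\<lambda>x. c h (T g x)) -` {v \<in> carrier G. v \<otimes> g = d h} \<inter> space B = {x \<in> space B. c h (T g x) \<otimes> g = d h}"
        using h E g c_carrier T_space by (auto simp: space_B)
      finally show "{x \<in> space B. c h (T g x) \<otimes> g = d h} \<in> sets B" .
    qed
    finally have W: "W d \<in> sets B" .
    let ?g = "\<lambda>x. \<lambda>h\<in>E. P (T (d h) x)"
    have sg: "simple_function M ?g"
      using dG by (intro simple_function_restrict simple_T P E) auto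
    have "AE x in M. x \<in> W d \<longrightarrow> ?f x = ?g x"
      using AE_good
    proof eventually_elim
      case (elim x)
      show ?case
      proof
        assume "x \<in> W d"
        then have "T (d h) x = U h (T g x)" if "h \<in> E" for h
          using good_cocycle(1)[OF elim g, of h] that E by (auto simp: W_def)
        then show "?f x = ?g x" by (simp add: translates_join_def restrict_def fun_eq_iff)
      qed
    qed
    from AE_ent_local[OF W f sg this]
    have "AE x in M. x \<in> W d \<longrightarrow> ent (cprob M B x) ?X ?f = ent (cprob M B x) ?X ?g" .
    moreover have "?g x = ?g y \<longleftrightarrow> (\<forall>h\<in>E. P (T (d h) x) = P (T (d h) y))" for x y
      by (auto simp: fun_eq_iff restrict_def)
    then have "ent m ?X ?g = ent m ?X (translates_join T P (d ` E))" for m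
      by (intro ent_kernel) (simp add: translates_eq_iff)
    ultimately show ?thesis by simp
  qed
  have "AE x in M. \<forall>d\<in>D. x \<in> W d \<longrightarrow> ent (cprob M B x) ?X ?f = ent (cprob M B x) ?X (translates_join T P (d ` E))"
    using D local by (simp add: AE_ball_countable)
  with equi AE_space show ?thesis
  proof eventually_elim
    case (elim x)
    define d where "d = (\<lambda>h\<in>E. c h (T g x) \<otimes> g)"
    have "d \<in> D" unfolding d_def D_def using E g c_carrier T_space[OF g elim(2)] by auto
    moreover have "x \<in> W d" using elim(2) by (auto simp: W_def d_def)
    moreover have "d ` E = (\<lambda>h. c h (T g x) \<otimes> g) ` E" by (auto simp: d_def)
    ultimately show ?case using elim(1,3) by metis
  qed
qed

text \<open>Shearer's inequality for the conditional probabilities at one fixed good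
  \<open>x\<close>. The window at \<open>g\<close> consists of the coordinates of the points
  \<open>U h (T g x)\<close> with \<open>h \<in> E\<close>, and \<open>AE_ent_cocycle\<close>
  identifies its entropy with that of the \<open>E\<close>-name under \<open>U\<close> at the point
  \<open>T g x\<close>.\<close>

lemma AE_shearer_cocycle:
  assumes P: "simple_function M P" and E: "finite E" "E \<subseteq> carrier G'" and K: "finite K" "K \<subseteq> carrier G"
  shows "AE x in M. card E * ent (cprob M B x) (space M) (translates_join T P K)
    \<le> (\<Sum>g\<in>K. ent (cprob M B (T g x)) (space M) (translates_join U P E))
      + card (P ` space M) * card E * (\<Sum>h\<in>E. bdry (inv\<^bsub>G'\<^esub> h) K x)"
proof -
  let ?X = "space M"
  \<comment> \<open>The windows vary with \<open>x\<close>, so additivity is secured for all finite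
    \<open>F\<close> at once before a point is fixed.\<close>
  have "countable {F. F \<subseteq> carrier G \<and> finite F}"
    using countable_Collect_finite_subset[OF count_G] by (simp add: conj_commute)
  then have "AE x in M. \<forall>F\<in>{F. F \<subseteq> carrier G \<and> finite F}. prob_on (cprob M B x) ?X (translates_join T P F)"
    by (subst AE_ball_countable) (auto intro!: AE_prob_on simple_translates P)
  moreover have "AE x in M. \<forall>g\<in>carrier G. ent (cprob M B (T g x)) ?X (translates_join U P E)
    = ent (cprob M B x) ?X (translates_join T P ((\<lambda>h. c h (T g x) \<otimes> g) ` E))"
    using count_G AE_ent_cocycle[OF P E] by (simp add: AE_ball_countable)
  moreover note AE_good
  ultimately show ?thesis
  proof eventually_elim
    case (elim x)
    note good = elim(3)
    note x = good_space[OF good]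
    define m where "m = cprob M B x"
    have pr: "prob_on m ?X (translates_join T P F)" if "finite F" "F \<subseteq> carrier G" for F
      using elim(1) that by (simp add: m_def)
    define \<psi> where "\<psi> F = ent m ?X (translates_join T P F)" for F
    have "submodular_rank (carrier G) (\<lambda>F. ent m ?X (\<lambda>x. (\<lambda>g\<in>F. P (T g x), ())) - ent m ?X (\<lambda>x. ()))"
    proof (rule submodular_rank_ent)
      fix F assume "finite F" "F \<subseteq> carrier G"
      from pr[OF this] show "prob_on m ?X (\<lambda>x. (\<lambda>g\<in>F. P (T g x), ()))"
        by (rule prob_on_factor) (simp add: translates_join_def)
    qed
    moreover have "ent m ?X (\<lambda>x. ()) = 0"
      using prob_onD(2)[OF pr[of "{}"]] by (intro ent_const) auto
    moreover have "ent m ?X (\<lambda>x. (\<lambda>g\<in>F. P (T g x), ())) = \<psi> F" for F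
      unfolding \<psi>_def by (intro ent_kernel) (simp add: translates_join_def)
    ultimately have rank: "submodular_rank (carrier G) \<psi>" by simp
    define S where "S g = (\<lambda>h. c h (T g x) \<otimes> g) ` E" for g
    \<comment> \<open>The window having \<open>T k x\<close> in position \<open>h\<close> must be
      based at \<open>U (inv h) (T k x)\<close>, whose coordinate this is.\<close>
    define r where "r h k = c (inv\<^bsub>G'\<^esub> h) (T k x) \<otimes> k" for h k
    have r: "r h k \<in> carrier G" "T (r h k) x = U (inv\<^bsub>G'\<^esub> h) (T k x)" if "h \<in> E" "k \<in> K" for h k
      using good_cocycle[OF good, of k "inv\<^bsub>G'\<^esub> h"] that E K by (auto simp: r_def)
    have "card E * \<psi> K \<le> (\<Sum>g\<in>K. ent (cprob M B (T g x)) ?X (translates_join U P E))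
      + real (card (P ` ?X)) * card E * (\<Sum>h\<in>E. card {k \<in> K. r h k \<notin> K})"
    proof (rule shearer_boundary[OF rank K E(1), where S = S])
      show "r h k \<in> carrier G" if "h \<in> E" "k \<in> K" for h k by (rule r(1)[OF that])
      show "inj_on (\<lambda>h. r h k) E" if k: "k \<in> K" for k
      proof (rule inj_onI)
        fix h h' assume h: "h \<in> E" "h' \<in> E" "r h k = r h' k"
        then have "U (inv\<^bsub>G'\<^esub> h) (T k x) = U (inv\<^bsub>G'\<^esub> h') (T k x)" using r(2) k by metis
        then have "inv\<^bsub>G'\<^esub> h = inv\<^bsub>G'\<^esub> h'"
          using good k K h E by (intro good_U_inj[of x k]) auto
        then show "h = h'" using h E by (metis U.inv_inv subsetD)
      qed
      show "finite (S g) \<and> S g \<subseteq> carrier G \<and> card (S g) \<le> card E" if "g \<in> carrier G" for g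
        unfolding S_def using good_cocycle(2)[OF good that] E by (auto intro: card_image_le)
      show "k \<in> S (r h k)" if hk: "h \<in> E" "k \<in> K" for h k
      proof -
        have hG: "h \<in> carrier G'" and kG: "k \<in> carrier G" using hk E K by auto
        have "T (c h (T (r h k) x) \<otimes> r h k) x = U h (T (r h k) x)"
          by (rule good_cocycle(1)[OF good r(1)[OF hk] hG])
        also have "\<dots> = T k x" unfolding r(2)[OF hk] using U.T_inv(2) T_space[OF kG x] hG by simp
        finally have "c h (T (r h k) x) \<otimes> r h k = k"
          by (intro good_T_inj[OF good good_cocycle(2)[OF good r(1)[OF hk] hG] kG])
        then show ?thesis unfolding S_def using hk(1) by force
      qed
      show "\<psi> (S g) \<le> ent (cprob M B (T g x)) ?X (translates_join U P E)" if "g \<in> K" for g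
        using elim(2) that K by (auto simp: \<psi>_def S_def m_def)
      show "\<psi> {k} \<le> real (card (P ` ?X))" if "k \<in> K" for k
      proof -
        have k: "k \<in> carrier G" using that K by auto
        have "\<psi> {k} \<le> card (translates_join T P {k} ` ?X)"
          unfolding \<psi>_def using k by (intro ent_le_card pr) auto
        also have "translates_join T P {k} ` ?X \<subseteq> (\<lambda>s. \<lambda>g\<in>{k}. s) ` (P ` ?X)"
        proof
          fix w assume "w \<in> translates_join T P {k} ` ?X"
          then obtain y where y: "y \<in> ?X" "w = translates_join T P {k} y" by blast
          have "w = (\<lambda>g\<in>{k}. P (T k y))" unfolding y(2) by (simp add: translates_join_def fun_eq_iff restrict_def)
          then show "w \<in> (\<lambda>s. \<lambda>g\<in>{k}. s) ` (P ` ?X)" using T_space[OF k y(1)] by blast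
        qed
        then have "card (translates_join T P {k} ` ?X) \<le> card ((\<lambda>s. \<lambda>g\<in>{k}. s) ` (P ` ?X))"
          using simple_functionD(1)[OF P] by (intro card_mono) auto
        also have "\<dots> \<le> card (P ` ?X)" using simple_functionD(1)[OF P] by (rule card_image_le)
        finally show ?thesis by simp
      qed
    qed auto
    then show ?case by (simp add: \<psi>_def m_def r_def bdry_def)
  qed
qed

text \<open>Integrating the pointwise bound removes the dependence on the base point:
  \<open>T g\<close> preserves the measure, so each \<open>g \<in> K i\<close> contributes the same
  conditional entropy of the \<open>E\<close>-name. After division by \<open>card E\<close> and
  \<open>card (K i)\<close> the boundary term vanishes in the limit.\<close>

lemma inf_cond_ent_le_cocycle:
  assumes P: "simple_function M P" and G: "amenable G"
  shows "inf_cond_ent P \<le> UB.inf_cond_ent P"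
proof -
  obtain K where K: "folner_sequence G K" using G by (auto simp: amenable_def)
  let ?X = "space M"
  have "inf_cond_ent P \<le> cond_ent M B (translates_join U P E) / card E" if "E \<in> U.finite_windows" for E
  proof -
    have E: "finite E" "E \<subseteq> carrier G'" "0 < card E" using U.finite_windowsD[OF that] by auto
    define C where "C = real (card (P ` ?X))"
    \<comment> \<open>Base points of windows are reached by inverses of elements of
      \<open>E\<close>, so the boundary terms involve these inverses.\<close>
    define E' where "E' = (\<lambda>h. inv\<^bsub>G'\<^esub> h) ` E"
    have E': "finite E'" "E' \<subseteq> carrier G'" using E by (auto simp: E'_def)
    have inj: "inj_on (\<lambda>h. inv\<^bsub>G'\<^esub> h) E" using E by (intro inj_onI) (metis U.inv_inv subsetD)
    have PE: "simple_function M (translates_join U P E)" by (rule U.simple_translates[OF P E(1,2)])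
    let ?u = "\<lambda>x. ent (cprob M B x) ?X (translates_join U P E)"
    have int_u: "integrable M (\<lambda>x. ?u (T g x))" "(\<integral>x. ?u (T g x) \<partial>M) = cond_ent M B (translates_join U P E)"
      if g: "g \<in> carrier G" for g
    proof -
      have "integrable (distr M M (T g)) ?u" unfolding T_distr[OF g] by (rule cond_ent_integrable[OF PE])
      then show "integrable M (\<lambda>x. ?u (T g x))" by (subst (asm) integrable_distr_eq[OF T_meas[OF g]]) auto
      have "(\<integral>x. ?u (T g x) \<partial>M) = (\<integral>x. ?u x \<partial>distr M M (T g))"
        by (rule integral_distr[OF T_meas[OF g], symmetric]) simp
      then show "(\<integral>x. ?u (T g x) \<partial>M) = cond_ent M B (translates_join U P E)"
        unfolding T_distr[OF g] cond_ent_def .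
    qed
    have bound: "inf_cond_ent P \<le> cond_ent M B (translates_join U P E) / card E
        + C * ((\<Sum>h\<in>E'. \<integral>x. bdry h (K i) x \<partial>M) / card (K i))" for i
    proof -
      note KD = folnerD[OF K, of i]
      have PK: "simple_function M (translates_join T P (K i))" by (rule simple_translates[OF P KD(1,3)])
      have int_b: "integrable M (bdry (inv\<^bsub>G'\<^esub> h) (K i))" if "h \<in> E" for h
        using that E KD by (intro bdry_integral) auto
      have int_s: "integrable M (\<lambda>x. \<Sum>g\<in>K i. ?u (T g x))"
        using KD int_u by (intro Bochner_Integration.integrable_sum) auto
      have int_e: "integrable M (\<lambda>x. C * card E * (\<Sum>h\<in>E. bdry (inv\<^bsub>G'\<^esub> h) (K i) x))"
        by (intro integrable_mult_right Bochner_Integration.integrable_sum int_b)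
      have "card E * cond_ent M B (translates_join T P (K i)) = (\<integral>x. card E * ent (cprob M B x) ?X (translates_join T P (K i)) \<partial>M)"
        by (simp add: cond_ent_def)
      also have "\<dots> \<le> (\<integral>x. (\<Sum>g\<in>K i. ?u (T g x)) + C * card E * (\<Sum>h\<in>E. bdry (inv\<^bsub>G'\<^esub> h) (K i) x) \<partial>M)"
        using AE_shearer_cocycle[OF P E(1,2) KD(1,3)] cond_ent_integrable[OF PK]
        by (intro integral_mono_AE Bochner_Integration.integrable_add int_s int_e integrable_mult_right)
          (auto simp: C_def)
      also have "\<dots> = (\<integral>x. (\<Sum>g\<in>K i. ?u (T g x)) \<partial>M) + (\<integral>x. C * card E * (\<Sum>h\<in>E. bdry (inv\<^bsub>G'\<^esub> h) (K i) x) \<partial>M)"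
        by (rule Bochner_Integration.integral_add[OF int_s int_e])
      also have "(\<integral>x. (\<Sum>g\<in>K i. ?u (T g x)) \<partial>M) = (\<Sum>g\<in>K i. \<integral>x. ?u (T g x) \<partial>M)"
        using KD int_u by (intro Bochner_Integration.integral_sum) auto
      also have "(\<integral>x. C * card E * (\<Sum>h\<in>E. bdry (inv\<^bsub>G'\<^esub> h) (K i) x) \<partial>M)
          = C * card E * (\<Sum>h\<in>E. \<integral>x. bdry (inv\<^bsub>G'\<^esub> h) (K i) x \<partial>M)"
        using int_b by (simp add: Bochner_Integration.integral_sum)
      also have "(\<Sum>g\<in>K i. \<integral>x. ?u (T g x) \<partial>M) = card (K i) * cond_ent M B (translates_join U P E)"
        using KD int_u by (simp add: subset_iff)
      also have "(\<Sum>h\<in>E. \<integral>x. bdry (inv\<^bsub>G'\<^esub> h) (K i) x \<partial>M) = (\<Sum>h\<in>E'. \<integral>x. bdry h (K i) x \<partial>M)"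
        unfolding E'_def by (simp add: sum.reindex[OF inj])
      finally have le: "card E * cond_ent M B (translates_join T P (K i)) \<le> card (K i) * cond_ent M B (translates_join U P E)
        + C * card E * (\<Sum>h\<in>E'. \<integral>x. bdry h (K i) x \<partial>M)" .
      have arith: "a / n \<le> u / e + C * (b / n)" if "e * a \<le> n * u + C * e * b" "0 < e" "0 < n" for a b e n u :: real
      proof -
        have "a \<le> (n * u + C * e * b) / e" using that by (simp add: field_simps)
        also have "\<dots> = (u / e + C * (b / n)) * n" using that by (simp add: field_simps)
        finally show ?thesis using that by (simp add: pos_divide_le_eq)
      qed
      have "cond_ent M B (translates_join T P (K i)) / card (K i) \<le> cond_ent M B (translates_join U P E) / card E
        + C * ((\<Sum>h\<in>E'. \<integral>x. bdry h (K i) x \<partial>M) / card (K i))"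
        using arith[OF le] KD E by simp
      then show ?thesis using inf_cond_ent_le[OF P folner_window[OF K, of i]] by linarith
    qed
    have "(\<lambda>i. C * ((\<Sum>h\<in>E'. \<integral>x. bdry h (K i) x \<partial>M) / card (K i))) \<longlonglongrightarrow> 0"
      by (intro tendsto_mult_right_zero bdry_sum_limit[OF E' K])
    from tendsto_add[OF tendsto_const[of "cond_ent M B (translates_join U P E) / card E"] this]
    have "(\<lambda>i. cond_ent M B (translates_join U P E) / card E
        + C * ((\<Sum>h\<in>E'. \<integral>x. bdry h (K i) x \<partial>M) / card (K i))) \<longlonglongrightarrow> cond_ent M B (translates_join U P E) / card E"
      by simp
    then show ?thesis by (rule LIMSEQ_le_const) (use bound in blast)
  qed
  then show ?thesis unfolding UB.inf_cond_ent_def by (intro cINF_greatest U.finite_windows_nonempty)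
qed

end

section \<open>Invariance of relative entropy\<close>

lemma null_modification:
  assumes B: "subalgebra M B" "null_sets M \<subseteq> sets B" and S: "S \<in> sets B" "S' \<in> sets M"
    and eq: "AE x in M. x \<in> S \<longleftrightarrow> x \<in> S'"
  shows "S' \<in> sets B"
proof -
  have SM: "S \<in> sets M" using B S by (auto simp: subalgebra_def)
  have "sym_diff S S' = {x \<in> space M. \<not> (x \<in> S \<longleftrightarrow> x \<in> S')}"
    using sets.sets_into_space[OF SM] sets.sets_into_space[OF S(2)] by auto
  then have "sym_diff S S' \<in> null_sets M"
    using eq SM S(2) by (subst (asm) AE_iff_null) auto
  then have null: "S - S' \<in> null_sets M" "S' - S \<in> null_sets M"
    using SM S(2) by (auto elim!: null_sets_subset)
  then have "S - S' \<in> sets B" "S' - S \<in> sets B" using B(2) by blast+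
  then have "S - (S - S') \<union> (S' - S) \<in> sets B" using S(1) by blast
  moreover have "S - (S - S') \<union> (S' - S) = S'" by auto
  ultimately show ?thesis by simp
qed

context pmp_action
begin

lemma T_null: "g \<in> carrier G \<Longrightarrow> N \<in> null_sets M \<Longrightarrow> T g -` N \<inter> space M \<in> null_sets M"
  using emeasure_distr[OF T_meas[of g], of N] measurable_sets[OF T_meas[of g], of N]
  by (auto simp: T_distr null_sets_def)

text \<open>The preimage of \<open>S\<close> differs from \<open>C'\<close> only inside the preimage
  of \<open>sym_diff S C\<close>, null because \<open>T g\<close> preserves the measure, and the
  null error granted by invariance modulo null sets.\<close>

lemma T_meas_null_completion:
  assumes inv: "invariant_subalgebra M G T A" and g: "g \<in> carrier G"
  shows "T g \<in> measurable (null_completion M A) (null_completion M A)"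
proof (rule measurableI)
  have A: "subalgebra M A" using inv by (simp add: invariant_subalgebra_def)
  fix S assume "S \<in> sets (null_completion M A)"
  then obtain C where C: "S \<in> sets M" "C \<in> sets A" "sym_diff S C \<in> null_sets M"
    unfolding sets_null_completion[OF A] by auto
  have CM: "C \<in> sets M" using A C(2) by (auto simp: subalgebra_def)
  obtain C' where C': "C' \<in> sets A" "sym_diff (T g -` C \<inter> space M) C' \<in> null_sets M"
    using inv g C(2) unfolding invariant_subalgebra_def by blast
  have C'M: "C' \<in> sets M" using A C'(1) by (auto simp: subalgebra_def)
  have TS: "T g -` S \<inter> space M \<in> sets M" by (rule measurable_sets[OF T_meas[OF g] C(1)])
  have "(T g -` sym_diff S C \<inter> space M) \<union> sym_diff (T g -` C \<inter> space M) C' \<in> null_sets M"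
    using T_null[OF g C(3)] C'(2) by (rule null_sets.Un)
  then have "sym_diff (T g -` S \<inter> space M) C' \<in> null_sets M"
    using TS C'M by (elim null_sets_subset) auto
  then show "T g -` S \<inter> space (null_completion M A) \<in> sets (null_completion M A)"
    using TS C'(1) unfolding sets_null_completion[OF A] by auto
qed (use T_space g in simp)

text \<open>Up to a null set, \<open>u\<close> is glued from the maps \<open>T g\<close> on the
  countably many pieces where \<open>c\<close> equals \<open>g\<close>, and \<open>B\<close>
  contains the null sets. Applied to \<open>u = U h\<close>, this makes \<open>B\<close> invariant
  under the second action.\<close>

lemma piecewise_T_measurable:
  assumes B: "subalgebra M B" "null_sets M \<subseteq> sets B" and TB: "\<And>g. g \<in> carrier G \<Longrightarrow> T g \<in> measurable B B"
    and u: "u \<in> measurable M M" and c: "c \<in> measurable B (count_space (carrier G))"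
    and eq: "AE x in M. T (c x) x = u x"
  shows "u \<in> measurable B B"
proof (rule measurableI)
  have sp: "space B = space M" using B by (simp add: subalgebra_def)
  show "u x \<in> space B" if "x \<in> space B" for x using that measurable_space[OF u] by (simp add: sp)
  fix S assume S: "S \<in> sets B"
  have SM: "S \<in> sets M" using S B by (auto simp: subalgebra_def)
  define D where "D = (\<Union>g\<in>carrier G. (c -` {g} \<inter> space B) \<inter> (T g -` S \<inter> space B))"
  have "(c -` {g} \<inter> space B) \<inter> (T g -` S \<inter> space B) \<in> sets B" if "g \<in> carrier G" for g
    by (rule sets.Int[OF measurable_sets[OF c] measurable_sets[OF TB[OF that] S]]) (simp add: that)
  then have "D \<in> sets B" unfolding D_def using count_G by (intro sets.countable_UN') auto
  moreover have "u -` S \<inter> space M \<in> sets M" by (rule measurable_sets[OF u SM])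
  moreover have "AE x in M. x \<in> D \<longleftrightarrow> x \<in> u -` S \<inter> space M"
    using eq AE_space
  proof eventually_elim
    case (elim x)
    have "c x \<in> carrier G" using measurable_space[OF c, of x] elim(2) sp by simp
    then have "x \<in> D \<longleftrightarrow> T (c x) x \<in> S" using elim(2) sp by (auto simp: D_def)
    then show ?case using elim by simp
  qed
  ultimately have "u -` S \<inter> space M \<in> sets B" by (rule null_modification[OF B])
  then show "u -` S \<inter> space B \<in> sets B" by (simp add: sp)
qed

end

context factor_cocycle
begin

text \<open>By freeness, the \<open>h\<close> with \<open>U h x = T g x\<close> is recognised by
  \<open>c h x = g\<close>, a condition that is measurable for \<open>B\<close>. The reverse orbit
  change is therefore as measurable as the given one.\<close>

lemma inverse_cocycle:
  assumes orb: "same_orbits M G T G' U" and g: "g \<in> carrier G"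
  shows "\<exists>d\<in>measurable B (count_space (carrier G')). AE x in M. U (d x) x = T g x"
proof -
  define f where "f = from_nat_into (carrier G')"
  have f: "range f = carrier G'"
    unfolding f_def using U.count_G U.one_closed by (intro range_from_nat_into) auto
  have fG: "f n \<in> carrier G'" for n using f by auto
  \<comment> \<open>The first success in the enumeration. At points without any success the value is
    arbitrary, but almost every point has one.\<close>
  define d where "d x = f (LEAST n. c (f n) x = g)" for x
  have "Measurable.pred B (\<lambda>x. c (f n) x = g)" for n
    using measurable_compose[OF c_meas_B[OF fG], of "\<lambda>v. v = g" "count_space UNIV"] by simp
  then have "(\<lambda>x. LEAST n. c (f n) x = g) \<in> measurable B (count_space UNIV)" by (rule measurable_Least)
  then have "d \<in> measurable B (count_space (carrier G'))"
    unfolding d_def by (rule measurable_compose) (use fG in auto)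
  moreover have "AE x in M. U (d x) x = T g x"
    using AE_good orb unfolding same_orbits_def
  proof eventually_elim
    case (elim x)
    note x = good_space[OF elim(1)]
    have coc: "T (c h x) x = U h x" "c h x \<in> carrier G" if "h \<in> carrier G'" for h
      using good_cocycle[OF elim(1) one_closed that] x that c_carrier by (simp_all add: T_one)
    have "T g x \<in> orbit G' U x" unfolding elim(2)[symmetric] using g by (auto simp: orbit_def)
    then obtain h where h: "h \<in> carrier G'" "U h x = T g x" by (auto simp: orbit_def)
    have "h \<in> range f" unfolding f by (fact h(1))
    then obtain n where n: "h = f n" by (rule rangeE)
    have "c (f n) x = g"
      using coc[OF h(1)] h(2) g unfolding n by (intro good_T_inj[OF elim(1)]) auto
    then have "c (d x) x = g" unfolding d_def by (rule LeastI)
    then show "U (d x) x = T g x" using coc(1)[OF fG] unfolding d_def by metis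
  qed
  ultimately show ?thesis by blast
qed

end

text \<open>A \<open>U\<close>-invariant \<open>S\<close> need not be exactly
  \<open>T\<close>-invariant, as orbits agree only almost everywhere. It is replaced by the set
  \<open>S'\<close> of points whose whole \<open>T\<close>-orbit lies in \<open>S\<close>, which is
  exactly invariant and differs from \<open>S\<close> by a null set.\<close>

lemma ergodic_same_orbits:
  assumes "prob_space M" "mp_action M G T" "ergodic_action M G T" "mp_action M G' U" "same_orbits M G T G' U"
  shows "ergodic_action M G' U"
  unfolding ergodic_action_def
proof (intro ballI impI)
  interpret pmp_action M G T using assms by (simp add: pmp_action_def pmp_action_axioms_def)
  fix S assume S: "S \<in> sets M" and inv: "\<forall>h\<in>carrier G'. U h -` S \<inter> space M = S"
  define S' where "S' = {x \<in> space M. \<forall>g\<in>carrier G. T g x \<in> S}"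
  have "{x \<in> space M. T g x \<in> S} \<in> sets M" if "g \<in> carrier G" for g
    using measurable_sets[OF T_meas[OF that] S] by (simp add: vimage_def Int_def conj_commute)
  then have S'_meas: "S' \<in> sets M"
    unfolding S'_def using count_G by (intro sets.sets_Collect_countable_All') auto
  have "T g -` S' \<inter> space M = S'" if g: "g \<in> carrier G" for g
  proof (intro equalityI subsetI)
    fix x assume x: "x \<in> T g -` S' \<inter> space M"
    have "T k x \<in> S" if k: "k \<in> carrier G" for k
    proof -
      have "T (k \<otimes>\<^bsub>G\<^esub> inv\<^bsub>G\<^esub> g) (T g x) \<in> S" using x g k by (auto simp: S'_def)
      then show ?thesis using x g k by (simp add: T_mult T_space T_inv)
    qed
    then show "x \<in> S'" using x by (simp add: S'_def)
  next
    fix x assume x: "x \<in> S'"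
    have "T k (T g x) \<in> S" if k: "k \<in> carrier G" for k
    proof -
      have "T (k \<otimes>\<^bsub>G\<^esub> g) x \<in> S" using x g k by (simp add: S'_def)
      then show ?thesis using x g k T_mult[of x k g] by (simp add: S'_def)
    qed
    then show "x \<in> T g -` S' \<inter> space M" using x g T_space by (auto simp: S'_def)
  qed
  then have "measure M S' = 0 \<or> measure M S' = 1"
    by (intro assms(3)[unfolded ergodic_action_def, rule_format, OF S'_meas])
  moreover have "AE x in M. x \<in> S' \<longleftrightarrow> x \<in> S"
    using assms(5) AE_space unfolding same_orbits_def
  proof eventually_elim
    case (elim x)
    show ?case
    proof
      assume "x \<in> S'"
      then have "T \<one>\<^bsub>G\<^esub> x \<in> S" by (auto simp: S'_def)
      then show "x \<in> S" using T_one[OF elim(2)] by simp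
    next
      assume x: "x \<in> S"
      have "T g x \<in> S" if "g \<in> carrier G" for g
      proof -
        have "T g x \<in> orbit G' U x" unfolding elim(1)[symmetric] using that by (auto simp: orbit_def)
        then obtain h where "h \<in> carrier G'" "T g x = U h x" by (auto simp: orbit_def)
        then show ?thesis using inv x by auto
      qed
      then show "x \<in> S'" using elim(2) by (simp add: S'_def)
    qed
  qed
  then have "measure M S' = measure M S" using S S'_meas by (intro measure_eq_AE) auto
  ultimately show "measure M S = 0 \<or> measure M S = 1" by simp
qed

theorem theorem2p6:
  fixes M A :: "'a measure"
    and G :: "('g, 'm) monoid_scheme" and G' :: "('h, 'n) monoid_scheme"
    and T :: "'g \<Rightarrow> 'a \<Rightarrow> 'a" and U :: "'h \<Rightarrow> 'a \<Rightarrow> 'a"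
    and P :: "'a \<Rightarrow> 's"
  assumes "standard_prob_space M"
    and "amenable G"
    and "mp_action M G T" and "free_action M G T" and "ergodic_action M G T"
    and "invariant_subalgebra M G T A"
    and "mp_action M G' U" and "free_action M G' U"
    and "same_orbits M G T G' U"
    and "orbit_change_measurable M A G T G' U"
    and "simple_function M P"
  shows "amenable G' \<and> ergodic_action M G' U \<and>
         rel_ds_entropy M G T P A = rel_ds_entropy M G' U P A"
proof -
  have prob: "prob_space M" using assms(1) by (simp add: standard_prob_space_def)
  interpret T: pmp_action M G T using prob assms(3) by (simp add: pmp_action_def pmp_action_axioms_def)
  interpret U: pmp_action M G' U using prob assms(7) by (simp add: pmp_action_def pmp_action_axioms_def)
  have A: "subalgebra M A" using assms(6) by (simp add: invariant_subalgebra_def)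
  \<comment> \<open>Conditioning is done on this one sigma-algebra for both actions, so the two
    infima of conditional entropies refer to the same \<open>cond_ent M B\<close>.\<close>
  define B where "B = null_completion M A"
  note B = subalgebra_null_completion[OF A, folded B_def]
  interpret prob_subalgebra M B using prob B(1) by (simp add: prob_subalgebra_def prob_subalgebra_axioms_def)
  have "subalgebra B A" using A B(2) by (simp add: subalgebra_def B_def)
  note A_B = measurable_from_subalg[OF this]
  have TB: "T g \<in> measurable B B" if "g \<in> carrier G" for g
    unfolding B_def by (rule T.T_meas_null_completion[OF assms(6) that])
  have "\<forall>h\<in>carrier G'. \<exists>c. c \<in> measurable A (count_space (carrier G)) \<and> (AE x in M. T (c x) x = U h x)"
    using assms(10) by (auto simp: orbit_change_measurable_def)
  then obtain c where c: "\<And>h. h \<in> carrier G' \<Longrightarrow> c h \<in> measurable A (count_space (carrier G))"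
    "\<And>h. h \<in> carrier G' \<Longrightarrow> AE x in M. T (c h x) x = U h x" by metis
  have UB: "U h \<in> measurable B B" if "h \<in> carrier G'" for h
    by (rule T.piecewise_T_measurable[OF B(1,3) TB U.T_meas[OF that] A_B[OF c(1)[OF that]] c(2)[OF that]])
  interpret TU: factor_cocycle M G T G' U c B
    by unfold_locales
      (use assms(4,8) TB UB A_B[OF c(1)] measurable_from_subalg[OF B(1) A_B[OF c(1)]] c(2) in auto)
  have amen: "amenable G'" by (rule TU.amenable_orbit_change[OF assms(2,9)])
  have orb': "same_orbits M G' U G T"
    using assms(9) unfolding same_orbits_def by eventually_elim simp
  have "\<forall>g\<in>carrier G. \<exists>d. d \<in> measurable B (count_space (carrier G')) \<and> (AE x in M. U (d x) x = T g x)"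
    using TU.inverse_cocycle[OF assms(9)] by blast
  then obtain d where d: "\<And>g. g \<in> carrier G \<Longrightarrow> d g \<in> measurable B (count_space (carrier G'))"
    "\<And>g. g \<in> carrier G \<Longrightarrow> AE x in M. U (d g x) x = T g x" by metis
  \<comment> \<open>The roles of the actions are exchanged over the same \<open>B\<close>; the
    reverse cocycle \<open>d\<close> is \<open>B\<close>-measurable, as the locale demands.\<close>
  interpret UT: factor_cocycle M G' U G T d B
    by unfold_locales (use assms(4,8) TB UB d measurable_from_subalg[OF B(1) d(1)] in auto)
  have approx: "\<exists>Q'. simple_function A Q' \<and> (AE x in M. Q x = Q' x)" if "simple_function B Q" for Q :: "'a \<Rightarrow> nat"
    using null_completion_simple[OF A that[unfolded B_def]] .
  have "rel_ds_entropy M G T P A = TU.inf_cond_ent P"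
    by (rule TU.rel_ds_entropy_eq[OF assms(11,2) A B(2) approx])
  moreover have "rel_ds_entropy M G' U P A = TU.UB.inf_cond_ent P"
    by (rule TU.UB.rel_ds_entropy_eq[OF assms(11) amen A B(2) approx])
  moreover have "TU.inf_cond_ent P \<le> TU.UB.inf_cond_ent P" by (rule TU.inf_cond_ent_le_cocycle[OF assms(11,2)])
  moreover have "TU.UB.inf_cond_ent P \<le> TU.inf_cond_ent P" by (rule UT.inf_cond_ent_le_cocycle[OF assms(11) amen])
  ultimately show ?thesis
    using amen ergodic_same_orbits[OF prob assms(3,5,7,9)] by simp
qed

end
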